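(* Let $(B(t))_{t\in\mathbb{Z}}$ be a centered complex-valued wide sense stationary sequence with spectral measure $\mu$ on $[-\pi,\pi)$, let $\mu=\mu_a+\mu_s$ be the decomposition of $\mu$ into its absolutely continuous and singular components with respect to Lebesgue measure, and let $f_a$ be the density of $\mu_a$. Let $L$ be a linear filter with measurable frequency characteristic $\ell:[-\pi,\pi)\to\mathbb{C}$. If $$\int_{-\pi}^{\pi}|\ln f_a(u)|\,du<\infty,$$ then $$\lim_{t\to-\infty}\sigma^2(t)=\mathbb{E}|B(0)|^2-\int_{-\pi}^{\pi}\frac{\mu_s(du)}{1+|\ell(u)|^2}.$$
   Context: A centered complex-valued sequence $(B(t))_{t\in\mathbb{Z}}$ is wide sense stationary if $\mathbb{E}B(t)=0$, $\mathbb{E}|B(t)|^2<\infty$ and $\mathbb{E}B(t+s)\overline{B(s)}=:K(t)$ does not depend on $s$. Its spectral measure is the finite measure $\mu$ on $[-\pi,\pi)$ with $K(t)=\int_{-\pi}^{\pi} e^{itu}\mu(du)$; one has $B(t)=\int e^{itu}\,\mathcal{W}(du)$ with an orthogonal random measure $\mathcal{W}$, $\mathbb{E}|\mathcal{W}(A)|^2=\mu(A)$. $H$ is the closed linear span of $\{B(s):s\in\mathbb{Z}\}$ in the Hilbert space of square integrable random variables, and $H_t$ is the closed linear span of $\{B(s):s\le t\}$. The stochastic integral $\phi\mapsto\int\phi\,d\mathcal{W}$ is a linear isometry of $L_2(\mu)$ onto $H$; for $\xi\in H$ write $\xi=\int\phi_\xi\,d\mathcal{W}$. The linear filter $L$ with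 frequency characteristic $\ell$ is $L\xi=\int\ell(u)\phi_\xi(u)\,\mathcal{W}(du)$ with domain $\mathcal{D}(L)=\{\xi\in H:\int|\ell\phi_\xi|^2d\mu<\infty\}$. The prediction errors are $$\sigma^2(t):=\inf_{Y\in H_t\cap\mathcal{D}(L)}\{\mathbb{E}|Y-B(0)|^2+\mathbb{E}|LY|^2\},\quad t\in\mathbb{Z}.$$ Convention: $|\ln 0|=\infty$. *)

theory Defs
  imports "HOL-Probability.Probability"
begin

section \<open>Square integrable functions\<close>

text \<open>
  Elements of an \<open>L\<^sub>2\<close> space are represented by functions. Everything below respects almost sure
  equality, so no quotient is formed.
\<close>

definition L2_space :: "'a measure \<Rightarrow> ('a \<Rightarrow> complex) set" where
  "L2_space M = {X \<in> borel_measurable M. integrable M (\<lambda>\<omega>. (cmod (X \<omega>))\<^sup>2)}"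

definition sq_dist :: "'a measure \<Rightarrow> ('a \<Rightarrow> complex) \<Rightarrow> ('a \<Rightarrow> complex) \<Rightarrow> real" where
  "sq_dist M X Y = (\<integral>\<omega>. (cmod (X \<omega> - Y \<omega>))\<^sup>2 \<partial>M)"

definition closed_lin_span :: "'a measure \<Rightarrow> (int \<Rightarrow> 'a \<Rightarrow> complex) \<Rightarrow> int set \<Rightarrow> ('a \<Rightarrow> complex) set" where
  "closed_lin_span M B T = {Y \<in> L2_space M.
     \<forall>e>0. \<exists>F c. finite F \<and> F \<subseteq> T \<and> sq_dist M Y (\<lambda>\<omega>. \<Sum>s\<in>F. c s * B s \<omega>) < e}"

section \<open>Wide sense stationary sequences and their spectral measures\<close>

definition wide_sense_stationary :: "'a measure \<Rightarrow> (int \<Rightarrow> 'a \<Rightarrow> complex) \<Rightarrow> bool" where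
  "wide_sense_stationary M B \<longleftrightarrow>
     (\<forall>t. B t \<in> L2_space M \<and> (\<integral>\<omega>. B t \<omega> \<partial>M) = 0) \<and>
     (\<forall>t s s'. (\<integral>\<omega>. B (t + s) \<omega> * cnj (B s \<omega>) \<partial>M) = (\<integral>\<omega>. B (t + s') \<omega> * cnj (B s' \<omega>) \<partial>M))"

definition autocov :: "'a measure \<Rightarrow> (int \<Rightarrow> 'a \<Rightarrow> complex) \<Rightarrow> int \<Rightarrow> complex" where
  "autocov M B t = (\<integral>\<omega>. B t \<omega> * cnj (B 0 \<omega>) \<partial>M)"

abbreviation lebesgue_pi :: "real measure" where
  "lebesgue_pi \<equiv> restrict_space lborel {-pi..<pi}"

definition spectral_measure :: "'a measure \<Rightarrow> (int \<Rightarrow> 'a \<Rightarrow> complex) \<Rightarrow> real measure \<Rightarrow> bool" where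
  "spectral_measure M B \<mu> \<longleftrightarrow>
     finite_measure \<mu> \<and> sets \<mu> = sets lebesgue_pi \<and>
     (\<forall>t. autocov M B t = (\<integral>u. cis (of_int t * u) \<partial>\<mu>))"

section \<open>Orthogonal random measures and stochastic integrals\<close>

text \<open>
  Finite additivity suffices here: countable additivity in mean square follows from it together
  with \<open>E \<bar>W A\<bar>\<^sup>2 = \<mu> A\<close>.
\<close>

definition orthogonal_random_measure ::
    "'a measure \<Rightarrow> real measure \<Rightarrow> (real set \<Rightarrow> 'a \<Rightarrow> complex) \<Rightarrow> bool" where
  "orthogonal_random_measure M \<mu> W \<longleftrightarrow>
     (\<forall>A\<in>sets \<mu>. W A \<in> L2_space M \<and> (\<integral>\<omega>. (cmod (W A \<omega>))\<^sup>2 \<partial>M) = measure \<mu> A) \<and>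
     (\<forall>A\<in>sets \<mu>. \<forall>A'\<in>sets \<mu>. A \<inter> A' = {} \<longrightarrow>
        (AE \<omega> in M. W (A \<union> A') \<omega> = W A \<omega> + W A' \<omega>) \<and>
        (\<integral>\<omega>. W A \<omega> * cnj (W A' \<omega>) \<partial>M) = 0)"

definition simple_stoch_int ::
    "real measure \<Rightarrow> (real set \<Rightarrow> 'a \<Rightarrow> complex) \<Rightarrow> (real \<Rightarrow> complex) \<Rightarrow> 'a \<Rightarrow> complex" where
  "simple_stoch_int \<mu> W g \<omega> = (\<Sum>y\<in>g ` space \<mu>. y * W (g -` {y} \<inter> space \<mu>) \<omega>)"

definition has_stoch_int ::
    "'a measure \<Rightarrow> real measure \<Rightarrow> (real set \<Rightarrow> 'a \<Rightarrow> complex) \<Rightarrow> (real \<Rightarrow> complex) \<Rightarrow>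
     ('a \<Rightarrow> complex) \<Rightarrow> bool" where
  "has_stoch_int M \<mu> W \<phi> \<xi> \<longleftrightarrow> \<phi> \<in> L2_space \<mu> \<and> \<xi> \<in> L2_space M \<and>
     (\<exists>g. (\<forall>n. simple_function \<mu> (g n)) \<and>
          (\<lambda>n. sq_dist \<mu> \<phi> (g n)) \<longlonglongrightarrow> 0 \<and>
          (\<lambda>n. sq_dist M \<xi> (simple_stoch_int \<mu> W (g n))) \<longlonglongrightarrow> 0)"

definition stoch_int ::
    "'a measure \<Rightarrow> real measure \<Rightarrow> (real set \<Rightarrow> 'a \<Rightarrow> complex) \<Rightarrow> (real \<Rightarrow> complex) \<Rightarrow> 'a \<Rightarrow> complex" where
  "stoch_int M \<mu> W \<phi> = (SOME \<xi>. has_stoch_int M \<mu> W \<phi> \<xi>)"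

text \<open>
  The spectral representation \<open>B t = \<integral> e\<^sup>i\<^sup>t\<^sup>u W(du)\<close>. For a stationary sequence with spectral
  measure \<open>\<mu>\<close> such a \<open>W\<close> exists, and each \<open>W A\<close> is determined almost surely.
\<close>

definition spectral_process ::
    "'a measure \<Rightarrow> (int \<Rightarrow> 'a \<Rightarrow> complex) \<Rightarrow> real measure \<Rightarrow> real set \<Rightarrow> 'a \<Rightarrow> complex" where
  "spectral_process M B \<mu> = (SOME W. orthogonal_random_measure M \<mu> W \<and>
     (\<forall>t. has_stoch_int M \<mu> W (\<lambda>u. cis (of_int t * u)) (B t)))"

section \<open>Linear filters and prediction errors\<close>

text \<open>The function \<open>\<phi>\<^sub>\<xi>\<close> with \<open>\<xi> = \<integral> \<phi>\<^sub>\<xi> dW\<close>, unique up to \<open>\<mu>\<close>-null sets.\<close>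

definition spectral_rep ::
    "'a measure \<Rightarrow> (int \<Rightarrow> 'a \<Rightarrow> complex) \<Rightarrow> real measure \<Rightarrow> ('a \<Rightarrow> complex) \<Rightarrow> real \<Rightarrow> complex" where
  "spectral_rep M B \<mu> \<xi> = (SOME \<phi>. has_stoch_int M \<mu> (spectral_process M B \<mu>) \<phi> \<xi>)"

definition filter_domain ::
    "'a measure \<Rightarrow> (int \<Rightarrow> 'a \<Rightarrow> complex) \<Rightarrow> real measure \<Rightarrow> (real \<Rightarrow> complex) \<Rightarrow> ('a \<Rightarrow> complex) set" where
  "filter_domain M B \<mu> l = {\<xi> \<in> closed_lin_span M B UNIV.
     (\<integral>\<^sup>+u. ennreal ((cmod (l u * spectral_rep M B \<mu> \<xi> u))\<^sup>2) \<partial>\<mu>) < \<infinity>}"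

definition linear_filter ::
    "'a measure \<Rightarrow> (int \<Rightarrow> 'a \<Rightarrow> complex) \<Rightarrow> real measure \<Rightarrow> (real \<Rightarrow> complex) \<Rightarrow>
     ('a \<Rightarrow> complex) \<Rightarrow> 'a \<Rightarrow> complex" where
  "linear_filter M B \<mu> l \<xi> =
     stoch_int M \<mu> (spectral_process M B \<mu>) (\<lambda>u. l u * spectral_rep M B \<mu> \<xi> u)"

definition prediction_error ::
    "'a measure \<Rightarrow> (int \<Rightarrow> 'a \<Rightarrow> complex) \<Rightarrow> real measure \<Rightarrow> (real \<Rightarrow> complex) \<Rightarrow> int \<Rightarrow> real" where
  "prediction_error M B \<mu> l t = (INF Y \<in> closed_lin_span M B {..t} \<inter> filter_domain M B \<mu> l.
     (\<integral>\<omega>. (cmod (Y \<omega> - B 0 \<omega>))\<^sup>2 \<partial>M) + (\<integral>\<omega>. (cmod (linear_filter M B \<mu> l Y \<omega>))\<^sup>2 \<partial>M))"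

section \<open>Lebesgue decomposition\<close>

definition lebesgue_decomposition :: "real measure \<Rightarrow> real measure \<Rightarrow> real measure \<Rightarrow> bool" where
  "lebesgue_decomposition \<mu> \<mu>\<^sub>a \<mu>\<^sub>s \<longleftrightarrow>
     sets \<mu>\<^sub>a = sets \<mu> \<and> sets \<mu>\<^sub>s = sets \<mu> \<and>
     (\<forall>A\<in>sets \<mu>. emeasure \<mu> A = emeasure \<mu>\<^sub>a A + emeasure \<mu>\<^sub>s A) \<and>
     absolutely_continuous lebesgue_pi \<mu>\<^sub>a \<and>
     (\<exists>N \<in> null_sets lebesgue_pi. emeasure \<mu>\<^sub>s (space \<mu> - N) = 0)"

text \<open>\<open>\<bar>ln x\<bar>\<close> with the convention \<open>\<bar>ln 0\<bar> = \<infinity>\<close>; in the library \<open>ln 0 = 0\<close>.\<close>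

definition abs_ln :: "real \<Rightarrow> ennreal" where
  "abs_ln x = (if x = 0 then \<infinity> else ennreal \<bar>ln x\<bar>)"

end

theory Submission
  imports Defs
begin

text \<open>
  The spectral isometry sends \<open>B t\<close> to the character \<open>u \<mapsto> e\<^sup>i\<^sup>t\<^sup>u\<close> and turns the prediction error
  into the infimum of \<open>\<integral> \<bar>\<phi> - 1\<bar>\<^sup>2 + \<bar>l \<phi>\<bar>\<^sup>2 d\<mu>\<close> over the \<open>\<phi>\<close> in the closed span of the
  characters of frequency at most \<open>t\<close>. With \<open>h = 1 / (1 + \<bar>l\<bar>\<^sup>2)\<close> one has
  \<open>\<bar>z - 1\<bar>\<^sup>2 + \<bar>l z\<bar>\<^sup>2 \<ge> 1 - h\<close> for every number \<open>z\<close>, with equality at \<open>z = h\<close>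
  (\<open>filter_cost_pointwise\<close>). Let \<open>N\<close> be a Lebesgue null set that carries \<open>\<mu>\<^sub>s\<close>. Two facts about the
  remote past decide the limit.

  On \<open>N\<close> the past of any time knows everything: each function of \<open>L\<^sub>2(\<mu>)\<close> that vanishes off \<open>N\<close> lies
  in the closed span of the characters of frequency at most \<open>t\<close>, for every \<open>t\<close>
  (\<open>singular_part_in_future\<close>). Hence \<open>\<phi> = 1\<^sub>N h\<close> is admissible, and its cost
  \<open>\<integral>\<^sub>N (1 - h) d\<mu> + \<mu>\<^sub>a(space)\<close> is the asserted limit. Off \<open>N\<close> the remote past knows nothing: since
  \<open>ln f\<^sub>a\<close> is integrable, trigonometric polynomials of very low frequency are almost orthogonal to the
  constants in \<open>L\<^sub>2(\<mu>\<^sub>a)\<close> (\<open>distance_from_remote_future\<close>). So any admissible \<open>\<phi>\<close> pays at least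
  \<open>\<mu>\<^sub>a(space) - \<epsilon>\<close> off \<open>N\<close>, and at least \<open>\<integral>\<^sub>N (1 - h) d\<mu>\<close> on \<open>N\<close> by the pointwise bound.

  Both facts rest on one device. For a trigonometric polynomial \<open>s\<close> there is an algebraic polynomial
  \<open>P\<close> with \<open>Re P = \<bar>s\<bar>\<^sup>2\<close> on the unit circle (\<open>trig_norm_sq_analytic\<close>), and
  \<open>exp (- P)\<close> has modulus \<open>exp (- \<bar>s\<bar>\<^sup>2)\<close> and mean \<open>exp (- P(0))\<close>. If \<open>s\<close> is near a large multiple of
  \<open>1\<^sub>N\<close>, then \<open>1 - exp (- P)\<close> is an analytic function near \<open>1\<^sub>N\<close>. If \<open>\<bar>s\<bar>\<^sup>2\<close> is near \<open>- ln f\<^sub>a\<close>, then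
  Szego's lower bound for \<open>\<integral> \<bar>Q\<bar>\<^sup>2 f\<^sub>a\<close> over the polynomials with \<open>Q(0) = 1\<close> follows; the minimizer \<open>\<psi>\<close>
  of that integral makes \<open>\<bar>\<psi>\<bar>\<^sup>2 f\<^sub>a\<close> constant, which yields a factor \<open>D\<close> of \<open>f\<^sub>a = \<bar>D\<bar>\<^sup>2\<close> with no negative
  frequencies.

  The analysis is written for spans of frequencies at least \<open>k\<close>, where polynomials in \<open>e\<^sup>i\<^sup>u\<close> are at
  hand; complex conjugation carries the results over to frequencies at most \<open>- k\<close>.
\<close>

section \<open>The seminorm and completeness of the space of square integrable functions\<close>

definition l2norm :: "'a measure \<Rightarrow> ('a \<Rightarrow> complex) \<Rightarrow> real" where
  "l2norm M X = sqrt (\<integral>\<omega>. (cmod (X \<omega>))\<^sup>2 \<partial>M)"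

lemma l2norm_nonneg [simp]: "0 \<le> l2norm M X"
  by (simp add: l2norm_def)

lemma l2norm_sq: "(l2norm M X)\<^sup>2 = (\<integral>\<omega>. (cmod (X \<omega>))\<^sup>2 \<partial>M)"
  by (simp add: l2norm_def)

lemma sq_dist_l2norm: "sq_dist M X Y = (l2norm M (\<lambda>\<omega>. X \<omega> - Y \<omega>))\<^sup>2"
  by (simp add: l2norm_sq sq_dist_def)

lemma L2_D: "X \<in> L2_space M \<Longrightarrow> X \<in> borel_measurable M"
  "X \<in> L2_space M \<Longrightarrow> integrable M (\<lambda>\<omega>. (cmod (X \<omega>))\<^sup>2)"
  by (auto simp: L2_space_def)

lemma L2_dominated:
  assumes "Y \<in> L2_space M" "X \<in> borel_measurable M" "AE \<omega> in M. cmod (X \<omega>) \<le> cmod (Y \<omega>)"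
  shows "X \<in> L2_space M" "l2norm M X \<le> l2norm M Y"
proof -
  have i: "integrable M (\<lambda>\<omega>. (cmod (X \<omega>))\<^sup>2)"
    by (rule Bochner_Integration.integrable_bound[OF L2_D(2)[OF assms(1)]])
       (use assms(2,3) in \<open>auto elim!: eventually_mono intro!: power_mono\<close>)
  then show "X \<in> L2_space M" using assms by (simp add: L2_space_def)
  show "l2norm M X \<le> l2norm M Y"
    unfolding l2norm_def
    by (intro real_sqrt_le_mono integral_mono_AE i L2_D(2) assms)
       (use assms(3) in \<open>auto elim!: eventually_mono intro!: power_mono\<close>)
qed

lemma L2_scale [intro]:
  assumes "X \<in> L2_space M" shows "(\<lambda>\<omega>. c * X \<omega>) \<in> L2_space M"
  using assms by (auto simp: L2_space_def norm_mult power_mult_distrib)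

lemma l2norm_scale: "l2norm M (\<lambda>\<omega>. c * X \<omega>) = cmod c * l2norm M X"
  by (simp add: l2norm_def norm_mult power_mult_distrib real_sqrt_mult)

lemma L2_add [intro]:
  assumes "X \<in> L2_space M" "Y \<in> L2_space M" shows "(\<lambda>\<omega>. X \<omega> + Y \<omega>) \<in> L2_space M"
proof -
  have le: "(cmod (x + y))\<^sup>2 \<le> 2 * (cmod x)\<^sup>2 + 2 * (cmod y)\<^sup>2" for x y
  proof -
    have "(cmod (x + y))\<^sup>2 \<le> (cmod x + cmod y)\<^sup>2" by (intro power_mono norm_triangle_ineq) auto
    also have "\<dots> \<le> 2 * (cmod x)\<^sup>2 + 2 * (cmod y)\<^sup>2"
      using sum_squares_bound[of "cmod x" "cmod y"] by (simp add: power2_sum)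
    finally show ?thesis .
  qed
  have "integrable M (\<lambda>\<omega>. 2 * (cmod (X \<omega>))\<^sup>2 + 2 * (cmod (Y \<omega>))\<^sup>2)"
    using assms by (auto simp: L2_space_def)
  then have "integrable M (\<lambda>\<omega>. (cmod (X \<omega> + Y \<omega>))\<^sup>2)"
    by (rule Bochner_Integration.integrable_bound)
       (use le assms in \<open>auto simp: L2_space_def intro!: AE_I2\<close>)
  then show ?thesis using assms by (auto simp: L2_space_def)
qed

lemma L2_zero [intro, simp]: "(\<lambda>\<omega>. 0) \<in> L2_space M"
  by (simp add: L2_space_def)

lemma L2_uminus [intro]: "X \<in> L2_space M \<Longrightarrow> (\<lambda>\<omega>. - X \<omega>) \<in> L2_space M"
  using L2_scale[of X M "-1"] by simp

lemma L2_diff [intro]: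
  assumes "X \<in> L2_space M" "Y \<in> L2_space M" shows "(\<lambda>\<omega>. X \<omega> - Y \<omega>) \<in> L2_space M"
  using L2_add[OF assms(1) L2_uminus[OF assms(2)]] by simp

lemma L2_sum [intro]:
  assumes "\<And>i. i \<in> I \<Longrightarrow> X i \<in> L2_space M" shows "(\<lambda>\<omega>. \<Sum>i\<in>I. X i \<omega>) \<in> L2_space M"
  using assms by (induction I rule: infinite_finite_induct) auto

lemma L2_cnj [intro]: "X \<in> L2_space M \<Longrightarrow> (\<lambda>\<omega>. cnj (X \<omega>)) \<in> L2_space M"
  by (auto simp: L2_space_def intro: borel_measurable_continuous_on[OF continuous_on_cnj[OF continuous_on_id], simplified])

lemma L2_norm_mult_integrable:
  assumes "X \<in> L2_space M" "Y \<in> L2_space M"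
  shows "integrable M (\<lambda>\<omega>. cmod (X \<omega>) * cmod (Y \<omega>))"
proof (rule Bochner_Integration.integrable_bound)
  show "integrable M (\<lambda>\<omega>. (cmod (X \<omega>))\<^sup>2 + (cmod (Y \<omega>))\<^sup>2)"
    using assms by (auto simp: L2_space_def)
  have "a * b \<le> a\<^sup>2 + b\<^sup>2" if "0 \<le> a" "0 \<le> b" for a b :: real
    using sum_squares_bound[of a b] mult_nonneg_nonneg[OF that] by simp
  then show "AE \<omega> in M. norm (cmod (X \<omega>) * cmod (Y \<omega>)) \<le> norm ((cmod (X \<omega>))\<^sup>2 + (cmod (Y \<omega>))\<^sup>2)"
    by (auto intro!: AE_I2)
qed (use assms in \<open>auto simp: L2_space_def\<close>)

lemma measurable_cnj [measurable (raw)]: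
  "X \<in> borel_measurable M \<Longrightarrow> (\<lambda>\<omega>. cnj (X \<omega>)) \<in> borel_measurable M"
  by (intro borel_measurable_continuous_on[OF continuous_on_cnj[OF continuous_on_id]])

lemma L2_inner_integrable:
  assumes "X \<in> L2_space M" "Y \<in> L2_space M"
  shows "integrable M (\<lambda>\<omega>. X \<omega> * cnj (Y \<omega>))"
proof (rule Bochner_Integration.integrable_bound[OF L2_norm_mult_integrable[OF assms]])
  show "(\<lambda>\<omega>. X \<omega> * cnj (Y \<omega>)) \<in> borel_measurable M"
    using assms by (auto simp: L2_space_def)
qed (simp add: norm_mult)

lemma L2_Cauchy_Schwarz_norm:
  assumes "X \<in> L2_space M" "Y \<in> L2_space M"
  shows "(\<integral>\<omega>. cmod (X \<omega>) * cmod (Y \<omega>) \<partial>M) \<le> l2norm M X * l2norm M Y"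
proof -
  have [measurable]: "X \<in> borel_measurable M" "Y \<in> borel_measurable M" using assms by (auto simp: L2_space_def)
  have "(\<integral>\<^sup>+\<omega>. ennreal (cmod (X \<omega>)) * ennreal (cmod (Y \<omega>)) \<partial>M)\<^sup>2
      \<le> (\<integral>\<^sup>+\<omega>. (ennreal (cmod (X \<omega>)))\<^sup>2 \<partial>M) * (\<integral>\<^sup>+\<omega>. (ennreal (cmod (Y \<omega>)))\<^sup>2 \<partial>M)"
    by (rule Cauchy_Schwarz_nn_integral) auto
  also have "(\<integral>\<^sup>+\<omega>. (ennreal (cmod (X \<omega>)))\<^sup>2 \<partial>M) = ennreal ((l2norm M X)\<^sup>2)"
    using nn_integral_eq_integral[OF L2_D(2)[OF assms(1)]] by (simp add: ennreal_power l2norm_sq)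
  also have "(\<integral>\<^sup>+\<omega>. (ennreal (cmod (Y \<omega>)))\<^sup>2 \<partial>M) = ennreal ((l2norm M Y)\<^sup>2)"
    using nn_integral_eq_integral[OF L2_D(2)[OF assms(2)]] by (simp add: ennreal_power l2norm_sq)
  also have "(\<integral>\<^sup>+\<omega>. ennreal (cmod (X \<omega>)) * ennreal (cmod (Y \<omega>)) \<partial>M) = ennreal (\<integral>\<omega>. cmod (X \<omega>) * cmod (Y \<omega>) \<partial>M)"
    using nn_integral_eq_integral[OF L2_norm_mult_integrable[OF assms]] by (simp add: ennreal_mult)
  finally have "(\<integral>\<omega>. cmod (X \<omega>) * cmod (Y \<omega>) \<partial>M)\<^sup>2 \<le> (l2norm M X * l2norm M Y)\<^sup>2"
    by (simp add: ennreal_power flip: ennreal_mult power_mult_distrib)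
  then show ?thesis by (rule power2_le_imp_le) simp
qed

lemma L2_Cauchy_Schwarz:
  assumes "X \<in> L2_space M" "Y \<in> L2_space M"
  shows "cmod (\<integral>\<omega>. X \<omega> * cnj (Y \<omega>) \<partial>M) \<le> l2norm M X * l2norm M Y"
proof -
  have "cmod (\<integral>\<omega>. X \<omega> * cnj (Y \<omega>) \<partial>M) \<le> (\<integral>\<omega>. cmod (X \<omega> * cnj (Y \<omega>)) \<partial>M)"
    by (rule integral_norm_bound)
  then show ?thesis using L2_Cauchy_Schwarz_norm[OF assms] by (simp add: norm_mult)
qed

text \<open>The law of cosines; orthogonality, polarization and the parallelogram law below are all read off
  from it.\<close>

lemma l2norm_sq_add:
  assumes "X \<in> L2_space M" "Y \<in> L2_space M"
  shows "(l2norm M (\<lambda>\<omega>. X \<omega> + Y \<omega>))\<^sup>2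
    = (l2norm M X)\<^sup>2 + 2 * Re (\<integral>\<omega>. X \<omega> * cnj (Y \<omega>) \<partial>M) + (l2norm M Y)\<^sup>2"
proof -
  have eq: "(cmod (x + y))\<^sup>2 = (cmod x)\<^sup>2 + 2 * Re (x * cnj y) + (cmod y)\<^sup>2" for x y
    unfolding cmod_power2 by (simp add: power2_eq_square algebra_simps)
  note [simp] = L2_D(2)[OF assms(1)] L2_D(2)[OF assms(2)] L2_inner_integrable[OF assms]
  show ?thesis
    unfolding l2norm_sq eq
    by (simp del: times_complex.sel)
qed

lemma l2norm_triangle:
  assumes "X \<in> L2_space M" "Y \<in> L2_space M"
  shows "l2norm M (\<lambda>\<omega>. X \<omega> + Y \<omega>) \<le> l2norm M X + l2norm M Y"
proof (rule power2_le_imp_le)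
  have "Re (\<integral>\<omega>. X \<omega> * cnj (Y \<omega>) \<partial>M) \<le> l2norm M X * l2norm M Y"
    using complex_Re_le_cmod L2_Cauchy_Schwarz[OF assms] order_trans by blast
  then show "(l2norm M (\<lambda>\<omega>. X \<omega> + Y \<omega>))\<^sup>2 \<le> (l2norm M X + l2norm M Y)\<^sup>2"
    by (simp add: l2norm_sq_add[OF assms] power2_sum)
qed auto

lemma l2norm_minus_commute: "l2norm M (\<lambda>\<omega>. X \<omega> - Y \<omega>) = l2norm M (\<lambda>\<omega>. Y \<omega> - X \<omega>)"
  by (simp add: l2norm_def norm_minus_commute)

lemma l2norm_triangle_diff:
  assumes "X \<in> L2_space M" "Y \<in> L2_space M" "Z \<in> L2_space M"
  shows "l2norm M (\<lambda>\<omega>. X \<omega> - Z \<omega>) \<le> l2norm M (\<lambda>\<omega>. X \<omega> - Y \<omega>) + l2norm M (\<lambda>\<omega>. Y \<omega> - Z \<omega>)"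
  using l2norm_triangle[OF L2_diff[OF assms(1,2)] L2_diff[OF assms(2,3)]] by simp

lemma l2norm_le_diff:
  assumes "X \<in> L2_space M" "Y \<in> L2_space M"
  shows "l2norm M X \<le> l2norm M Y + l2norm M (\<lambda>\<omega>. X \<omega> - Y \<omega>)"
  using l2norm_triangle[OF assms(2) L2_diff[OF assms]] by simp

lemma l2norm_tendsto:
  assumes "\<And>n. X n \<in> L2_space M" "Y \<in> L2_space M" "(\<lambda>n. l2norm M (\<lambda>\<omega>. X n \<omega> - Y \<omega>)) \<longlonglongrightarrow> 0"
  shows "(\<lambda>n. l2norm M (X n)) \<longlonglongrightarrow> l2norm M Y"
proof (rule Lim_transform_bound[where g="\<lambda>n. l2norm M (\<lambda>\<omega>. X n \<omega> - Y \<omega>)", THEN LIM_zero_cancel])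
  show "\<forall>\<^sub>F n in sequentially. norm (l2norm M (X n) - l2norm M Y) \<le> norm (l2norm M (\<lambda>\<omega>. X n \<omega> - Y \<omega>))"
    using l2norm_le_diff[OF assms(1,2)] l2norm_le_diff[OF assms(2,1)]
    by (intro always_eventually allI) (simp add: abs_le_iff l2norm_minus_commute[of M Y] algebra_simps)
qed fact

lemma l2norm_cong_AE:
  assumes "X \<in> borel_measurable M" "Y \<in> borel_measurable M" "AE \<omega> in M. X \<omega> = Y \<omega>"
  shows "l2norm M X = l2norm M Y"
  unfolding l2norm_def using assms by (intro arg_cong[where f=sqrt] integral_cong_AE) auto

lemma l2norm_eq_0_AE:
  assumes "X \<in> L2_space M" "l2norm M X = 0"
  shows "AE \<omega> in M. X \<omega> = 0"
  using integral_nonneg_eq_0_iff_AE[OF L2_D(2)[OF assms(1)]] assms(2) by (simp add: l2norm_def)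

lemma L2_bounded:
  assumes "finite_measure M" "X \<in> borel_measurable M" "\<And>\<omega>. \<omega> \<in> space M \<Longrightarrow> cmod (X \<omega>) \<le> C"
  shows "X \<in> L2_space M"
proof -
  interpret finite_measure M by fact
  have "integrable M (\<lambda>\<omega>. (cmod (X \<omega>))\<^sup>2)"
    by (rule integrable_const_bound[where B="C\<^sup>2"]) (use assms in \<open>auto intro!: AE_I2 power_mono\<close>)
  then show ?thesis using assms by (simp add: L2_space_def)
qed

lemma L2_mult_bounded:
  assumes "X \<in> L2_space M" "Y \<in> borel_measurable M" "\<And>\<omega>. \<omega> \<in> space M \<Longrightarrow> cmod (Y \<omega>) \<le> C" "0 \<le> C"
  shows "(\<lambda>\<omega>. Y \<omega> * X \<omega>) \<in> L2_space M" "l2norm M (\<lambda>\<omega>. Y \<omega> * X \<omega>) \<le> C * l2norm M X"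
proof -
  have *: "(\<lambda>\<omega>. complex_of_real C * X \<omega>) \<in> L2_space M" using assms by auto
  have m: "(\<lambda>\<omega>. Y \<omega> * X \<omega>) \<in> borel_measurable M" using assms by (auto simp: L2_space_def)
  have "AE \<omega> in M. cmod (Y \<omega> * X \<omega>) \<le> cmod (complex_of_real C * X \<omega>)"
    using assms by (auto intro!: AE_I2 mult_right_mono simp: norm_mult)
  note d = L2_dominated[OF * m this]
  show "(\<lambda>\<omega>. Y \<omega> * X \<omega>) \<in> L2_space M" by (rule d)
  show "l2norm M (\<lambda>\<omega>. Y \<omega> * X \<omega>) \<le> C * l2norm M X"
    using d(2) assms(4) by (simp add: l2norm_scale)
qed

lemma dominated_convergence_l2norm:
  assumes X: "\<And>n. X n \<in> borel_measurable M" and Y: "Y \<in> borel_measurable M"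
    and G: "G \<in> L2_space M"
    and conv: "\<And>\<omega>. \<omega> \<in> space M \<Longrightarrow> (\<lambda>n. X n \<omega>) \<longlonglongrightarrow> Y \<omega>"
    and le: "\<And>n \<omega>. \<omega> \<in> space M \<Longrightarrow> cmod (X n \<omega> - Y \<omega>) \<le> cmod (G \<omega>)"
  shows "(\<lambda>n. l2norm M (\<lambda>\<omega>. X n \<omega> - Y \<omega>)) \<longlonglongrightarrow> 0"
proof -
  have "(\<lambda>n. \<integral>\<omega>. (cmod (X n \<omega> - Y \<omega>))\<^sup>2 \<partial>M) \<longlonglongrightarrow> (\<integral>\<omega>. 0 \<partial>M)"
  proof (rule integral_dominated_convergence[where w="\<lambda>\<omega>. (cmod (G \<omega>))\<^sup>2"])
    have "(\<lambda>n. (cmod (X n \<omega> - Y \<omega>))\<^sup>2) \<longlonglongrightarrow> 0" if "\<omega> \<in> space M" for \<omega>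
    proof -
      have "(\<lambda>n. (cmod (X n \<omega> - Y \<omega>))\<^sup>2) \<longlonglongrightarrow> (cmod (Y \<omega> - Y \<omega>))\<^sup>2"
        by (intro tendsto_intros conv that)
      then show ?thesis by simp
    qed
    then show "AE \<omega> in M. (\<lambda>n. (cmod (X n \<omega> - Y \<omega>))\<^sup>2) \<longlonglongrightarrow> 0" by auto
    show "AE \<omega> in M. norm ((cmod (X n \<omega> - Y \<omega>))\<^sup>2) \<le> (cmod (G \<omega>))\<^sup>2" for n
      using le by (auto intro!: AE_I2 power_mono)
  qed (use X Y G in \<open>auto simp: L2_space_def\<close>)
  then have "(\<lambda>n. sqrt (\<integral>\<omega>. (cmod (X n \<omega> - Y \<omega>))\<^sup>2 \<partial>M)) \<longlonglongrightarrow> sqrt 0"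
    by (intro tendsto_real_sqrt) simp
  then show ?thesis by (simp add: l2norm_def)
qed

lemma simple_function_decomp:
  fixes g :: "'a \<Rightarrow> complex"
  assumes g: "simple_function M g" and u: "u \<in> space M"
  shows "g u = (\<Sum>y\<in>g ` space M. y * indicator (g -` {y} \<inter> space M) u)"
proof -
  have "(\<Sum>y\<in>g ` space M. y * indicator (g -` {y} \<inter> space M) u) = (\<Sum>y\<in>g ` space M. if g u = y then y else 0)"
    using u by (intro sum.cong) (auto simp: indicator_def)
  then show ?thesis using u simple_functionD(1)[OF g] by simp
qed

lemma L2_simple_approx:
  assumes \<phi>: "\<phi> \<in> L2_space M"
  obtains F where "\<And>n. simple_function M (F n)" "(\<lambda>n. l2norm M (\<lambda>u. F n u - \<phi> u)) \<longlonglongrightarrow> 0"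
proof -
  obtain F where F: "\<And>i. simple_function M (F i)" "\<And>x. x \<in> space M \<Longrightarrow> (\<lambda>i. F i x) \<longlonglongrightarrow> \<phi> x"
    "\<And>i x. x \<in> space M \<Longrightarrow> dist (F i x) 0 \<le> 2 * dist (\<phi> x) 0"
    using borel_measurable_implies_sequence_metric[OF L2_D(1)[OF \<phi>], of 0] by blast
  have "(\<lambda>n. l2norm M (\<lambda>u. F n u - \<phi> u)) \<longlonglongrightarrow> 0"
  proof (rule dominated_convergence_l2norm[where G="\<lambda>u. 3 * \<phi> u"])
    show "cmod (F n u - \<phi> u) \<le> cmod (3 * \<phi> u)" if "u \<in> space M" for n u
      using F(3)[OF that, of n] norm_triangle_ineq4[of "F n u" "\<phi> u"] by (simp add: norm_mult)
    show "F n \<in> borel_measurable M" for n by (rule borel_measurable_simple_function[OF F(1)])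
    show "\<phi> \<in> borel_measurable M" by (rule L2_D(1)[OF \<phi>])
    show "(\<lambda>u. 3 * \<phi> u) \<in> L2_space M" by (rule L2_scale[OF \<phi>])
  qed (rule F(2))
  with F(1) show ?thesis by (rule that)
qed

text \<open>Riesz-Fischer. On a finite measure space a Cauchy sequence in mean square is Cauchy in the mean,
  so a subsequence converges almost everywhere; Fatou's lemma shows that its limit is a limit in mean
  square.\<close>

theorem L2_complete:
  assumes fin: "finite_measure M" and X: "\<And>n. X n \<in> L2_space M"
    and Cauchy: "\<And>e. 0 < e \<Longrightarrow> \<exists>N. \<forall>i\<ge>N. \<forall>j\<ge>N. l2norm M (\<lambda>\<omega>. X i \<omega> - X j \<omega>) < e"
  obtains Y where "Y \<in> L2_space M" "(\<lambda>n. l2norm M (\<lambda>\<omega>. X n \<omega> - Y \<omega>)) \<longlonglongrightarrow> 0"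
proof -
  interpret finite_measure M by fact
  note [measurable] = L2_D(1)[OF X]
  have one: "(\<lambda>\<omega>. 1) \<in> L2_space M" by (rule L2_bounded[where C=1]) (use fin in auto)
  have L1: "integrable M (Z :: _ \<Rightarrow> complex)" and L1n: "(\<integral>\<omega>. cmod (Z \<omega>) \<partial>M) \<le> l2norm M Z * l2norm M (\<lambda>\<omega>. 1)"
    if "Z \<in> L2_space M" for Z
    using L2_inner_integrable[OF that one] L2_Cauchy_Schwarz_norm[OF that one] by auto
  have cauchy1: "\<exists>N. \<forall>i\<ge>N. \<forall>j\<ge>N. (\<integral>\<omega>. norm (X i \<omega> - X j \<omega>) \<partial>M) < e" if "e > 0" for e
  proof -
    let ?c = "l2norm M (\<lambda>\<omega>. 1) + 1"
    have c: "?c > 0" by (simp add: add_nonneg_pos)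
    obtain N where N: "\<forall>i\<ge>N. \<forall>j\<ge>N. l2norm M (\<lambda>\<omega>. X i \<omega> - X j \<omega>) < e / ?c"
      using Cauchy[of "e / ?c"] \<open>e > 0\<close> c by auto
    have "(\<integral>\<omega>. norm (X i \<omega> - X j \<omega>) \<partial>M) < e" if "i \<ge> N" "j \<ge> N" for i j
    proof -
      have "(\<integral>\<omega>. norm (X i \<omega> - X j \<omega>) \<partial>M) \<le> l2norm M (\<lambda>\<omega>. X i \<omega> - X j \<omega>) * l2norm M (\<lambda>\<omega>. 1)"
        using L1n[OF L2_diff[OF X X]] by simp
      also have "\<dots> \<le> l2norm M (\<lambda>\<omega>. X i \<omega> - X j \<omega>) * ?c" by (intro mult_left_mono) auto
      also have "\<dots> < e" using N that c by (simp add: field_simps)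
      finally show ?thesis .
    qed
    then show ?thesis by blast
  qed
  obtain r where r: "strict_mono r" "AE \<omega> in M. Cauchy (\<lambda>i. X (r i) \<omega>)"
    using cauchy_L1_AE_cauchy_subseq[of M X, OF L1[OF X] cauchy1] by blast
  define Y where "Y \<omega> = lim (\<lambda>i. X (r i) \<omega>)" for \<omega>
  have Ym [measurable]: "Y \<in> borel_measurable M" unfolding Y_def by measurable
  have YL: "AE \<omega> in M. (\<lambda>i. X (r i) \<omega>) \<longlonglongrightarrow> Y \<omega>"
    using r(2) by eventually_elim (simp add: Y_def convergent_LIMSEQ_iff[symmetric] Cauchy_convergent_iff)
  have fatou: "(\<integral>\<^sup>+\<omega>. ennreal ((cmod (X n \<omega> - Y \<omega>))\<^sup>2) \<partial>M) \<le> ennreal (e\<^sup>2)"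
    if n: "\<forall>j\<ge>n. l2norm M (\<lambda>\<omega>. X n \<omega> - X j \<omega>) < e" for n e
  proof -
    have "(\<integral>\<^sup>+\<omega>. ennreal ((cmod (X n \<omega> - Y \<omega>))\<^sup>2) \<partial>M)
        = (\<integral>\<^sup>+\<omega>. liminf (\<lambda>i. ennreal ((cmod (X n \<omega> - X (r i) \<omega>))\<^sup>2)) \<partial>M)"
    proof (rule nn_integral_cong_AE, use YL in eventually_elim)
      case (elim \<omega>)
      have "(\<lambda>i. ennreal ((cmod (X n \<omega> - X (r i) \<omega>))\<^sup>2)) \<longlonglongrightarrow> ennreal ((cmod (X n \<omega> - Y \<omega>))\<^sup>2)"
        by (intro tendsto_ennrealI tendsto_intros elim)
      then show ?case by (metis lim_imp_Liminf trivial_limit_sequentially)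
    qed
    also have "\<dots> \<le> liminf (\<lambda>i. \<integral>\<^sup>+\<omega>. ennreal ((cmod (X n \<omega> - X (r i) \<omega>))\<^sup>2) \<partial>M)"
      by (rule nn_integral_liminf) simp
    also have "\<dots> \<le> ennreal (e\<^sup>2)"
    proof (rule Liminf_le)
      have "(\<integral>\<^sup>+\<omega>. ennreal ((cmod (X n \<omega> - X (r i) \<omega>))\<^sup>2) \<partial>M) \<le> ennreal (e\<^sup>2)" if "i \<ge> n" for i
      proof -
        have "n \<le> r i" using seq_suble[OF r(1), of i] that by simp
        then have "(l2norm M (\<lambda>\<omega>. X n \<omega> - X (r i) \<omega>))\<^sup>2 \<le> e\<^sup>2"
          using n by (intro power_mono) (auto intro: less_imp_le)
        then show ?thesis
          using nn_integral_eq_integral[OF L2_D(2)[OF L2_diff[OF X X]]] by (simp add: l2norm_sq ennreal_leI)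
      qed
      then show "\<forall>\<^sub>F i in sequentially. (\<integral>\<^sup>+\<omega>. ennreal ((cmod (X n \<omega> - X (r i) \<omega>))\<^sup>2) \<partial>M) \<le> ennreal (e\<^sup>2)"
        by (auto simp: eventually_sequentially)
    qed auto
    finally show ?thesis .
  qed
  have in_L2: "(\<lambda>\<omega>. X n \<omega> - Y \<omega>) \<in> L2_space M" and le: "l2norm M (\<lambda>\<omega>. X n \<omega> - Y \<omega>) \<le> e"
    if n: "\<forall>j\<ge>n. l2norm M (\<lambda>\<omega>. X n \<omega> - X j \<omega>) < e" "e > 0" for n e
  proof -
    have i: "integrable M (\<lambda>\<omega>. (cmod (X n \<omega> - Y \<omega>))\<^sup>2)"
      using fatou[OF n(1)] by (intro integrableI_bounded) (auto simp: less_top[symmetric] top_unique)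
    then show "(\<lambda>\<omega>. X n \<omega> - Y \<omega>) \<in> L2_space M" by (simp add: L2_space_def)
    have "(\<integral>\<omega>. (cmod (X n \<omega> - Y \<omega>))\<^sup>2 \<partial>M) \<le> e\<^sup>2"
      using fatou[OF n(1)] nn_integral_eq_integral[OF i] by (simp add: ennreal_le_iff)
    then show "l2norm M (\<lambda>\<omega>. X n \<omega> - Y \<omega>) \<le> e"
      using n(2) by (simp add: l2norm_def real_le_lsqrt)
  qed
  obtain N where "\<forall>i\<ge>N. \<forall>j\<ge>N. l2norm M (\<lambda>\<omega>. X i \<omega> - X j \<omega>) < 1" using Cauchy[of 1] by auto
  then have "(\<lambda>\<omega>. X N \<omega> - Y \<omega>) \<in> L2_space M" by (intro in_L2[of N 1]) auto
  from L2_diff[OF X[of N] this] have Y: "Y \<in> L2_space M" by simp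
  have "(\<lambda>n. l2norm M (\<lambda>\<omega>. X n \<omega> - Y \<omega>)) \<longlonglongrightarrow> 0"
  proof (rule LIMSEQ_I)
    fix e :: real assume e: "0 < e"
    obtain N where N: "\<forall>i\<ge>N. \<forall>j\<ge>N. l2norm M (\<lambda>\<omega>. X i \<omega> - X j \<omega>) < e/2" using Cauchy[of "e/2"] e by auto
    have "l2norm M (\<lambda>\<omega>. X n \<omega> - Y \<omega>) \<le> e/2" if "n \<ge> N" for n
      using N that e by (intro le) auto
    then show "\<exists>N. \<forall>n\<ge>N. norm (l2norm M (\<lambda>\<omega>. X n \<omega> - Y \<omega>) - 0) < e" using e by force
  qed
  with Y show ?thesis by (rule that)
qed

section \<open>Density of trigonometric polynomials\<close>

lemma tendsto_0_ex_less:
  fixes X :: "nat \<Rightarrow> real"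
  assumes "X \<longlonglongrightarrow> 0" "0 < e" shows "\<exists>n. X n < e"
  using order_tendstoD(2)[OF assms] by (auto simp: eventually_sequentially)

text \<open>The closure is taken among representatives: it is saturated under almost everywhere equality by
  \<open>L2_closure_cong\<close>.\<close>

definition L2_closure :: "'a measure \<Rightarrow> ('a \<Rightarrow> complex) set \<Rightarrow> ('a \<Rightarrow> complex) set" where
  "L2_closure M S = {Y \<in> L2_space M. \<forall>e>0. \<exists>Z\<in>S. l2norm M (\<lambda>\<omega>. Y \<omega> - Z \<omega>) < e}"

lemma L2_closure_D:
  assumes "Y \<in> L2_closure M S"
  shows "Y \<in> L2_space M" "0 < e \<Longrightarrow> \<exists>Z\<in>S. l2norm M (\<lambda>\<omega>. Y \<omega> - Z \<omega>) < e"
  using assms by (auto simp: L2_closure_def)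

lemma L2_closure_base: "S \<subseteq> L2_space M \<Longrightarrow> Y \<in> S \<Longrightarrow> Y \<in> L2_closure M S"
  by (auto simp: L2_closure_def l2norm_def intro!: bexI[of _ Y])

lemma L2_closure_add:
  assumes S: "S \<subseteq> L2_space M" and add: "\<And>X Y. X \<in> S \<Longrightarrow> Y \<in> S \<Longrightarrow> (\<lambda>\<omega>. X \<omega> + Y \<omega>) \<in> S"
    and X: "X \<in> L2_closure M S" and Y: "Y \<in> L2_closure M S"
  shows "(\<lambda>\<omega>. X \<omega> + Y \<omega>) \<in> L2_closure M S"
  unfolding L2_closure_def
proof (safe)
  show "(\<lambda>\<omega>. X \<omega> + Y \<omega>) \<in> L2_space M" using X Y by (auto dest: L2_closure_D)
  fix e :: real assume "0 < e"
  then obtain X' Y' where X': "X' \<in> S" "l2norm M (\<lambda>\<omega>. X \<omega> - X' \<omega>) < e/2"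
    and Y': "Y' \<in> S" "l2norm M (\<lambda>\<omega>. Y \<omega> - Y' \<omega>) < e/2"
    using L2_closure_D(2)[OF X, of "e/2"] L2_closure_D(2)[OF Y, of "e/2"] by auto
  have "l2norm M (\<lambda>\<omega>. (X \<omega> - X' \<omega>) + (Y \<omega> - Y' \<omega>)) < e"
    using l2norm_triangle[of "\<lambda>\<omega>. X \<omega> - X' \<omega>" M "\<lambda>\<omega>. Y \<omega> - Y' \<omega>"] X' Y' S X Y
    by (force dest: L2_closure_D)
  moreover have "(\<lambda>\<omega>. (X \<omega> - X' \<omega>) + (Y \<omega> - Y' \<omega>)) = (\<lambda>\<omega>. X \<omega> + Y \<omega> - (X' \<omega> + Y' \<omega>))" by auto
  ultimately show "\<exists>Z\<in>S. l2norm M (\<lambda>\<omega>. X \<omega> + Y \<omega> - Z \<omega>) < e"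
    using add[OF X'(1) Y'(1)] by (intro bexI[of _ "\<lambda>\<omega>. X' \<omega> + Y' \<omega>"]) auto
qed

lemma L2_closure_scale:
  assumes scale: "\<And>X. X \<in> S \<Longrightarrow> (\<lambda>\<omega>. c * X \<omega>) \<in> S" and X: "X \<in> L2_closure M S"
  shows "(\<lambda>\<omega>. c * X \<omega>) \<in> L2_closure M S"
  unfolding L2_closure_def
proof (safe)
  show "(\<lambda>\<omega>. c * X \<omega>) \<in> L2_space M" using X by (auto dest: L2_closure_D)
  fix e :: real assume e: "0 < e"
  have c: "0 < cmod c + 1" by (simp add: add_nonneg_pos)
  obtain Z where Z: "Z \<in> S" "l2norm M (\<lambda>\<omega>. X \<omega> - Z \<omega>) < e / (cmod c + 1)"
    using L2_closure_D(2)[OF X, of "e / (cmod c + 1)"] e c by auto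
  have "cmod c * l2norm M (\<lambda>\<omega>. X \<omega> - Z \<omega>) \<le> (cmod c + 1) * l2norm M (\<lambda>\<omega>. X \<omega> - Z \<omega>)"
    by (intro mult_right_mono) auto
  also have "\<dots> < e" using Z c by (simp add: field_simps)
  finally have "l2norm M (\<lambda>\<omega>. c * X \<omega> - c * Z \<omega>) < e"
    using l2norm_scale[of M c "\<lambda>\<omega>. X \<omega> - Z \<omega>"] by (simp add: right_diff_distrib)
  then show "\<exists>Z\<in>S. l2norm M (\<lambda>\<omega>. c * X \<omega> - Z \<omega>) < e" using scale[OF Z(1)] by (rule bexI)
qed

lemma L2_closure_approx:
  assumes S: "S \<subseteq> L2_space M" and Y: "Y \<in> L2_space M"
    and approx: "\<And>e. 0 < e \<Longrightarrow> \<exists>X\<in>L2_closure M S. l2norm M (\<lambda>\<omega>. Y \<omega> - X \<omega>) < e"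
  shows "Y \<in> L2_closure M S"
  unfolding L2_closure_def
proof (safe intro!: Y)
  fix e :: real assume "0 < e"
  then obtain X where X: "X \<in> L2_closure M S" "l2norm M (\<lambda>\<omega>. Y \<omega> - X \<omega>) < e/2"
    using approx[of "e/2"] by auto
  then obtain Z where Z: "Z \<in> S" "l2norm M (\<lambda>\<omega>. X \<omega> - Z \<omega>) < e/2"
    using L2_closure_D(2)[of X M S "e/2"] \<open>0 < e\<close> by auto
  have "l2norm M (\<lambda>\<omega>. Y \<omega> - Z \<omega>) < e"
    using l2norm_triangle_diff[of Y M X Z] X Z Y S by (force dest: L2_closure_D)
  then show "\<exists>Z\<in>S. l2norm M (\<lambda>\<omega>. Y \<omega> - Z \<omega>) < e" using Z by blast
qed

lemma L2_closure_cong: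
  assumes Y: "Y \<in> L2_closure M S" and S: "S \<subseteq> L2_space M" and m: "X \<in> borel_measurable M"
    and eq: "AE \<omega> in M. X \<omega> = Y \<omega>"
  shows "X \<in> L2_closure M S"
proof -
  have X: "X \<in> L2_space M"
    by (rule L2_dominated(1)[OF L2_closure_D(1)[OF Y] m]) (use eq in auto)
  have "l2norm M (\<lambda>\<omega>. X \<omega> - Z \<omega>) = l2norm M (\<lambda>\<omega>. Y \<omega> - Z \<omega>)" if "Z \<in> S" for Z
    using that S X L2_closure_D(1)[OF Y] eq
    by (intro l2norm_cong_AE) (auto dest!: subsetD L2_D(1))
  with X Y show ?thesis by (auto simp: L2_closure_def)
qed

text \<open>A trigonometric polynomial whose frequencies are at least \<open>k\<close>. The factorization
  keeps the spectrum bound in \<open>k\<close> and leaves the algebra to ordinary polynomials.\<close>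

definition tpoly :: "int \<Rightarrow> complex poly \<Rightarrow> real \<Rightarrow> complex" where
  "tpoly k P u = cis (of_int k * u) * poly P (cis u)"

definition trig_polys :: "(real \<Rightarrow> complex) set" where
  "trig_polys = {tpoly k P | k P. True}"

lemma cis_of_int_add: "cis (of_int (j + k) * u) = cis (of_int j * u) * cis (of_int k * u)"
  by (simp add: cis_mult distrib_right)

lemma tpoly_lower: "tpoly k P = tpoly (k - int n) (monom 1 n * P)"
proof
  fix u
  have "tpoly (k - int n) (monom 1 n * P) u = cis (of_int (k - int n) * u) * cis (of_int (int n) * u) * poly P (cis u)"
    by (simp add: tpoly_def poly_monom Complex.DeMoivre)
  also have "\<dots> = tpoly k P u" unfolding cis_of_int_add[symmetric] by (simp add: tpoly_def)
  finally show "tpoly k P u = tpoly (k - int n) (monom 1 n * P) u" ..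
qed

lemma tpoly_lower': "j \<le> k \<Longrightarrow> \<exists>Q. tpoly k P = tpoly j Q"
  using tpoly_lower[of k P "nat (k - j)"] by auto

lemma tpoly_mult: "tpoly j P u * tpoly k Q u = tpoly (j + k) (P * Q) u"
  by (simp add: tpoly_def cis_of_int_add del: of_int_add)

lemma tpoly_add: "tpoly k P u + tpoly k Q u = tpoly k (P + Q) u"
  by (simp add: tpoly_def algebra_simps)

lemma tpoly_smult: "c * tpoly k P u = tpoly k (smult c P) u"
  by (simp add: tpoly_def)

lemma tpoly_trig: "tpoly k P \<in> trig_polys"
  unfolding trig_polys_def by blast

lemma trig_polysE:
  assumes "f \<in> trig_polys" obtains k P where "f = tpoly k P"
  using assms unfolding trig_polys_def by blast

lemma trig_mult: "f \<in> trig_polys \<Longrightarrow> g \<in> trig_polys \<Longrightarrow> (\<lambda>u. f u * g u) \<in> trig_polys"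
  by (elim trig_polysE) (simp add: tpoly_mult tpoly_trig)

lemma trig_scale: "f \<in> trig_polys \<Longrightarrow> (\<lambda>u. c * f u) \<in> trig_polys"
  by (elim trig_polysE) (simp add: tpoly_smult tpoly_trig)

lemma trig_add: 
  assumes "f \<in> trig_polys" "g \<in> trig_polys" shows "(\<lambda>u. f u + g u) \<in> trig_polys"
proof -
  obtain j k P Q where "f = tpoly j P" "g = tpoly k Q" using assms by (metis trig_polysE)
  moreover obtain P' Q' where "tpoly j P = tpoly (min j k) P'" "tpoly k Q = tpoly (min j k) Q'"
    using tpoly_lower'[of "min j k" j P] tpoly_lower'[of "min j k" k Q] by auto
  ultimately show ?thesis by (simp add: tpoly_add tpoly_trig)
qed

lemma trig_cis: "(\<lambda>u. cis (of_int k * u)) \<in> trig_polys"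
proof -
  have "(\<lambda>u. cis (of_int k * u)) = tpoly k 1" by (auto simp: tpoly_def)
  then show ?thesis by (simp only: tpoly_trig)
qed

lemma trig_const: "(\<lambda>u. c) \<in> trig_polys"
  using trig_scale[OF trig_cis[of 0], of c] by simp

lemma trig_cnj: assumes "f \<in> trig_polys" shows "(\<lambda>u. cnj (f u)) \<in> trig_polys"
proof -
  obtain k P where f: "f = tpoly k P" using assms by (rule trig_polysE)
  have "(\<lambda>u. cnj (poly P (cis u))) \<in> trig_polys"
  proof (induction P)
    case 0
    then show ?case using trig_const[of 0] by simp
  next
    case (pCons a P)
    have "(\<lambda>u. cnj a + cis (of_int (-1) * u) * cnj (poly P (cis u))) \<in> trig_polys"
      by (intro trig_add trig_const trig_mult trig_cis pCons.IH)
    then show ?case by (simp add: cis_cnj)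
  qed
  from trig_mult[OF trig_cis[of "-k"] this] show ?thesis
    by (simp add: f tpoly_def cis_cnj)
qed

lemma tpoly_bounded: obtains C where "0 \<le> C" "\<And>u. cmod (tpoly k P u) \<le> C"
proof -
  have "continuous_on (sphere 0 1) (\<lambda>z. poly P z)" by (intro continuous_intros)
  then have "bounded ((\<lambda>z. poly P z) ` sphere 0 1)"
    by (intro compact_imp_bounded compact_continuous_image) auto
  then obtain C where C: "\<And>z. z \<in> sphere 0 1 \<Longrightarrow> cmod (poly P z) \<le> C"
    unfolding bounded_iff by blast
  have "cmod (tpoly k P u) \<le> C" for u using C[of "cis u"] by (simp add: tpoly_def norm_mult)
  moreover have "0 \<le> C" using order_trans[OF norm_ge_zero C[of 1]] by simp
  ultimately show ?thesis using that by blast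
qed

lemma continuous_on_tpoly: "continuous_on A (tpoly k P)"
  unfolding tpoly_def[abs_def] by (intro continuous_intros)

lemma measurable_lebesgue_pi:
  assumes "sets N = sets lebesgue_pi" "f \<in> borel_measurable borel"
  shows "f \<in> borel_measurable N"
  unfolding measurable_cong_sets[OF assms(1) refl]
  by (intro measurable_restrict_space1) (use assms(2) in simp)

lemma tpoly_measurable: "sets N = sets lebesgue_pi \<Longrightarrow> tpoly k P \<in> borel_measurable N"
  by (erule measurable_lebesgue_pi) (intro borel_measurable_continuous_onI continuous_on_tpoly)

lemma tpoly_L2: "finite_measure N \<Longrightarrow> sets N = sets lebesgue_pi \<Longrightarrow> tpoly k P \<in> L2_space N"
  by (rule tpoly_bounded[of k P]) (blast intro: L2_bounded tpoly_measurable)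

lemma trig_L2: "finite_measure N \<Longrightarrow> sets N = sets lebesgue_pi \<Longrightarrow> trig_polys \<subseteq> L2_space N"
  by (auto elim!: trig_polysE intro: tpoly_L2)

text \<open>On the unit circle the coordinates are the trigonometric polynomials \<open>cos u\<close> and
  \<open>sin u\<close>. This makes the Stone-Weierstrass theorem for polynomials in the coordinates
  applicable.\<close>

lemma real_polynomial_function_trig:
  assumes "real_polynomial_function (p :: complex \<Rightarrow> real)"
  shows "(\<lambda>u. complex_of_real (p (cis u))) \<in> trig_polys"
  using assms
proof induction
  case (linear f)
  interpret bounded_linear f by fact
  have f: "f z = Re z * f 1 + Im z * f \<i>" for z
  proof -
    have "z = Re z *\<^sub>R 1 + Im z *\<^sub>R \<i>" by (simp add: complex_eq_iff)
    then have "f z = f (Re z *\<^sub>R 1 + Im z *\<^sub>R \<i>)" by simp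
    then show ?thesis unfolding add scaleR by simp
  qed
  have "(\<lambda>u. (of_real (f 1) / 2 + of_real (f \<i>) / (2 * \<i>)) * cis (of_int 1 * u)
     + (of_real (f 1) / 2 - of_real (f \<i>) / (2 * \<i>)) * cis (of_int (-1) * u)) \<in> trig_polys"
    by (intro trig_add trig_scale trig_cis)
  moreover have "(of_real (f 1) / 2 + of_real (f \<i>) / (2 * \<i>)) * cis (of_int 1 * u)
     + (of_real (f 1) / 2 - of_real (f \<i>) / (2 * \<i>)) * cis (of_int (-1) * u) = of_real (f (cis u))" for u
    by (subst f) (simp add: complex_eq_iff field_simps)
  ultimately show ?case by simp
next
  case (add f g)
  then show ?case using trig_add by fastforce
next
  case (mult f g)
  then show ?case using trig_mult by fastforce
qed (rule trig_const)

lemma continuous_circle_trig_approx: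
  assumes "continuous_on (sphere 0 1) (g :: complex \<Rightarrow> real)" "0 < e"
  shows "\<exists>t\<in>trig_polys. \<forall>u. cmod (of_real (g (cis u)) - t u) < e"
proof -
  obtain p where p: "real_polynomial_function p" "\<And>x. x \<in> sphere 0 1 \<Longrightarrow> \<bar>g x - p x\<bar> < e"
    using Stone_Weierstrass_real_polynomial_function[OF compact_sphere assms] by blast
  have "cmod (of_real (g (cis u)) - of_real (p (cis u))) < e" for u
    using p(2)[of "cis u"] by (simp flip: of_real_diff)
  then show ?thesis by (intro bexI[OF _ real_polynomial_function_trig[OF p(1)]]) simp
qed

text \<open>A Borel inverse of \<open>cis\<close> with values in \<open>[-\<pi>, \<pi>)\<close>. The principal
  argument would send \<open>-1\<close> to \<open>\<pi>\<close>.\<close>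

definition circle_angle :: "complex \<Rightarrow> real" where
  "circle_angle z = (if Im z \<le> 0 then - arccos (max (-1) (min 1 (Re z))) else arccos (max (-1) (min 1 (Re z))))"

lemma circle_angle_cis:
  assumes "u \<in> {-pi..<pi}" shows "circle_angle (cis u) = u"
proof (cases "u \<le> 0")
  case True
  then have "sin u \<le> 0" using sin_ge_zero[of "-u"] assms by auto
  moreover have "arccos (cos u) = - u" using arccos_cos2[of u] True assms by auto
  ultimately show ?thesis by (simp add: circle_angle_def)
next
  case False
  then have "sin u > 0" using sin_gt_zero[of u] assms by auto
  moreover have "arccos (cos u) = u" using arccos_cos[of u] False assms by auto
  ultimately show ?thesis by (simp add: circle_angle_def)
qed

lemma circle_angle_measurable [measurable]: "circle_angle \<in> borel_measurable borel"
proof -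
  have "continuous_on UNIV (\<lambda>x::real. arccos (max (-1) (min 1 x)))"
    by (intro continuous_on_arccos continuous_intros) auto
  then have [measurable]: "(\<lambda>x::real. arccos (max (-1) (min 1 x))) \<in> borel_measurable borel"
    by (rule borel_measurable_continuous_onI)
  have [measurable]: "Re \<in> borel_measurable borel" "Im \<in> borel_measurable borel"
    by (intro borel_measurable_continuous_onI continuous_intros)+
  show ?thesis unfolding circle_angle_def by measurable
qed

context
  fixes N :: "real measure"
  assumes fin: "finite_measure N" and sets_N: "sets N = sets lebesgue_pi"
begin

interpretation finite_measure N by (rule fin)

lemma space_N: "space N = {-pi..<pi}"
  using sets_eq_imp_space_eq[OF sets_N] by (simp add: space_restrict_space)

lemma trig_closure_bounded:
  assumes "\<phi> \<in> borel_measurable N"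
    and "\<And>e. 0 < e \<Longrightarrow> \<exists>\<psi>\<in>L2_closure N trig_polys. l2norm N (\<lambda>u. \<phi> u - \<psi> u) < e"
    and "\<And>u. u \<in> space N \<Longrightarrow> cmod (\<phi> u) \<le> C"
  shows "\<phi> \<in> L2_closure N trig_polys"
  by (rule L2_closure_approx) (use assms fin sets_N in \<open>auto intro: L2_bounded trig_L2[THEN subsetD]\<close>)

lemma continuous_circle_in_closure:
  assumes g: "continuous_on UNIV (g :: complex \<Rightarrow> real)"
  shows "(\<lambda>u. complex_of_real (g (cis u))) \<in> L2_closure N trig_polys"
proof -
  have m: "(\<lambda>u. complex_of_real (g (cis u))) \<in> borel_measurable N"
    by (intro measurable_lebesgue_pi[OF sets_N] borel_measurable_continuous_onI
        continuous_intros continuous_on_compose2[OF g]) auto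
  have g': "continuous_on (sphere 0 1) g" using g by (rule continuous_on_subset) simp
  have "bounded (g ` sphere 0 1)"
    using g' by (intro compact_imp_bounded compact_continuous_image) auto
  then obtain C where C: "\<And>z. z \<in> sphere 0 1 \<Longrightarrow> \<bar>g z\<bar> \<le> C"
    unfolding bounded_iff by (metis image_eqI real_norm_def)
  show ?thesis
  proof (rule trig_closure_bounded[OF m])
    fix e :: real assume e: "0 < e"
    have c: "0 < l2norm N (\<lambda>_. 1) + 1" by (simp add: add_nonneg_pos)
    let ?d = "e / (l2norm N (\<lambda>_. 1) + 1)"
    obtain t where t: "t \<in> trig_polys" "\<And>u. cmod (of_real (g (cis u)) - t u) < ?d"
      using continuous_circle_trig_approx[OF g', of ?d] e c by auto
    have one: "(\<lambda>_. 1) \<in> L2_space N" by (rule L2_bounded[OF fin]) auto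
    have tL: "t \<in> L2_space N" using trig_L2[OF fin sets_N] t by blast
    have "l2norm N (\<lambda>u. of_real (g (cis u)) - t u) \<le> l2norm N (\<lambda>u. of_real ?d * 1)"
      using t(2) m e c tL by (intro L2_dominated(2)[OF L2_scale[OF one]])
        (auto intro!: AE_I2 less_imp_le simp: abs_of_pos norm_divide dest: L2_D)
    also have "\<dots> = ?d * l2norm N (\<lambda>_. 1)" using e c unfolding l2norm_scale by (simp add: norm_divide)
    also have "\<dots> < e" using e c by (simp add: field_simps)
    finally show "\<exists>\<psi>\<in>L2_closure N trig_polys. l2norm N (\<lambda>u. of_real (g (cis u)) - \<psi> u) < e"
      using L2_closure_base[OF trig_L2[OF fin sets_N] t(1)] by blast
  next
    show "cmod (of_real (g (cis u))) \<le> C" for u using C[of "cis u"] by simp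
  qed
qed

text \<open>The indicator of a compact subset of the plane is the pointwise limit of the functions \<open>max
  0 (1 - n dist(z, K))\<close>.\<close>

lemma compact_in_closure:
  assumes K: "compact (K :: complex set)"
  shows "(\<lambda>u. indicator K (cis u)) \<in> L2_closure N trig_polys"
proof (cases "K = {}")
  case True
  then show ?thesis
    using L2_closure_base[OF trig_L2[OF fin sets_N] trig_const[of 0]] by simp
next
  case False
  let ?g = "\<lambda>n z. max 0 (1 - real n * infdist z K)"
  have closed: "closed K" using K by (rule compact_imp_closed)
  have [measurable]: "K \<in> sets borel" using closed by simp
  have [measurable]: "cis \<in> borel_measurable borel"
    by (intro borel_measurable_continuous_onI continuous_intros)
  have m1: "(\<lambda>u. indicator K (cis u) :: complex) \<in> borel_measurable N"
    by (rule measurable_lebesgue_pi[OF sets_N]) measurable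
  have m2: "(\<lambda>u. complex_of_real (?g n (cis u))) \<in> borel_measurable N" for n
    by (intro measurable_lebesgue_pi[OF sets_N] borel_measurable_continuous_onI continuous_intros)
  have conv: "(\<lambda>n. complex_of_real (?g n z)) \<longlonglongrightarrow> indicator K z" for z
  proof (cases "z \<in> K")
    case False
    then have d: "0 < infdist z K"
      using closed \<open>K \<noteq> {}\<close> infdist_nonneg[of z K] in_closed_iff_infdist_zero[of K z] by force
    obtain n0 :: nat where n0: "1 < real n0 * infdist z K" using reals_Archimedean3[OF d] by blast
    have "?g n z = 0" if "n \<ge> n0" for n
    proof -
      have "real n0 * infdist z K \<le> real n * infdist z K" using that d by (intro mult_right_mono) auto
      then show ?thesis using n0 by simp
    qed
    then have "\<forall>\<^sub>F n in sequentially. complex_of_real (?g n z) = indicator K z"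
      using False by (auto simp: eventually_sequentially)
    then show ?thesis by (rule tendsto_eventually)
  qed simp
  have "(\<lambda>n. l2norm N (\<lambda>u. complex_of_real (?g n (cis u)) - indicator K (cis u))) \<longlonglongrightarrow> 0"
  proof (rule dominated_convergence_l2norm)
    show "(\<lambda>u. 1) \<in> L2_space N" by (rule L2_bounded[OF fin]) auto
    fix n u
    have "0 \<le> ?g n (cis u)" "?g n (cis u) \<le> 1" using infdist_nonneg[of "cis u" K] by auto
    moreover have "cis u \<in> K \<Longrightarrow> ?g n (cis u) = 1" by simp
    ultimately show "cmod (complex_of_real (?g n (cis u)) - indicator K (cis u)) \<le> cmod 1"
      by (auto simp: indicator_def)
  qed (use m1 m2 conv in auto)
  note lim = this
  show ?thesis
  proof (rule trig_closure_bounded[OF m1])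
    fix e :: real assume "0 < e"
    then obtain n where "l2norm N (\<lambda>u. complex_of_real (?g n (cis u)) - indicator K (cis u)) < e"
      using tendsto_0_ex_less[OF lim \<open>0 < e\<close>] by (elim exE)
    then have "l2norm N (\<lambda>u. indicator K (cis u) - complex_of_real (?g n (cis u))) < e"
      by (subst l2norm_minus_commute)
    moreover have "(\<lambda>u. complex_of_real (?g n (cis u))) \<in> L2_closure N trig_polys"
      by (intro continuous_circle_in_closure continuous_intros)
    ultimately show "\<exists>\<psi>\<in>L2_closure N trig_polys. l2norm N (\<lambda>u. indicator K (cis u) - \<psi> u) < e"
      by (rule bexI)
  qed (auto simp: indicator_def intro: exI[of _ 1])
qed

text \<open>Transport the measure to the plane by \<open>cis\<close>, where inner regularity supplies a
  compact set that exhausts the image of \<open>A\<close> up to \<open>e\<^sup>2\<close>.\<close>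

lemma indicator_in_closure:
  assumes A: "A \<in> sets N"
  shows "indicator A \<in> L2_closure N trig_polys"
proof (rule trig_closure_bounded)
  show "(indicator A :: _ \<Rightarrow> complex) \<in> borel_measurable N" using A by auto
  have A_borel: "A \<in> sets borel" and A_sub: "A \<subseteq> {-pi..<pi}"
    using A by (auto simp: sets_N sets_restrict_space)
  have cis_m [measurable]: "cis \<in> measurable N borel"
    by (intro measurable_lebesgue_pi[OF sets_N] borel_measurable_continuous_onI continuous_intros)
  define A' where "A' = circle_angle -` A"
  have A'b: "A' \<in> sets borel"
    unfolding A'_def using measurable_sets_borel[OF circle_angle_measurable A_borel] by simp
  have A'_iff: "cis u \<in> A' \<longleftrightarrow> u \<in> A" if "u \<in> space N" for u
    using circle_angle_cis[of u] that by (simp add: A'_def space_N)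
  define N' where "N' = distr N borel cis"
  interpret N': finite_measure N' unfolding N'_def by (rule finite_measure_distr) simp
  fix e :: real assume e: "0 < e"
  have "\<exists>K. K \<subseteq> A' \<and> compact K \<and> emeasure N' A' < emeasure N' K + ennreal (e\<^sup>2)"
  proof (cases "emeasure N' A' = 0")
    case True
    then show ?thesis using e by (intro exI[of _ "{}"]) auto
  next
    case False
    then have "emeasure N' A' - ennreal (e\<^sup>2) < emeasure N' A'"
      using e N'.emeasure_finite[of A']
      by (intro ennreal_between) (auto simp: zero_less_iff_neq_zero less_top[symmetric])
    also have "emeasure N' A' = (SUP K \<in> {K. K \<subseteq> A' \<and> compact K}. emeasure N' K)"
      by (rule inner_regular) (auto simp: N'_def A'b[unfolded] N'.emeasure_finite[unfolded N'_def])
    finally obtain K where "K \<subseteq> A'" "compact K" "emeasure N' A' - ennreal (e\<^sup>2) < emeasure N' K"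
      by (auto simp: less_SUP_iff)
    then show ?thesis
    proof (intro exI[of _ K] conjI)
      have "\<not> measure N' K \<le> measure N' A' - e\<^sup>2"
        using \<open>emeasure N' A' - ennreal (e\<^sup>2) < emeasure N' K\<close>
        by (auto simp: N'.emeasure_eq_measure ennreal_minus dest: ennreal_leI)
      then show "emeasure N' A' < emeasure N' K + ennreal (e\<^sup>2)"
        by (simp add: N'.emeasure_eq_measure ennreal_less_iff flip: ennreal_plus)
    qed
  qed
  then obtain K where K: "K \<subseteq> A'" "compact K" "emeasure N' A' < emeasure N' K + ennreal (e\<^sup>2)" by blast
  have Kb: "K \<in> sets borel" using K(2) by (simp add: borel_compact)
  let ?B = "cis -` (A' - K) \<inter> space N"
  have "emeasure N' K + emeasure N' (A' - K) = emeasure N' A'"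
    using K(1) A'b Kb plus_emeasure[of K N' "A' - K"] by (simp add: N'_def Un_absorb1)
  then have "measure N' (A' - K) < e\<^sup>2"
    using K(3) e by (simp add: N'.emeasure_eq_measure ennreal_less_iff flip: ennreal_plus)
  then have Bm: "measure N ?B < e\<^sup>2" using A'b Kb by (simp add: N'_def measure_distr)
  have Bs: "?B \<in> sets N" using A'b Kb by (intro measurable_sets[OF cis_m]) auto
  have "(l2norm N (\<lambda>u. indicator A u - indicator K (cis u)))\<^sup>2 = (\<integral>u. indicator ?B u \<partial>N)"
    unfolding l2norm_sq
  proof (rule Bochner_Integration.integral_cong)
    fix u assume "u \<in> space N"
    then show "(cmod (indicator A u - indicator K (cis u)))\<^sup>2 = indicator ?B u"
      using A'_iff K(1) by (auto simp: indicator_def)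
  qed simp
  also have "\<dots> = measure N ?B" using Bs by (simp add: Int_absorb1 sets.sets_into_space)
  finally have "l2norm N (\<lambda>u. indicator A u - indicator K (cis u)) < e"
    using Bm e by (intro power_less_imp_less_base[of _ 2 e]) auto
  then show "\<exists>\<psi>\<in>L2_closure N trig_polys. l2norm N (\<lambda>u. indicator A u - \<psi> u) < e"
    by (rule bexI[OF _ compact_in_closure[OF K(2)]])
qed (auto simp: indicator_def intro: exI[of _ 1])

lemma simple_in_closure:
  assumes "simple_function N g" shows "g \<in> L2_closure N trig_polys"
proof -
  have trigs: "trig_polys \<subseteq> L2_space N" by (rule trig_L2[OF fin sets_N])
  have fin_img: "finite (g ` space N)" using assms by (rule simple_functionD)
  have "(\<lambda>u. \<Sum>y\<in>I. y * indicator (g -` {y} \<inter> space N) u) \<in> L2_closure N trig_polys"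
    if "finite I" for I
    using that
  proof induction
    case empty
    then show ?case using L2_closure_base[OF trigs trig_const[of 0]] by simp
  next
    case (insert y I)
    have "(\<lambda>u. y * indicator (g -` {y} \<inter> space N) u) \<in> L2_closure N trig_polys"
      using simple_functionD(2)[OF assms, of "{y}"]
      by (intro L2_closure_scale trig_scale indicator_in_closure)
    from L2_closure_add[OF trigs trig_add this insert.IH]
    have "(\<lambda>u. y * indicator (g -` {y} \<inter> space N) u + (\<Sum>y\<in>I. y * indicator (g -` {y} \<inter> space N) u))
      \<in> L2_closure N trig_polys" .
    then show ?case by (simp only: sum.insert[OF insert.hyps])
  qed
  note * = this[OF fin_img]
  show ?thesis
    by (rule L2_closure_cong[OF * trigs borel_measurable_simple_function[OF assms]]) (rule AE_I2, erule simple_function_decomp[OF assms])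
qed

text \<open>Simple functions are dense; Borel sets are approximated from inside by compact ones, the
  indicators of these by continuous functions on the circle, and continuous functions uniformly by
  Stone-Weierstrass.\<close>

theorem trig_polys_dense:
  assumes \<phi>: "\<phi> \<in> L2_space N" shows "\<phi> \<in> L2_closure N trig_polys"
proof (rule L2_closure_approx[OF trig_L2[OF fin sets_N] \<phi>])
  obtain F where F: "\<And>i. simple_function N (F i)"
    and lim: "(\<lambda>n. l2norm N (\<lambda>u. F n u - \<phi> u)) \<longlonglongrightarrow> 0"
    using L2_simple_approx[OF \<phi>] by blast
  fix e :: real assume "0 < e"
  then obtain n where "l2norm N (\<lambda>u. F n u - \<phi> u) < e"
    using tendsto_0_ex_less[OF lim \<open>0 < e\<close>] by (elim exE)
  then show "\<exists>X\<in>L2_closure N trig_polys. l2norm N (\<lambda>u. \<phi> u - X u) < e"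
    by (subst l2norm_minus_commute) (rule bexI[OF _ simple_in_closure[OF F]])
qed

end

section \<open>Analytic trigonometric polynomials on the circle\<close>

lemma space_lebesgue_pi [simp]: "space lebesgue_pi = {-pi..<pi}"
  by (simp add: space_restrict_space)

lemma sets_lebesgue_pi_top [simp]: "{-pi..<pi} \<in> sets lebesgue_pi"
  using sets.top[of lebesgue_pi] by (simp only: space_lebesgue_pi)

lemma finite_measure_lebesgue_pi: "finite_measure lebesgue_pi"
  by (rule finite_measureI) (simp add: emeasure_restrict_space)

lemma measure_lebesgue_pi: "measure lebesgue_pi {-pi..<pi} = 2 * pi"
  by (simp add: measure_restrict_space)

lemma integral_cis_lebesgue_pi:
  "(\<integral>u. cis (of_int k * u) \<partial>lebesgue_pi) = (if k = 0 then of_real (2 * pi) else 0)"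
proof (cases "k = 0")
  case True
  then show ?thesis using measure_lebesgue_pi by (simp add: scaleR_conv_of_real)
next
  case False
  have eq: "(\<integral>u. cis (of_int k * u) \<partial>lebesgue_pi) = (\<integral>u. indicator {-pi..pi} u *\<^sub>R cis (of_int k * u) \<partial>lborel)"
  proof -
    have "AE u in lborel. u \<noteq> pi" by (rule AE_lborel_singleton)
    then have "AE u in lborel. indicator {-pi..<pi} u *\<^sub>R cis (of_int k * u) = indicator {-pi..pi} u *\<^sub>R cis (of_int k * u)"
      by eventually_elim (auto simp: indicator_def)
    moreover have "cis \<in> borel_measurable borel" by (intro borel_measurable_continuous_onI continuous_intros)
    ultimately show ?thesis
      by (subst integral_restrict_space) (auto intro!: integral_cong_AE)
  qed
  define F where "F u = cis (of_int k * u) / (\<i> * of_int k)" for u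
  have "(F has_vector_derivative cis (of_int k * u)) (at u within {-pi..pi})" for u
  proof -
    have "((\<lambda>u. exp (\<i> * of_int k * of_real u)) has_vector_derivative exp (\<i> * of_int k * of_real u) * (\<i> * of_int k)) (at u within {-pi..pi})"
      by (rule has_vector_derivative_real_field[where f="\<lambda>z. exp (\<i> * of_int k * z)"])
         (auto intro!: derivative_eq_intros)
    from has_vector_derivative_divide[OF this, of "\<i> * of_int k"] show ?thesis
      using False by (simp add: F_def[abs_def] cis_conv_exp mult.assoc)
  qed
  then have "(\<integral>u. indicator {-pi..pi} u *\<^sub>R cis (of_int k * u) \<partial>lborel) = F pi - F (-pi)"
    by (intro integral_FTC_Icc) (auto intro!: continuous_intros)
  also have "cis (of_int k * pi) = cis (of_int k * (-pi))"
  proof -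
    have "cis (of_int k * pi) = cis (of_int k * (-pi)) * cis (2 * pi * of_int k)"
      by (simp add: cis_mult algebra_simps)
    then show ?thesis by simp
  qed
  then have "F pi - F (-pi) = 0" by (simp add: F_def)
  finally show ?thesis using eq False by simp
qed

lemma tpoly_sum: "tpoly k P u = (\<Sum>i\<le>degree P. coeff P i * cis (of_int (k + int i) * u))"
  by (simp add: tpoly_def poly_altdef sum_distrib_left Complex.DeMoivre cis_of_int_add del: of_int_add)
     (simp add: mult_ac)

lemma cis_integrable_lebesgue_pi: "integrable lebesgue_pi (\<lambda>u. cis (of_int k * u))"
proof -
  interpret finite_measure lebesgue_pi by (rule finite_measure_lebesgue_pi)
  show ?thesis
    by (rule integrable_const_bound[where B=1])
       (auto intro!: measurable_lebesgue_pi borel_measurable_continuous_onI continuous_intros)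
qed

lemma tpoly_integral:
  "(\<integral>u. tpoly k P u \<partial>lebesgue_pi) = (\<Sum>i\<le>degree P. coeff P i * (if k + int i = 0 then of_real (2 * pi) else 0))"
  unfolding tpoly_sum by (subst Bochner_Integration.integral_sum)
    (auto simp: integral_cis_lebesgue_pi simp del: of_int_add intro: cis_integrable_lebesgue_pi)

lemma poly_cis_tpoly: "poly P (cis u) = tpoly 0 P u"
  by (simp add: tpoly_def)

lemma integral_poly_cis: "(\<integral>u. poly P (cis u) \<partial>lebesgue_pi) = of_real (2 * pi) * poly P 0"
proof -
  have "(\<Sum>i\<le>degree P. coeff P i * (if 0 + int i = 0 then of_real (2 * pi) else 0)) = (\<Sum>i\<le>degree P. if i = 0 then coeff P 0 * of_real (2 * pi) else 0)"
    by (intro sum.cong) auto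
  then show ?thesis by (simp add: poly_cis_tpoly tpoly_integral poly_0_coeff_0 del: of_real_mult)
qed

lemma tpoly_integrable:
  assumes "finite_measure N" "sets N = sets lebesgue_pi" shows "integrable N (tpoly k P)"
proof -
  interpret finite_measure N by fact
  obtain C where "\<And>u. cmod (tpoly k P u) \<le> C" using tpoly_bounded by blast
  then show ?thesis by (intro integrable_const_bound[where B=C]) (use assms in \<open>auto intro: tpoly_measurable\<close>)
qed

definition exp_poly :: "complex poly \<Rightarrow> nat \<Rightarrow> complex poly" where
  "exp_poly P n = (\<Sum>j<n. smult (1 / fact j) (P ^ j))"

lemma poly_exp_poly: "poly (exp_poly P n) z = (\<Sum>j<n. poly P z ^ j /\<^sub>R fact j)"
  by (simp add: exp_poly_def poly_sum poly_power scaleR_conv_of_real divide_inverse)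

lemma exp_poly_tendsto: "(\<lambda>n. poly (exp_poly P n) z) \<longlonglongrightarrow> exp (poly P z)"
  unfolding poly_exp_poly using exp_converges[of "poly P z"] by (simp add: sums_def)

lemma exp_poly_bound:
  assumes "cmod (poly P z) \<le> C" shows "cmod (poly (exp_poly P n) z) \<le> exp C"
proof -
  have "cmod (poly (exp_poly P n) z) \<le> (\<Sum>j<n. norm (poly P z ^ j /\<^sub>R fact j))"
    unfolding poly_exp_poly by (rule norm_sum)
  also have "\<dots> = (\<Sum>j<n. cmod (poly P z) ^ j /\<^sub>R fact j)" by (simp add: norm_power)
  also have "\<dots> \<le> exp (cmod (poly P z))"
    using exp_converges[of "cmod (poly P z)"] unfolding sums_iff
    by (metis (no_types, lifting) divide_inverse_commute norm_ge_zero sum_le_suminf finite_lessThan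
        real_scaleR_def inverse_nonnegative_iff_nonnegative fact_ge_zero zero_le_power mult_nonneg_nonneg)
  also have "\<dots> \<le> exp C" using assms by simp
  finally show ?thesis .
qed

lemma exp_poly_l2norm_tendsto:
  assumes fin: "finite_measure N" and sets_N: "sets N = sets lebesgue_pi"
  shows "(\<lambda>n. l2norm N (\<lambda>u. poly (exp_poly P n) (cis u) - exp (poly P (cis u)))) \<longlonglongrightarrow> 0"
proof -
  obtain C where C: "\<And>u. cmod (tpoly 0 P u) \<le> C" using tpoly_bounded by blast
  have lim: "(\<lambda>n. poly (exp_poly P n) (cis u)) \<longlonglongrightarrow> exp (poly P (cis u))" for u by (rule exp_poly_tendsto)
  have b: "cmod (poly (exp_poly P n) (cis u)) \<le> exp C" for n u
    using C[of u] by (intro exp_poly_bound) (simp add: tpoly_def)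
  have b': "cmod (exp (poly P (cis u))) \<le> exp C" for u
    using C[of u] complex_Re_le_cmod[of "poly P (cis u)"] by (simp add: tpoly_def)
  show ?thesis
  proof (rule dominated_convergence_l2norm)
    show "(\<lambda>u. complex_of_real (2 * exp C)) \<in> L2_space N"
      by (rule L2_bounded[OF fin, where C="2 * exp C"]) auto
    show "cmod (poly (exp_poly P n) (cis u) - exp (poly P (cis u))) \<le> cmod (complex_of_real (2 * exp C))" for n u
      using norm_triangle_ineq4[of "poly (exp_poly P n) (cis u)" "exp (poly P (cis u))"] b[of n u] b'[of u]
      by (simp add: norm_mult del: norm_exp_eq_Re)
    show "(\<lambda>u. poly (exp_poly P n) (cis u)) \<in> borel_measurable N" for n
      unfolding poly_cis_tpoly by (rule tpoly_measurable[OF sets_N])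
    show "(\<lambda>u. exp (poly P (cis u))) \<in> borel_measurable N"
      by (intro measurable_lebesgue_pi[OF sets_N] borel_measurable_continuous_onI continuous_intros)
  qed (rule lim)
qed

text \<open>The mean value property of \<open>Q exp P\<close>: taking the mean over the circle is
  multiplicative on polynomials in \<open>e\<^sup>i\<^sup>u\<close>, and the exponential series converges
  uniformly there.\<close>

lemma integral_poly_exp_cis:
  "(\<integral>u. poly Q (cis u) * exp (poly P (cis u)) \<partial>lebesgue_pi) = of_real (2 * pi) * (poly Q 0 * exp (poly P 0))"
proof (rule LIMSEQ_unique)
  interpret finite_measure lebesgue_pi by (rule finite_measure_lebesgue_pi)
  obtain C where C: "\<And>u. cmod (tpoly 0 P u) \<le> C" using tpoly_bounded by blast
  obtain D where D: "0 \<le> D" "\<And>u. cmod (tpoly 0 Q u) \<le> D" using tpoly_bounded by blast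
  show "(\<lambda>n. \<integral>u. poly (Q * exp_poly P n) (cis u) \<partial>lebesgue_pi) \<longlonglongrightarrow> (\<integral>u. poly Q (cis u) * exp (poly P (cis u)) \<partial>lebesgue_pi)"
  proof (rule integral_dominated_convergence[where w="\<lambda>u. D * exp C"])
    have "cmod (poly (Q * exp_poly P n) (cis u)) \<le> D * exp C" for n u
      unfolding poly_mult norm_mult using C[of u] D
      by (intro mult_mono exp_poly_bound) (simp_all add: tpoly_def)
    then show "AE u in lebesgue_pi. cmod (poly (Q * exp_poly P n) (cis u)) \<le> D * exp C" for n by simp
    show "AE u in lebesgue_pi. (\<lambda>n. poly (Q * exp_poly P n) (cis u)) \<longlonglongrightarrow> poly Q (cis u) * exp (poly P (cis u))"
      unfolding poly_mult by (intro AE_I2 tendsto_mult tendsto_const exp_poly_tendsto)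
    show "(\<lambda>u. poly Q (cis u) * exp (poly P (cis u))) \<in> borel_measurable lebesgue_pi"
      by (intro measurable_lebesgue_pi[OF refl] borel_measurable_continuous_onI continuous_intros)
    show "(\<lambda>u. poly (Q * exp_poly P n) (cis u)) \<in> borel_measurable lebesgue_pi" for n
      unfolding poly_cis_tpoly by (rule tpoly_measurable[OF refl])
  qed simp
  show "(\<lambda>n. \<integral>u. poly (Q * exp_poly P n) (cis u) \<partial>lebesgue_pi) \<longlonglongrightarrow> of_real (2 * pi) * (poly Q 0 * exp (poly P 0))"
    unfolding integral_poly_cis unfolding poly_mult by (intro tendsto_mult tendsto_const exp_poly_tendsto)
qed

text \<open>Adding twice the strictly positive frequencies of \<open>\<bar>S\<bar>\<^sup>2\<close> to its mean
  gives \<open>P\<close>. The induction produces it directly: \<open>\<bar>a + z S(z)\<bar>\<^sup>2 =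
  \<bar>a\<bar>\<^sup>2 + 2 Re (cnj a z S(z)) + \<bar>S(z)\<bar>\<^sup>2\<close> when \<open>\<bar>z\<bar> =
  1\<close>.\<close>

lemma ex_poly_Re_eq_norm_sq:
  "\<exists>P. (\<forall>z. cmod z = 1 \<longrightarrow> Re (poly P z) = (cmod (poly S z))\<^sup>2) \<and> poly P 0 \<in> \<real>"
proof (induction S)
  case 0
  show ?case by (intro exI[of _ 0]) simp
next
  case (pCons a S)
  then obtain P where P: "\<And>z. cmod z = 1 \<Longrightarrow> Re (poly P z) = (cmod (poly S z))\<^sup>2" "poly P 0 \<in> \<real>"
    by blast
  let ?P = "[:of_real ((cmod a)\<^sup>2):] + smult (2 * cnj a) (pCons 0 S) + P"
  have "Re (poly ?P z) = (cmod (poly (pCons a S) z))\<^sup>2" if z: "cmod z = 1" for z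
  proof -
    let ?w = "z * poly S z"
    have "(cmod (a + ?w))\<^sup>2 = (cmod a)\<^sup>2 + 2 * Re (cnj a * ?w) + (cmod ?w)\<^sup>2"
      unfolding cmod_power2 by (simp add: power2_eq_square algebra_simps)
    moreover have "cmod ?w = cmod (poly S z)" using z by (simp add: norm_mult)
    ultimately show ?thesis using P(1)[OF z] by (simp add: algebra_simps)
  qed
  moreover have "poly ?P 0 \<in> \<real>" using P(2) by simp
  ultimately show ?case by blast
qed

text \<open>A shift of the frequencies does not change the modulus, so the polynomial factor of
  \<open>s\<close> decides. The value \<open>P(0)\<close> is the mean of \<open>P\<close> over the circle and
  hence of \<open>\<bar>s\<bar>\<^sup>2\<close>; it controls the mean of exponentials of
  \<open>P\<close>.\<close>

lemma trig_norm_sq_analytic: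
  assumes "s \<in> trig_polys"
  obtains P where "\<And>u. Re (poly P (cis u)) = (cmod (s u))\<^sup>2"
    "poly P 0 = of_real ((l2norm lebesgue_pi s)\<^sup>2 / (2 * pi))"
proof -
  obtain k S where s: "s = tpoly k S" using assms by (rule trig_polysE)
  obtain P where P: "\<And>z. cmod z = 1 \<Longrightarrow> Re (poly P z) = (cmod (poly S z))\<^sup>2" "poly P 0 \<in> \<real>"
    using ex_poly_Re_eq_norm_sq by blast
  have re: "Re (poly P (cis u)) = (cmod (s u))\<^sup>2" for u
    using P(1)[of "cis u"] by (simp add: s tpoly_def norm_mult)
  have "integrable lebesgue_pi (\<lambda>u. poly P (cis u))"
    unfolding poly_cis_tpoly by (rule tpoly_integrable[OF finite_measure_lebesgue_pi refl])
  then have "(l2norm lebesgue_pi s)\<^sup>2 = Re (\<integral>u. poly P (cis u) \<partial>lebesgue_pi)"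
    unfolding l2norm_sq re[symmetric] by simp
  also have "\<dots> = 2 * pi * Re (poly P 0)" by (simp add: integral_poly_cis)
  finally have "poly P 0 = of_real ((l2norm lebesgue_pi s)\<^sup>2 / (2 * pi))"
    using P(2) by (simp add: complex_eq_iff complex_is_Real_iff)
  with re show ?thesis by (rule that)
qed

text \<open>The indicator of \<open>A\<close> is approximated in mean square with respect to the weighted
  measure \<open>\<bar>h\<bar> du\<close>, so that the error is small after integration against
  \<open>h\<close>.\<close>

theorem Fourier_coefficients_unique:
  fixes h :: "real \<Rightarrow> complex"
  assumes h: "integrable lebesgue_pi h"
    and coeff: "\<And>k. (\<integral>u. h u * cis (of_int k * u) \<partial>lebesgue_pi) = 0"
  shows "AE u in lebesgue_pi. h u = 0"
proof -
  interpret finite_measure lebesgue_pi by (rule finite_measure_lebesgue_pi)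
  have hm [measurable]: "h \<in> borel_measurable lebesgue_pi" using h by auto
  define N where "N = density lebesgue_pi (\<lambda>u. ennreal (cmod (h u)))"
  have sets_N: "sets N = sets lebesgue_pi" by (simp add: N_def)
  have fin: "finite_measure N"
  proof (rule finite_measureI)
    have "emeasure N (space N) = (\<integral>\<^sup>+u. ennreal (cmod (h u)) * indicator (space lebesgue_pi) u \<partial>lebesgue_pi)"
      unfolding N_def space_density by (rule emeasure_density) auto
    also have "\<dots> = (\<integral>\<^sup>+u. ennreal (cmod (h u)) \<partial>lebesgue_pi)"
      by (intro nn_integral_cong) simp
    also have "\<dots> < \<infinity>" using h by (simp add: integrable_iff_bounded)
    finally show "emeasure N (space N) \<noteq> \<infinity>" by simp
  qed
  have one: "(\<lambda>_. 1) \<in> L2_space N" by (rule L2_bounded[OF fin]) auto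
  have ht: "integrable lebesgue_pi (\<lambda>u. h u * t u)" "(\<integral>u. h u * t u \<partial>lebesgue_pi) = 0" if "t \<in> trig_polys" for t
  proof -
    obtain k P where t: "t = tpoly k P" using \<open>t \<in> trig_polys\<close> by (rule trig_polysE)
    have i: "integrable lebesgue_pi (\<lambda>u. h u * cis (of_int j * u))" for j
      by (rule Bochner_Integration.integrable_bound[OF h])
         (auto simp: norm_mult intro!: borel_measurable_times borel_measurable_integrable[OF cis_integrable_lebesgue_pi])
    have eq: "h u * t u = (\<Sum>i\<le>degree P. coeff P i * (h u * cis (of_int (k + int i) * u)))" for u
      unfolding t tpoly_sum sum_distrib_left by (intro sum.cong) (auto simp: mult_ac)
    show "integrable lebesgue_pi (\<lambda>u. h u * t u)" unfolding eq by (intro Bochner_Integration.integrable_sum integrable_mult_right i)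
    show "(\<integral>u. h u * t u \<partial>lebesgue_pi) = 0"
      unfolding eq
      by (subst Bochner_Integration.integral_sum) (simp_all add: integrable_mult_right[OF i] coeff del: of_int_add)
  qed
  show ?thesis
  proof (rule density_zero[OF h])
    fix A :: "real set" assume A: "A \<in> sets lebesgue_pi"
    have indA: "indicator A u *\<^sub>R h u = indicator A u * h u" for u by (cases "u \<in> A") auto
    have iA: "integrable lebesgue_pi (\<lambda>u. indicator A u * h u)"
      using integrable_mult_indicator[OF A h] unfolding indA .
    have "cmod (\<integral>u. indicator A u * h u \<partial>lebesgue_pi) \<le> 0"
    proof (rule field_le_epsilon)
      fix e :: real assume e: "0 < e"
      have c: "0 < l2norm N (\<lambda>_. 1) + 1" by (simp add: add_nonneg_pos)
      have "(indicator A :: _ \<Rightarrow> complex) \<in> L2_space N"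
        by (rule L2_bounded[OF fin, where C=1]) (use A sets_N in \<open>auto simp: indicator_def\<close>)
      from L2_closure_D(2)[OF trig_polys_dense[OF fin sets_N this], of "e / (l2norm N (\<lambda>_. 1) + 1)"]
      obtain t where t: "t \<in> trig_polys" "l2norm N (\<lambda>u. indicator A u - t u) < e / (l2norm N (\<lambda>_. 1) + 1)"
        using e c by auto
      have tm [measurable]: "t \<in> borel_measurable lebesgue_pi"
        using t(1) tpoly_measurable[of lebesgue_pi] by (auto elim!: trig_polysE)
      have dL: "(\<lambda>u. indicator A u - t u) \<in> L2_space N"
        using trig_L2[OF fin sets_N] t(1) \<open>indicator A \<in> L2_space N\<close> by (intro L2_diff) auto
      have "cmod (\<integral>u. indicator A u * h u \<partial>lebesgue_pi) = cmod (\<integral>u. indicator A u * h u - h u * t u \<partial>lebesgue_pi)"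
        using iA ht[OF t(1)] by simp
      also have "\<dots> \<le> (\<integral>u. cmod (indicator A u * h u - h u * t u) \<partial>lebesgue_pi)" by (rule integral_norm_bound)
      also have "\<dots> = (\<integral>u. cmod (h u) *\<^sub>R cmod (indicator A u - t u) \<partial>lebesgue_pi)"
      proof (rule Bochner_Integration.integral_cong[OF refl])
        fix u
        have "indicator A u * h u - h u * t u = h u * (indicator A u - t u)" by (simp add: algebra_simps)
        then show "cmod (indicator A u * h u - h u * t u) = cmod (h u) *\<^sub>R cmod (indicator A u - t u)"
          by (simp add: norm_mult)
      qed
      also have "\<dots> = (\<integral>u. cmod (indicator A u - t u) \<partial>N)"
        unfolding N_def using A by (subst integral_density) auto
      also have "\<dots> \<le> l2norm N (\<lambda>u. indicator A u - t u) * l2norm N (\<lambda>_. 1)"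
        using L2_Cauchy_Schwarz_norm[OF dL one] by simp
      also have "\<dots> \<le> l2norm N (\<lambda>u. indicator A u - t u) * (l2norm N (\<lambda>_. 1) + 1)"
        by (intro mult_left_mono) auto
      also have "\<dots> \<le> e" using t(2) c by (simp add: field_simps)
      finally show "cmod (\<integral>u. indicator A u * h u \<partial>lebesgue_pi) \<le> 0 + e" by simp
    qed
    then show "set_lebesgue_integral lebesgue_pi A h = 0"
      unfolding set_lebesgue_integral_def indA by simp
  qed
qed

section \<open>The singular part of the spectrum\<close>

lemma L2_mono_measure:
  assumes sets_eq: "sets M = sets N" and le: "M \<le> N" and X: "X \<in> L2_space N"
  shows "X \<in> L2_space M" "l2norm M X \<le> l2norm N X"
proof -
  have [measurable]: "X \<in> borel_measurable M"
    using L2_D(1)[OF X] measurable_cong_sets[OF sets_eq refl] by blast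
  have "(\<integral>\<^sup>+u. ennreal ((cmod (X u))\<^sup>2) \<partial>M) \<le> (\<integral>\<^sup>+u. ennreal ((cmod (X u))\<^sup>2) \<partial>N)"
    by (rule nn_integral_mono_measure[OF sets_eq le])
  also have "\<dots> = ennreal ((l2norm N X)\<^sup>2)"
    using nn_integral_eq_integral[OF L2_D(2)[OF X]] by (simp add: l2norm_sq)
  finally have *: "(\<integral>\<^sup>+u. ennreal ((cmod (X u))\<^sup>2) \<partial>M) \<le> ennreal ((l2norm N X)\<^sup>2)" .
  then have i: "integrable M (\<lambda>u. (cmod (X u))\<^sup>2)"
    by (intro integrableI_bounded) (auto simp: less_top[symmetric] top_unique)
  then show "X \<in> L2_space M" by (simp add: L2_space_def)
  have "(l2norm M X)\<^sup>2 \<le> (l2norm N X)\<^sup>2"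
    using * nn_integral_eq_integral[OF i] by (simp add: l2norm_sq[of M] ennreal_le_iff)
  then show "l2norm M X \<le> l2norm N X" by (rule power2_le_imp_le) simp
qed

text \<open>One trigonometric polynomial can then be chosen to approximate in two measures at once.\<close>

lemma common_finite_bound:
  assumes M: "finite_measure M" and N: "finite_measure N" and sets_eq: "sets N = sets M"
  obtains K where "finite_measure K" "sets K = sets M" "M \<le> K" "N \<le> K"
proof (rule that)
  let ?K = "sup_measure' M N"
  interpret M: finite_measure M by fact
  interpret N: finite_measure N by fact
  show sets_K: "sets ?K = sets M" using sets_eq by simp
  show "finite_measure ?K"
  proof (rule finite_measureI)
    have "emeasure ?K (space ?K) \<le> emeasure M (space M) + emeasure N (space N)"
      using sets_eq by (subst emeasure_sup_measure') (auto intro!: SUP_least add_mono emeasure_space)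
    also have "\<dots> < \<infinity>" by (simp add: M.emeasure_finite N.emeasure_finite less_top[symmetric])
    finally show "emeasure ?K (space ?K) \<noteq> \<infinity>" by simp
  qed
  show "M \<le> ?K" using sets_eq by (subst le_measure) (auto intro: le_emeasure_sup_measure'1 simp: le_fun_def emeasure_notin_sets)
  show "N \<le> ?K" using sets_eq by (subst le_measure) (auto intro: le_emeasure_sup_measure'2 simp: le_fun_def emeasure_notin_sets)
qed

lemma coeff_le_l2norm:
  "cmod (coeff Q k) \<le> l2norm lebesgue_pi (\<lambda>u. poly Q (cis u))"
proof -
  note fin = finite_measure_lebesgue_pi
  have Q: "(\<lambda>u. poly Q (cis u)) \<in> L2_space lebesgue_pi" unfolding poly_cis_tpoly by (rule tpoly_L2[OF fin refl])
  have e: "(\<lambda>u. cis (of_int (int k) * u)) \<in> L2_space lebesgue_pi"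
    using trig_L2[OF fin refl] trig_cis by blast
  have "of_real (2 * pi) * coeff Q k = (\<integral>u. tpoly (- int k) Q u \<partial>lebesgue_pi)"
  proof -
    have "(\<integral>u. tpoly (- int k) Q u \<partial>lebesgue_pi) = (\<Sum>i\<le>degree Q. if i = k then coeff Q k * of_real (2 * pi) else 0)"
      unfolding tpoly_integral by (intro sum.cong) auto
    also have "\<dots> = of_real (2 * pi) * coeff Q k" by (auto simp: coeff_eq_0 not_le)
    finally show ?thesis ..
  qed
  also have "\<dots> = (\<integral>u. poly Q (cis u) * cnj (cis (of_int (int k) * u)) \<partial>lebesgue_pi)"
    by (simp add: tpoly_def cis_cnj mult.commute)
  finally have "2 * pi * cmod (coeff Q k) \<le> l2norm lebesgue_pi (\<lambda>u. poly Q (cis u)) * l2norm lebesgue_pi (\<lambda>u. cis (of_int (int k) * u))"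
    using L2_Cauchy_Schwarz[OF Q e] by (metis norm_mult norm_of_real abs_of_nonneg pi_ge_zero zero_le_numeral mult_nonneg_nonneg)
  also have "l2norm lebesgue_pi (\<lambda>u. cis (of_int (int k) * u)) = sqrt (2 * pi)"
    using measure_lebesgue_pi by (simp add: l2norm_def)
  finally have "2 * pi * cmod (coeff Q k) \<le> l2norm lebesgue_pi (\<lambda>u. poly Q (cis u)) * sqrt (2 * pi)" .
  moreover have "sqrt (2 * pi) \<le> 2 * pi"
    using pi_gt3 mult_left_mono[of 1 "2 * pi" "2 * pi"] by (intro real_le_lsqrt) (auto simp: power2_eq_square)
  then have "l2norm lebesgue_pi (\<lambda>u. poly Q (cis u)) * sqrt (2 * pi) \<le> l2norm lebesgue_pi (\<lambda>u. poly Q (cis u)) * (2 * pi)"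
    by (rule mult_left_mono) simp
  ultimately have "2 * pi * cmod (coeff Q k) \<le> l2norm lebesgue_pi (\<lambda>u. poly Q (cis u)) * (2 * pi)"
    by (rule order_trans)
  then show ?thesis by simp
qed

text \<open>If \<open>Q\<close> is small in \<open>L\<^sub>2\<close> of Lebesgue measure, then so are its
  coefficients, and the finitely many of index below \<open>m\<close> can be removed at a uniformly small
  price. This pushes the spectrum to the right.\<close>

lemma drop_low_coefficients:
  assumes "l2norm lebesgue_pi (\<lambda>u. poly Q (cis u)) \<le> d"
  obtains T where "\<And>u. cmod (poly Q (cis u) - tpoly (int m) T u) \<le> real m * d"
proof -
  define R where "R = (\<Sum>i<m. monom (coeff Q i) i)"
  have "coeff R j = coeff Q j" if "j < m" for j
    using that by (simp add: R_def coeff_sum)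
  then have "monom 1 m dvd Q - R" by (simp add: monom_1_dvd_iff')
  then obtain T where T: "Q - R = monom 1 m * T" by (rule dvdE)
  show ?thesis
  proof (rule that[of T])
    fix u
    have "tpoly (int m) T u = poly Q (cis u) - poly R (cis u)"
      using arg_cong[OF T, of "\<lambda>p. poly p (cis u)"]
      by (simp add: tpoly_def poly_monom Complex.DeMoivre)
    then have "cmod (poly Q (cis u) - tpoly (int m) T u) = cmod (\<Sum>i<m. coeff Q i * cis u ^ i)"
      by (simp add: R_def poly_sum poly_monom)
    also have "\<dots> \<le> (\<Sum>i<m. cmod (coeff Q i * cis u ^ i))" by (rule norm_sum)
    also have "\<dots> \<le> (\<Sum>i<m. d)"
      using assms coeff_le_l2norm[of Q] by (intro sum_mono) (auto simp: norm_mult norm_power intro: order_trans)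
    finally show "cmod (poly Q (cis u) - tpoly (int m) T u) \<le> real m * d" by simp
  qed
qed

text \<open>The Lebesgue decomposition without names for its parts: \<open>N\<close> carries the singular
  part, and \<open>f\<close> is the density of the absolutely continuous part.\<close>

locale singular_set =
  fixes \<mu> :: "real measure" and f :: "real \<Rightarrow> real" and N :: "real set"
  assumes fin: "finite_measure \<mu>" and sets_mu: "sets \<mu> = sets lebesgue_pi"
    and N: "N \<in> null_sets lebesgue_pi"
    and f_meas: "f \<in> borel_measurable lebesgue_pi" and f_nonneg: "\<And>u. u \<in> {-pi..<pi} \<Longrightarrow> 0 \<le> f u"
    and f_int: "integrable lebesgue_pi f"
    and off_N: "density \<mu> (indicator (- N)) = density lebesgue_pi (\<lambda>u. ennreal (f u))"
begin

lemma space_mu: "space \<mu> = {-pi..<pi}"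
  using sets_eq_imp_space_eq[OF sets_mu] by simp

lemma N_sets: "N \<in> sets \<mu>" "N \<in> sets lebesgue_pi"
  using N sets_mu by auto

lemma integral_off_N:
  fixes g :: "real \<Rightarrow> real"
  assumes "g \<in> borel_measurable \<mu>"
  shows "(\<integral>u. indicator (- N) u * g u \<partial>\<mu>) = (\<integral>u. f u * g u \<partial>lebesgue_pi)"
proof -
  have g: "g \<in> borel_measurable lebesgue_pi" using assms measurable_cong_sets[OF sets_mu refl] by blast
  have ind: "(indicator (- N) :: real \<Rightarrow> real) \<in> borel_measurable \<mu>"
    using borel_measurable_indicator[OF sets.compl_sets[OF N_sets(1)], where 'b=real]
    by (rule measurable_cong[THEN iffD1, rotated]) (auto simp: indicator_def)
  have "(\<integral>u. indicator (- N) u * g u \<partial>\<mu>) = integral\<^sup>L (density \<mu> (\<lambda>u. ennreal (indicator (- N) u))) g"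
    using assms ind by (subst integral_density) auto
  also have "density \<mu> (\<lambda>u. ennreal (indicator (- N) u)) = density lebesgue_pi (\<lambda>u. ennreal (f u))"
    using off_N by (simp add: ennreal_indicator)
  also have "integral\<^sup>L \<dots> g = (\<integral>u. f u * g u \<partial>lebesgue_pi)"
    using g f_meas f_nonneg by (subst integral_density) auto
  finally show ?thesis .
qed

lemma truncation_error_small:
  assumes "0 < e"
  shows "\<exists>K\<ge>0. (\<integral>u. f u - min (f u) K \<partial>lebesgue_pi) < e"
proof -
  have "(\<lambda>n. \<integral>u. f u - min (f u) (real n) \<partial>lebesgue_pi) \<longlonglongrightarrow> (\<integral>u. 0 \<partial>lebesgue_pi)"
  proof (rule integral_dominated_convergence[where w=f])
    have "(\<lambda>n. f u - min (f u) (real n)) \<longlonglongrightarrow> 0" for u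
    proof -
      obtain n0 where "f u \<le> real n0" using real_arch_simple by blast
      then have "\<forall>\<^sub>F n in sequentially. f u - min (f u) (real n) = 0"
        by (auto simp: eventually_sequentially intro!: exI[of _ n0])
      then show ?thesis by (rule tendsto_eventually)
    qed
    then show "AE u in lebesgue_pi. (\<lambda>n. f u - min (f u) (real n)) \<longlonglongrightarrow> 0" by simp
    show "AE u in lebesgue_pi. norm (f u - min (f u) (real n)) \<le> f u" for n
      using f_nonneg by (auto intro!: AE_I2 simp: min_def)
  qed (use f_meas f_int in auto)
  then have "(\<lambda>n. \<integral>u. f u - min (f u) (real n) \<partial>lebesgue_pi) \<longlonglongrightarrow> 0" by simp
  from tendsto_0_ex_less[OF this assms] show ?thesis by (metis of_nat_0_le_iff)
qed

lemma l2norm_split: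
  assumes X: "X \<in> L2_space \<mu>"
  shows "(l2norm \<mu> X)\<^sup>2 = (\<integral>u. indicator N u * (cmod (X u))\<^sup>2 \<partial>\<mu>) + (\<integral>u. f u * (cmod (X u))\<^sup>2 \<partial>lebesgue_pi)"
proof -
  note i = L2_D(2)[OF X]
  have i1: "integrable \<mu> (\<lambda>u. indicator N u * (cmod (X u))\<^sup>2)"
    using integrable_mult_indicator[OF N_sets(1) i] by simp
  have "(\<integral>u. indicator N u * (cmod (X u))\<^sup>2 \<partial>\<mu>) + (\<integral>u. indicator (- N) u * (cmod (X u))\<^sup>2 \<partial>\<mu>) = (l2norm \<mu> X)\<^sup>2"
  proof -
    have eq: "indicator (- N) u * (cmod (X u))\<^sup>2 = (cmod (X u))\<^sup>2 - indicator N u * (cmod (X u))\<^sup>2" for u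
      by (simp add: indicator_def)
    show ?thesis unfolding eq using i i1 by (simp add: l2norm_sq)
  qed
  also have "(\<integral>u. indicator (- N) u * (cmod (X u))\<^sup>2 \<partial>\<mu>) = (\<integral>u. f u * (cmod (X u))\<^sup>2 \<partial>lebesgue_pi)"
    by (rule integral_off_N) (use L2_D(1)[OF X] in auto)
  finally show ?thesis ..
qed

lemma indicator_N_L2: "indicator N \<in> L2_space \<mu>"
  by (rule L2_bounded[OF fin, where C=1]) (use N_sets in \<open>auto simp: indicator_def\<close>)

text \<open>Let \<open>s\<close> be within \<open>1/n\<close> of \<open>n 1\<^sub>N\<close>, both for
  \<open>\<mu>\<close> and for Lebesgue measure, for which \<open>n 1\<^sub>N\<close> is zero. The exponential
  \<open>exp P\<close> with \<open>Re P = - \<bar>s\<bar>\<^sup>2\<close> is small on \<open>N\<close>. Its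
  modulus is at most one and its mean is close to one, hence it is close to one in \<open>L\<^sub>2\<close> of
  Lebesgue measure.\<close>

lemma exp_peak:
  fixes n :: nat
  assumes n: "0 < n"
  obtains P where "\<And>u. cmod (exp (poly P (cis u))) \<le> 1"
    "(l2norm lebesgue_pi (\<lambda>u. 1 - exp (poly P (cis u))))\<^sup>2 \<le> 2 / (real n)\<^sup>2"
    "(\<integral>u. indicator N u * (cmod (exp (poly P (cis u))))\<^sup>2 \<partial>\<mu>) \<le> (measure \<mu> (space \<mu>) + 2) / (real n)\<^sup>2"
proof -
  interpret mu: finite_measure \<mu> by (rule fin)
  note finL = finite_measure_lebesgue_pi
  obtain K where K: "finite_measure K" "sets K = sets \<mu>" "\<mu> \<le> K" "lebesgue_pi \<le> K"
    using common_finite_bound[OF fin finL] sets_mu by metis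
  let ?g = "\<lambda>u. of_nat n * indicator N u :: complex"
  have g: "?g \<in> L2_space K"
    by (rule L2_bounded[OF K(1), where C="real n"]) (use N_sets K in \<open>auto simp: indicator_def\<close>)
  have setsK: "sets K = sets lebesgue_pi" using K sets_mu by simp
  obtain s where s: "s \<in> trig_polys" and sn: "l2norm K (\<lambda>u. ?g u - s u) < 1 / n"
    using L2_closure_D(2)[OF trig_polys_dense[OF K(1) setsK g], of "1 / n"] n by auto
  have sK: "s \<in> L2_space K" using trig_L2[OF K(1) setsK] s by blast
  have dK: "(\<lambda>u. ?g u - s u) \<in> L2_space K" using g sK by auto
  note s_mu = L2_mono_measure[OF K(2)[symmetric] K(3) dK]
  note s_L = L2_mono_measure[OF setsK[symmetric] K(4) dK]
  have sL: "s \<in> L2_space lebesgue_pi" using trig_L2[OF finL refl] s by blast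
  have "l2norm lebesgue_pi s = l2norm lebesgue_pi (\<lambda>u. ?g u - s u)"
  proof -
    have "AE u in lebesgue_pi. u \<notin> N" using N by (rule AE_not_in)
    then have "AE u in lebesgue_pi. - s u = ?g u - s u" by eventually_elim (simp add: indicator_def)
    then have "l2norm lebesgue_pi (\<lambda>u. - s u) = l2norm lebesgue_pi (\<lambda>u. ?g u - s u)"
      using sL s_L(1) by (intro l2norm_cong_AE) (auto dest: L2_D)
    then show ?thesis by (simp add: l2norm_def)
  qed
  then have sL_small: "l2norm lebesgue_pi s \<le> 1 / n" using s_L(2) sn by simp
  obtain P where P: "\<And>u. Re (poly P (cis u)) = (cmod (s u))\<^sup>2"
    "poly P 0 = of_real ((l2norm lebesgue_pi s)\<^sup>2 / (2 * pi))"
    using trig_norm_sq_analytic[OF s] by blast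
  let ?G = "\<lambda>u. exp (poly (- P) (cis u))"
  have G: "cmod (?G u) = exp (- (cmod (s u))\<^sup>2)" for u by (simp add: P)
  have G1: "cmod (?G u) \<le> 1" for u unfolding G by simp
  have Gm: "sets M = sets lebesgue_pi \<Longrightarrow> ?G \<in> borel_measurable M" for M
    by (erule measurable_lebesgue_pi) (intro borel_measurable_continuous_onI continuous_intros)
  have one: "(\<lambda>u. 1) \<in> L2_space lebesgue_pi" by (rule L2_bounded[OF finL, where C=1]) auto
  have GL: "?G \<in> L2_space lebesgue_pi" by (rule L2_bounded[OF finL Gm[OF refl] G1])
  show ?thesis
  proof (rule that[of "- P"])
    show "cmod (?G u) \<le> 1" for u by (rule G1)
    let ?a = "(l2norm lebesgue_pi s)\<^sup>2 / (2 * pi)"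
    have n1: "(l2norm lebesgue_pi (\<lambda>u. 1))\<^sup>2 = 2 * pi"
      using measure_lebesgue_pi by (simp add: l2norm_sq)
    have "l2norm lebesgue_pi ?G \<le> l2norm lebesgue_pi (\<lambda>u. 1)"
      by (rule L2_dominated(2)[OF one]) (use GL G1 in \<open>auto dest: L2_D\<close>)
    then have nG: "(l2norm lebesgue_pi ?G)\<^sup>2 \<le> 2 * pi"
      unfolding n1[symmetric] by (intro power_mono) auto
    have "exp (- poly P 0) = of_real (exp (- ?a))" unfolding P(2) by (metis exp_of_real of_real_minus)
    then have iG: "(\<integral>u. ?G u \<partial>lebesgue_pi) = of_real (2 * pi * exp (- ?a))"
      using integral_poly_exp_cis[of 1 "- P"] by simp
    have "(l2norm lebesgue_pi (\<lambda>u. 1 - ?G u))\<^sup>2 = 2 * pi - 2 * Re (\<integral>u. ?G u \<partial>lebesgue_pi) + (l2norm lebesgue_pi ?G)\<^sup>2"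
      using l2norm_sq_add[OF L2_uminus[OF GL] one] n1
      by (simp add: l2norm_minus_commute[of lebesgue_pi "\<lambda>u. 1"]) (simp add: l2norm_def)
    also have "Re (\<integral>u. ?G u \<partial>lebesgue_pi) = 2 * pi * exp (- ?a)"
      unfolding iG by simp
    also have "2 * pi - 2 * (2 * pi * exp (- ?a)) + (l2norm lebesgue_pi ?G)\<^sup>2 \<le> 4 * pi * (1 - exp (- ?a))"
      using nG by (simp add: algebra_simps)
    also have "\<dots> \<le> 4 * pi * ?a"
      using exp_ge_add_one_self[of "- ?a"] by (intro mult_left_mono) auto
    also have "\<dots> = 2 * (l2norm lebesgue_pi s)\<^sup>2" by simp
    also have "\<dots> \<le> 2 * (1 / n)\<^sup>2" using sL_small by (intro mult_left_mono power_mono) auto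
    also have "\<dots> = 2 / (real n)\<^sup>2" by (simp add: power_divide)
    finally show "(l2norm lebesgue_pi (\<lambda>u. 1 - ?G u))\<^sup>2 \<le> 2 / (real n)\<^sup>2" .
    (* Either z is large and the exponential is tiny, or z is far from n. *)
    have ineq: "(exp (- (cmod z)\<^sup>2))\<^sup>2 \<le> (1 + 2 * (cmod (of_nat n - z))\<^sup>2) / (real n)\<^sup>2" for z
    proof -
      have "real n \<le> cmod z + cmod (of_nat n - z)"
        using norm_triangle_ineq[of z "of_nat n - z"] by simp
      then have "(real n)\<^sup>2 \<le> (cmod z + cmod (of_nat n - z))\<^sup>2" by (intro power_mono) auto
      also have "\<dots> \<le> 2 * (cmod z)\<^sup>2 + 2 * (cmod (of_nat n - z))\<^sup>2"
        using sum_squares_bound[of "cmod z" "cmod (of_nat n - z)"] by (simp add: power2_sum)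
      also have "\<dots> \<le> (1 + 2 * (cmod z)\<^sup>2) * (1 + 2 * (cmod (of_nat n - z))\<^sup>2)"
        by (simp add: algebra_simps)
      also have "\<dots> \<le> exp (2 * (cmod z)\<^sup>2) * (1 + 2 * (cmod (of_nat n - z))\<^sup>2)"
        using exp_ge_add_one_self[of "2 * (cmod z)\<^sup>2"] by (intro mult_right_mono) auto
      finally have "exp (- (2 * (cmod z)\<^sup>2)) * (real n)\<^sup>2 \<le> 1 + 2 * (cmod (of_nat n - z))\<^sup>2"
        by (simp add: exp_minus field_simps)
      moreover have "(exp (- (cmod z)\<^sup>2))\<^sup>2 = exp (- (2 * (cmod z)\<^sup>2))"
        by (simp add: power2_eq_square flip: exp_add)
      ultimately show ?thesis using n by (simp add: field_simps)
    qed
    have "(\<integral>u. indicator N u * (cmod (?G u))\<^sup>2 \<partial>\<mu>) \<le> (\<integral>u. (1 + 2 * (cmod (?g u - s u))\<^sup>2) / (real n)\<^sup>2 \<partial>\<mu>)"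
    proof (rule integral_mono)
      show "integrable \<mu> (\<lambda>u. indicator N u * (cmod (?G u))\<^sup>2)"
        by (rule mu.integrable_const_bound[where B=1])
           (use G1 N_sets Gm[OF sets_mu] in \<open>auto simp: indicator_def power_le_one
             intro!: borel_measurable_times borel_measurable_power borel_measurable_norm simp del: norm_exp_eq_Re\<close>)
      show "integrable \<mu> (\<lambda>u. (1 + 2 * (cmod (?g u - s u))\<^sup>2) / (real n)\<^sup>2)"
        using L2_D(2)[OF s_mu(1)] by auto
      show "indicator N u * (cmod (?G u))\<^sup>2 \<le> (1 + 2 * (cmod (?g u - s u))\<^sup>2) / (real n)\<^sup>2" for u
        using ineq[of "s u"] unfolding G by (auto simp: indicator_def)
    qed
    also have "\<dots> = (measure \<mu> (space \<mu>) + 2 * (l2norm \<mu> (\<lambda>u. ?g u - s u))\<^sup>2) / (real n)\<^sup>2"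
      using L2_D(2)[OF s_mu(1)] by (simp add: l2norm_sq)
    also have "\<dots> \<le> (measure \<mu> (space \<mu>) + 2) / (real n)\<^sup>2"
    proof (intro divide_right_mono add_left_mono)
      have "1 / real n \<le> 1" using n by simp
      then have "l2norm \<mu> (\<lambda>u. ?g u - s u) \<le> 1" using s_mu(2) sn by linarith
      then show "2 * (l2norm \<mu> (\<lambda>u. ?g u - s u))\<^sup>2 \<le> 2" by (simp add: power_le_one)
    qed simp
    finally show "(\<integral>u. indicator N u * (cmod (?G u))\<^sup>2 \<partial>\<mu>) \<le> (measure \<mu> (space \<mu>) + 2) / (real n)\<^sup>2" .
  qed
qed


text \<open>The function \<open>1 - exp P\<close> of \<open>exp_peak\<close> is near \<open>1\<^sub>N\<close>:
  on \<open>N\<close> directly, off \<open>N\<close> because it is bounded and small for Lebesgue measure,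
  with respect to which \<open>\<mu>\<close> has a density there. Partial sums of the exponential series turn
  it into a polynomial.\<close>

lemma analytic_peak:
  assumes e: "0 < e"
  obtains Q where "l2norm \<mu> (\<lambda>u. indicator N u - poly Q (cis u)) < e"
    "l2norm lebesgue_pi (\<lambda>u. poly Q (cis u)) < e"
proof -
  note finL = finite_measure_lebesgue_pi
  have e2: "0 < e\<^sup>2 / 36" using e by simp
  (* Off N the density is at most K up to a part of small integral, where the bound 2 is used. *)
  obtain K where K: "0 \<le> K" "(\<integral>u. f u - min (f u) K \<partial>lebesgue_pi) < e\<^sup>2 / 36"
    using truncation_error_small[OF e2] by blast
  (* ?C collects the error terms of order 1 / n^2. With the factor 36 the squared error stays below (e / 2)^2. *)
  let ?C = "measure \<mu> (space \<mu>) + 2 + 2 * K + 2"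
  have C: "0 < ?C" using K(1) measure_nonneg[of \<mu> "space \<mu>"] by linarith
  obtain n0 :: nat where n0: "36 * ?C / e\<^sup>2 < real n0" using reals_Archimedean2 by blast
  define n where "n = Suc n0"
  have n: "0 < n" "?C / (real n)\<^sup>2 \<le> e\<^sup>2 / 36"
  proof -
    have "36 * ?C / e\<^sup>2 < real n" using n0 by (simp add: n_def)
    also have "real n \<le> (real n)\<^sup>2" by (simp add: n_def power2_eq_square)
    finally show "?C / (real n)\<^sup>2 \<le> e\<^sup>2 / 36" using e by (simp add: n_def field_simps)
  qed (simp add: n_def)
  obtain P where P1: "\<And>u. cmod (exp (poly P (cis u))) \<le> 1"
    and P2: "(l2norm lebesgue_pi (\<lambda>u. 1 - exp (poly P (cis u))))\<^sup>2 \<le> 2 / (real n)\<^sup>2"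
    and P3: "(\<integral>u. indicator N u * (cmod (exp (poly P (cis u))))\<^sup>2 \<partial>\<mu>) \<le> (measure \<mu> (space \<mu>) + 2) / (real n)\<^sup>2"
    using exp_peak[OF n(1)] by blast
  let ?F = "\<lambda>u. 1 - exp (poly P (cis u))"
  have Fm: "sets M = sets lebesgue_pi \<Longrightarrow> ?F \<in> borel_measurable M" for M
    by (erule measurable_lebesgue_pi) (intro borel_measurable_continuous_onI continuous_intros)
  have F2: "cmod (?F u) \<le> 2" for u
    using norm_triangle_ineq4[of 1 "exp (poly P (cis u))"] P1[of u] by (simp del: norm_exp_eq_Re)
  have FL: "sets M = sets lebesgue_pi \<Longrightarrow> finite_measure M \<Longrightarrow> ?F \<in> L2_space M" for M
    using L2_bounded[OF _ Fm F2] by blast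
  have dL: "(\<lambda>u. indicator N u - ?F u) \<in> L2_space \<mu>"
    by (intro L2_diff indicator_N_L2 FL sets_mu fin)
  have "(\<integral>u. f u * (cmod (indicator N u - ?F u))\<^sup>2 \<partial>lebesgue_pi) = (\<integral>u. f u * (cmod (?F u))\<^sup>2 \<partial>lebesgue_pi)"
  proof (rule integral_cong_AE)
    have "AE u in lebesgue_pi. u \<notin> N" using N by (rule AE_not_in)
    then show "AE u in lebesgue_pi. f u * (cmod (indicator N u - ?F u))\<^sup>2 = f u * (cmod (?F u))\<^sup>2"
      by eventually_elim (simp add: indicator_def norm_minus_commute)
    show "(\<lambda>u. f u * (cmod (indicator N u - ?F u))\<^sup>2) \<in> borel_measurable lebesgue_pi"
      using f_meas N_sets Fm[OF refl] by (intro borel_measurable_times borel_measurable_power borel_measurable_norm borel_measurable_diff) auto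
    show "(\<lambda>u. f u * (cmod (?F u))\<^sup>2) \<in> borel_measurable lebesgue_pi"
      using f_meas Fm[OF refl] by (intro borel_measurable_times borel_measurable_power borel_measurable_norm) auto
  qed
  also have "\<dots> \<le> (\<integral>u. K * (cmod (?F u))\<^sup>2 + 4 * (f u - min (f u) K) \<partial>lebesgue_pi)"
  proof (rule integral_mono)
    have imin: "integrable lebesgue_pi (\<lambda>u. min (f u) K)"
      by (rule Bochner_Integration.integrable_bound[OF f_int])
         (use f_meas f_nonneg K(1) in \<open>auto simp: min_def\<close>)
    show "integrable lebesgue_pi (\<lambda>u. K * (cmod (?F u))\<^sup>2 + 4 * (f u - min (f u) K))"
      using L2_D(2)[OF FL[OF refl finL]] f_int imin by auto
    show le: "f u * (cmod (?F u))\<^sup>2 \<le> K * (cmod (?F u))\<^sup>2 + 4 * (f u - min (f u) K)" for u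
    proof -
      have "(cmod (?F u))\<^sup>2 \<le> 2\<^sup>2" using F2 by (intro power_mono) auto
      then have "(f u - min (f u) K) * (cmod (?F u))\<^sup>2 \<le> (f u - min (f u) K) * 4"
        by (intro mult_left_mono) auto
      moreover have "min (f u) K * (cmod (?F u))\<^sup>2 \<le> K * (cmod (?F u))\<^sup>2" by (intro mult_right_mono) auto
      ultimately show ?thesis by (simp add: algebra_simps)
    qed
    show "integrable lebesgue_pi (\<lambda>u. f u * (cmod (?F u))\<^sup>2)"
    proof (rule Bochner_Integration.integrable_bound)
      show "integrable lebesgue_pi (\<lambda>u. 4 * f u)" using f_int by auto
      have "(cmod (?F u))\<^sup>2 \<le> 2\<^sup>2" for u using F2 by (intro power_mono) auto
      then have "f u * (cmod (?F u))\<^sup>2 \<le> f u * 4" if "u \<in> {-pi..<pi}" for u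
        using f_nonneg[OF that] by (intro mult_left_mono) auto
      then show "AE u in lebesgue_pi. norm (f u * (cmod (?F u))\<^sup>2) \<le> norm (4 * f u)"
        using f_nonneg by (auto intro!: AE_I2 simp: abs_mult mult.commute)
      show "(\<lambda>u. f u * (cmod (?F u))\<^sup>2) \<in> borel_measurable lebesgue_pi"
        using f_meas Fm[OF refl] by (intro borel_measurable_times borel_measurable_power borel_measurable_norm) auto
    qed
  qed
  also have "\<dots> = K * (l2norm lebesgue_pi ?F)\<^sup>2 + 4 * (\<integral>u. f u - min (f u) K \<partial>lebesgue_pi)"
  proof -
    have imin: "integrable lebesgue_pi (\<lambda>u. f u - min (f u) K)"
      by (rule Bochner_Integration.integrable_bound[OF f_int])
         (use f_meas f_nonneg K(1) in \<open>auto simp: min_def\<close>)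
    show ?thesis
      using L2_D(2)[OF FL[OF refl finL]] imin
      by (subst Bochner_Integration.integral_add) (auto simp only: l2norm_sq integral_mult_right_zero integrable_mult_right)
  qed
  also have "\<dots> \<le> K * (2 / (real n)\<^sup>2) + 4 * (e\<^sup>2 / 36)"
    using K P2 by (intro add_mono mult_left_mono) auto
  finally have off: "(\<integral>u. f u * (cmod (indicator N u - ?F u))\<^sup>2 \<partial>lebesgue_pi) \<le> 2 * K / (real n)\<^sup>2 + e\<^sup>2 / 9"
    by simp
  have "(\<integral>u. indicator N u * (cmod (indicator N u - ?F u))\<^sup>2 \<partial>\<mu>) = (\<integral>u. indicator N u * (cmod (exp (poly P (cis u))))\<^sup>2 \<partial>\<mu>)"
    by (intro Bochner_Integration.integral_cong) (auto simp: indicator_def)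
  then have "(l2norm \<mu> (\<lambda>u. indicator N u - ?F u))\<^sup>2
      \<le> (measure \<mu> (space \<mu>) + 2) / (real n)\<^sup>2 + (2 * K / (real n)\<^sup>2 + e\<^sup>2 / 9)"
    unfolding l2norm_split[OF dL] using P3 off by (simp del: norm_exp_eq_Re)
  also have "\<dots> \<le> ?C / (real n)\<^sup>2 + e\<^sup>2 / 9" by (simp add: add_divide_distrib divide_right_mono)
  also have "\<dots> \<le> e\<^sup>2 / 36 + e\<^sup>2 / 9" by (rule add_right_mono[OF n(2)])
  also have "\<dots> \<le> (e / 2)\<^sup>2" by (simp add: power_divide)
  finally have F_mu: "l2norm \<mu> (\<lambda>u. indicator N u - ?F u) \<le> e / 2"
    by (rule power2_le_imp_le) (use e in simp)
  have "(l2norm lebesgue_pi ?F)\<^sup>2 \<le> ?C / (real n)\<^sup>2"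
  proof (rule order_trans[OF P2], rule divide_right_mono)
    show "2 \<le> ?C" using K(1) measure_nonneg[of \<mu> "space \<mu>"] by linarith
  qed simp
  also note n(2)
  also have "e\<^sup>2 / 36 \<le> (e / 2)\<^sup>2" by (simp add: power_divide)
  finally have F_L: "l2norm lebesgue_pi ?F \<le> e / 2"
    by (rule power2_le_imp_le) (use e in simp)
  obtain H where H: "finite_measure H" "sets H = sets \<mu>" "\<mu> \<le> H" "lebesgue_pi \<le> H"
    using common_finite_bound[OF fin finL] sets_mu by metis
  have setsH: "sets H = sets lebesgue_pi" using H sets_mu by simp
  obtain j where j: "l2norm H (\<lambda>u. poly (exp_poly P j) (cis u) - exp (poly P (cis u))) < e / 2"
    using tendsto_0_ex_less[OF exp_poly_l2norm_tendsto[OF H(1) setsH]] e by (metis half_gt_zero)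
  let ?Q = "1 - exp_poly P j"
  have QL: "sets M = sets lebesgue_pi \<Longrightarrow> finite_measure M \<Longrightarrow> (\<lambda>u. poly ?Q (cis u)) \<in> L2_space M" for M
    unfolding poly_cis_tpoly by (rule tpoly_L2)
  have QF: "(\<lambda>u. ?F u - poly ?Q (cis u)) = (\<lambda>u. poly (exp_poly P j) (cis u) - exp (poly P (cis u)))"
    by (auto simp: algebra_simps)
  have QH: "(\<lambda>u. ?F u - poly ?Q (cis u)) \<in> L2_space H" by (intro L2_diff FL QL setsH H)
  have 1: "l2norm \<mu> (\<lambda>u. ?F u - poly ?Q (cis u)) < e / 2"
    using L2_mono_measure(2)[OF H(2)[symmetric] H(3) QH] j unfolding QF by simp
  have 2: "l2norm lebesgue_pi (\<lambda>u. ?F u - poly ?Q (cis u)) < e / 2"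
    using L2_mono_measure(2)[OF setsH[symmetric] H(4) QH] j unfolding QF by simp
  show ?thesis
  proof (rule that)
    show "l2norm \<mu> (\<lambda>u. indicator N u - poly ?Q (cis u)) < e"
      using l2norm_triangle_diff[OF indicator_N_L2 FL[OF sets_mu fin] QL[OF sets_mu fin]] 1 F_mu by linarith
    show "l2norm lebesgue_pi (\<lambda>u. poly ?Q (cis u)) < e"
      using l2norm_le_diff[OF QL[OF refl finL] FL[OF refl finL]] 2 F_L
        l2norm_minus_commute[of lebesgue_pi ?F "\<lambda>u. poly ?Q (cis u)"] by linarith
  qed
qed

lemma indicator_in_future:
  assumes e: "0 < e"
  shows "\<exists>T. l2norm \<mu> (\<lambda>u. indicator N u - tpoly (int m) T u) < e"
proof -
  interpret mu: finite_measure \<mu> by (rule fin)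
  let ?c = "1 + real m * l2norm \<mu> (\<lambda>u. 1)"
  have c: "0 < ?c" by (simp add: add_pos_nonneg)
  obtain Q where Q: "l2norm \<mu> (\<lambda>u. indicator N u - poly Q (cis u)) < e / ?c"
    "l2norm lebesgue_pi (\<lambda>u. poly Q (cis u)) < e / ?c"
    using analytic_peak[of "e / ?c"] e c by auto
  obtain T where T: "\<And>u. cmod (poly Q (cis u) - tpoly (int m) T u) \<le> real m * (e / ?c)"
    using drop_low_coefficients[OF less_imp_le[OF Q(2)]] by blast
  have one: "(\<lambda>u. 1) \<in> L2_space \<mu>" by (rule L2_bounded[OF fin]) auto
  have QL: "(\<lambda>u. poly Q (cis u)) \<in> L2_space \<mu>" unfolding poly_cis_tpoly by (rule tpoly_L2[OF fin sets_mu])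
  have TL: "tpoly (int m) T \<in> L2_space \<mu>" by (rule tpoly_L2[OF fin sets_mu])
  have "l2norm \<mu> (\<lambda>u. poly Q (cis u) - tpoly (int m) T u) \<le> l2norm \<mu> (\<lambda>u. of_real (real m * (e / ?c)) * 1)"
  proof (rule L2_dominated(2)[OF L2_scale[OF one]])
    show "(\<lambda>u. poly Q (cis u) - tpoly (int m) T u) \<in> borel_measurable \<mu>"
      using L2_D(1)[OF L2_diff[OF QL TL]] .
    have "0 \<le> real m * (e / ?c)" using e c by simp
    then show "AE u in \<mu>. cmod (poly Q (cis u) - tpoly (int m) T u) \<le> cmod (of_real (real m * (e / ?c)) * 1)"
      using T by (simp only: norm_mult norm_of_real norm_one mult_1_right abs_of_nonneg) simp
  qed
  also have "\<dots> = real m * (e / ?c) * l2norm \<mu> (\<lambda>u. 1)"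
    using e c unfolding l2norm_scale by (simp only: norm_of_real abs_of_nonneg[of "real m * (e / ?c)"]) auto
  finally have "l2norm \<mu> (\<lambda>u. indicator N u - tpoly (int m) T u) < e / ?c + real m * (e / ?c) * l2norm \<mu> (\<lambda>u. 1)"
    using l2norm_triangle_diff[OF indicator_N_L2 QL TL] Q(1) by linarith
  also have "\<dots> = e"
  proof -
    have "e / ?c + real m * (e / ?c) * l2norm \<mu> (\<lambda>u. 1) = ?c * (e / ?c)" by (simp only: distrib_right) simp
    then show ?thesis using c by simp
  qed
  finally show ?thesis by blast
qed

text \<open>The functions supported on \<open>N\<close> are deterministic: they belong to the closed span of
  the frequencies at least \<open>k\<close> for every \<open>k\<close>. Approximate \<open>g\<close> by a
  trigonometric polynomial \<open>p\<close> and \<open>1\<^sub>N\<close> by one whose frequencies are so high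
  that those of the product with \<open>p\<close> are still at least \<open>k\<close>.\<close>

theorem singular_part_in_future:
  assumes g: "g \<in> L2_space \<mu>"
  shows "(\<lambda>u. indicator N u * g u) \<in> L2_closure \<mu> (range (tpoly k))"
proof -
  have ind: "\<And>u. cmod (indicator N u) \<le> 1" by (simp add: indicator_def)
  have indm: "(indicator N :: _ \<Rightarrow> complex) \<in> borel_measurable \<mu>" using N_sets by auto
  have Ng: "(\<lambda>u. indicator N u * g u) \<in> L2_space \<mu>" by (rule L2_mult_bounded(1)[OF g indm ind]) auto
  moreover have "\<exists>Z\<in>range (tpoly k). l2norm \<mu> (\<lambda>u. indicator N u * g u - Z u) < e" if e: "0 < e" for e
  proof -
    obtain p where p: "p \<in> trig_polys" "l2norm \<mu> (\<lambda>u. g u - p u) < e / 2"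
      using L2_closure_D(2)[OF trig_polys_dense[OF fin sets_mu g], of "e / 2"] e by auto
    obtain j S where p': "p = tpoly j S" using p(1) by (rule trig_polysE)
    obtain C where C: "0 \<le> C" "\<And>u. cmod (p u) \<le> C" using tpoly_bounded[of j S] unfolding p' by blast
    define m where "m = nat (k - j)"
    have "0 < e / (2 * (C + 1))" using e C by simp
    from indicator_in_future[OF this] obtain T where
      T: "l2norm \<mu> (\<lambda>u. indicator N u - tpoly (int m) T u) < e / (2 * (C + 1))" by blast
    have pL: "p \<in> L2_space \<mu>" unfolding p' by (rule tpoly_L2[OF fin sets_mu])
    have TL: "tpoly (int m) T \<in> L2_space \<mu>" by (rule tpoly_L2[OF fin sets_mu])
    note d1 = L2_mult_bounded[OF L2_diff[OF g pL] indm ind zero_le_one]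
    note d2 = L2_mult_bounded[OF L2_diff[OF indicator_N_L2 TL] L2_D(1)[OF pL] C(2) C(1)]
    have "C * l2norm \<mu> (\<lambda>u. indicator N u - tpoly (int m) T u) \<le> C * (e / (2 * (C + 1)))"
      using T C by (intro mult_left_mono) auto
    also have "\<dots> \<le> (C + 1) * (e / (2 * (C + 1)))" using C e by (intro mult_right_mono) auto
    also have "\<dots> = e / 2" using C(1) by (simp add: field_simps)
    finally have "C * l2norm \<mu> (\<lambda>u. indicator N u - tpoly (int m) T u) \<le> e / 2" .
    then have "l2norm \<mu> (\<lambda>u. indicator N u * (g u - p u) + p u * (indicator N u - tpoly (int m) T u)) < e"
      using l2norm_triangle[OF d1(1) d2(1)] d1(2) d2(2) p(2) by linarith
    moreover have "indicator N u * (g u - p u) + p u * (indicator N u - tpoly (int m) T u)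
       = indicator N u * g u - tpoly (j + int m) (S * T) u" for u
      unfolding p' by (simp add: tpoly_mult[symmetric] algebra_simps)
    ultimately have "l2norm \<mu> (\<lambda>u. indicator N u * g u - tpoly (j + int m) (S * T) u) < e" by simp
    moreover obtain R where "tpoly (j + int m) (S * T) = tpoly k R"
      using tpoly_lower'[of k "j + int m" "S * T"] by (elim meta_impE exE) (auto simp: m_def)
    ultimately show ?thesis by auto
  qed
  ultimately show ?thesis by (simp add: L2_closure_def)
qed

end

section \<open>The absolutely continuous part of the spectrum\<close>

text \<open>The parallelogram law makes minimizing sequences Cauchy. The approximating sequence is part of the
  conclusion, because the minimizer lies only in the closure of \<open>S\<close>.\<close>

lemma L2_minimizer:
  assumes fin: "finite_measure M" and S: "S \<subseteq> L2_space M" "S \<noteq> {}"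
    and mid: "\<And>X Y. X \<in> S \<Longrightarrow> Y \<in> S \<Longrightarrow> (\<lambda>u. (X u + Y u) / 2) \<in> S"
  obtains X \<psi> where "\<And>n. X n \<in> S" "\<psi> \<in> L2_space M" "(\<lambda>n. l2norm M (\<lambda>u. X n u - \<psi> u)) \<longlonglongrightarrow> 0"
    "\<And>Y. Y \<in> S \<Longrightarrow> l2norm M \<psi> \<le> l2norm M Y"
proof -
  define D where "D = (INF Y\<in>S. (l2norm M Y)\<^sup>2)"
  have bdd: "bdd_below ((\<lambda>Y. (l2norm M Y)\<^sup>2) ` S)" by (rule bdd_belowI2[of _ 0]) simp
  have D: "D \<le> (l2norm M Y)\<^sup>2" if "Y \<in> S" for Y
    unfolding D_def by (rule cINF_lower[OF bdd that])
  have "\<exists>Y\<in>S. (l2norm M Y)\<^sup>2 < D + 1 / real (Suc n)" for n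
    using cINF_less_iff[OF S(2) bdd, of "D + 1 / real (Suc n)"] unfolding D_def[symmetric] by simp
  then obtain X where X: "\<And>n. X n \<in> S" "\<And>n. (l2norm M (X n))\<^sup>2 < D + 1 / real (Suc n)" by metis
  have XL: "X n \<in> L2_space M" for n using X(1) S(1) by blast
  have par: "(l2norm M (\<lambda>u. X i u - X j u))\<^sup>2 \<le> 4 / real (Suc N)" if "i \<ge> N" "j \<ge> N" for i j N
  proof -
    have "(l2norm M (\<lambda>u. X i u + - X j u))\<^sup>2 + (l2norm M (\<lambda>u. X i u + X j u))\<^sup>2
        = 2 * (l2norm M (X i))\<^sup>2 + 2 * (l2norm M (X j))\<^sup>2"
      unfolding l2norm_sq_add[OF XL L2_uminus[OF XL]] l2norm_sq_add[OF XL XL]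
      by (simp add: l2norm_def)
    moreover have "(l2norm M (\<lambda>u. X i u + X j u))\<^sup>2 \<ge> 4 * D"
    proof -
      have "l2norm M (\<lambda>u. (X i u + X j u) / 2) = l2norm M (\<lambda>u. X i u + X j u) / 2"
        using l2norm_scale[of M "1/2" "\<lambda>u. X i u + X j u"] by simp
      then show ?thesis using D[OF mid[OF X(1) X(1), of i j]] by (simp only: power_divide) simp
    qed
    moreover have "1 / real (Suc i) \<le> 1 / real (Suc N)" "1 / real (Suc j) \<le> 1 / real (Suc N)"
      using that by (auto intro!: divide_left_mono)
    ultimately show ?thesis using X(2)[of i] X(2)[of j] by simp
  qed
  have "\<exists>N. \<forall>i\<ge>N. \<forall>j\<ge>N. l2norm M (\<lambda>u. X i u - X j u) < e" if "0 < e" for e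
  proof -
    obtain N where N: "4 / e\<^sup>2 < real N" using reals_Archimedean2 by blast
    have "l2norm M (\<lambda>u. X i u - X j u) < e" if "i \<ge> N" "j \<ge> N" for i j
    proof (rule power_less_imp_less_base)
      have e2: "0 < e\<^sup>2" using \<open>0 < e\<close> by simp
      then have "4 < real N * e\<^sup>2" using N by (simp add: field_simps)
      also have "\<dots> \<le> real (Suc N) * e\<^sup>2" using e2 by (intro mult_right_mono) auto
      finally have "4 / real (Suc N) < e\<^sup>2" by (simp add: divide_less_eq mult.commute)
      then show "(l2norm M (\<lambda>u. X i u - X j u))\<^sup>2 < e\<^sup>2" using par[OF that] by linarith
    qed (use \<open>0 < e\<close> in simp)
    then show ?thesis by blast
  qed
  from L2_complete[OF fin XL this] obtain \<psi> where psi: "\<psi> \<in> L2_space M"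
    "(\<lambda>n. l2norm M (\<lambda>u. X n u - \<psi> u)) \<longlonglongrightarrow> 0" by blast
  have "(l2norm M \<psi>)\<^sup>2 \<le> D"
  proof (rule LIMSEQ_le)
    show "(\<lambda>n. (l2norm M (X n))\<^sup>2) \<longlonglongrightarrow> (l2norm M \<psi>)\<^sup>2" by (intro tendsto_intros l2norm_tendsto XL psi)
    show "(\<lambda>n. D + 1 / real (Suc n)) \<longlonglongrightarrow> D" using tendsto_add[OF tendsto_const LIMSEQ_inverse_real_of_nat, of D] by (simp add: inverse_eq_divide)
    show "\<exists>N. \<forall>n\<ge>N. (l2norm M (X n))\<^sup>2 \<le> D + 1 / real (Suc n)" using X(2) by (auto intro: less_imp_le)
  qed
  then have "l2norm M \<psi> \<le> l2norm M Y" if "Y \<in> S" for Y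
    using order_trans[OF _ D[OF that]] by (intro power2_le_imp_le[of "l2norm M \<psi>"]) auto
  with X(1) psi show ?thesis by (rule that)
qed

text \<open>The first variation vanishes: for \<open>c = - t \<langle>X, Y\<rangle>\<close> with small
  \<open>t > 0\<close> the norm would otherwise decrease.\<close>

lemma minimal_norm_orthogonal:
  assumes X: "X \<in> L2_space M" and Y: "Y \<in> L2_space M"
    and min: "\<And>c. l2norm M X \<le> l2norm M (\<lambda>u. X u + c * Y u)"
  shows "(\<integral>u. X u * cnj (Y u) \<partial>M) = 0"
proof -
  define a where "a = (\<integral>u. X u * cnj (Y u) \<partial>M)"
  define t where "t = 1 / ((l2norm M Y)\<^sup>2 + 1)"
  have "0 < (l2norm M Y)\<^sup>2 + 1" by (simp add: add_nonneg_pos)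
  then have t: "0 < t" "t * (l2norm M Y)\<^sup>2 < 1" by (simp_all add: t_def)
  let ?c = "- of_real t * a"
  have inner: "(\<integral>u. X u * cnj (?c * Y u) \<partial>M) = - of_real t * (cnj a * a)"
  proof -
    have eq: "X u * cnj (?c * Y u) = (- of_real t * cnj a) * (X u * cnj (Y u))" for u by simp
    show ?thesis unfolding eq by (simp add: a_def)
  qed
  have "(l2norm M X)\<^sup>2 \<le> (l2norm M (\<lambda>u. X u + ?c * Y u))\<^sup>2"
    by (rule power_mono[OF min]) simp
  also have "\<dots> = (l2norm M X)\<^sup>2 + 2 * Re (- of_real t * (cnj a * a)) + (t * cmod a * l2norm M Y)\<^sup>2"
    unfolding l2norm_sq_add[OF X L2_scale[OF Y]] inner l2norm_scale using t by (simp add: norm_mult)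
  also have "Re (- of_real t * (cnj a * a)) = - t * (cmod a)\<^sup>2"
    unfolding cmod_power2 by (simp add: power2_eq_square algebra_simps)
  finally have "2 * t * (cmod a)\<^sup>2 \<le> t * (cmod a)\<^sup>2 * (t * (l2norm M Y)\<^sup>2)"
    by (simp add: power_mult_distrib power2_eq_square mult_ac)
  also have "\<dots> \<le> t * (cmod a)\<^sup>2 * 1" using t by (intro mult_left_mono) auto
  finally have "t * (cmod a)\<^sup>2 \<le> 0" by simp
  then show ?thesis using t by (simp add: a_def[symmetric] mult_le_0_iff)
qed

lemma cnj_cis_int: "cnj (cis (of_int k * u)) = cis (of_int (- k) * u)"
  by (simp add: cis_cnj)

text \<open>The Szego condition. It forces \<open>f > 0\<close> almost everywhere, because \<open>abs_ln 0 =
  \<infinity>\<close>.\<close>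

locale log_integrable_density =
  fixes f :: "real \<Rightarrow> real"
  assumes f_meas: "f \<in> borel_measurable lebesgue_pi" and f_nonneg: "\<And>u. u \<in> {-pi..<pi} \<Longrightarrow> 0 \<le> f u"
    and f_int: "integrable lebesgue_pi f"
    and f_log: "(\<integral>\<^sup>+u. abs_ln (f u) \<partial>lebesgue_pi) < \<infinity>"
begin

definition "\<nu> = density lebesgue_pi (\<lambda>u. ennreal (f u))"

lemma sets_nu: "sets \<nu> = sets lebesgue_pi" by (simp add: \<nu>_def)

lemma meas_nu: "g \<in> borel_measurable \<nu> \<longleftrightarrow> g \<in> borel_measurable lebesgue_pi"
  using measurable_cong_sets[OF sets_nu refl] by blast

lemma integral_nu:
  fixes g :: "real \<Rightarrow> 'b :: {banach, second_countable_topology}"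
  assumes "g \<in> borel_measurable lebesgue_pi"
  shows "(\<integral>u. g u \<partial>\<nu>) = (\<integral>u. f u *\<^sub>R g u \<partial>lebesgue_pi)"
  unfolding \<nu>_def using assms f_meas f_nonneg by (subst integral_density) auto

lemma integrable_nu:
  fixes g :: "real \<Rightarrow> 'b :: {banach, second_countable_topology}"
  assumes "g \<in> borel_measurable lebesgue_pi"
  shows "integrable \<nu> g \<longleftrightarrow> integrable lebesgue_pi (\<lambda>u. f u *\<^sub>R g u)"
  unfolding \<nu>_def using assms f_meas f_nonneg by (subst integrable_density) auto

lemma finite_nu: "finite_measure \<nu>"
proof (rule finite_measureI)
  have "emeasure \<nu> (space \<nu>) = (\<integral>\<^sup>+u. ennreal (f u) * indicator (space lebesgue_pi) u \<partial>lebesgue_pi)"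
    unfolding \<nu>_def space_density by (rule emeasure_density) (use f_meas in auto)
  also have "\<dots> = (\<integral>\<^sup>+u. ennreal (norm (f u)) \<partial>lebesgue_pi)"
    by (intro nn_integral_cong) (simp add: f_nonneg)
  also have "\<dots> < \<infinity>" using f_int by (simp add: integrable_iff_bounded)
  finally show "emeasure \<nu> (space \<nu>) \<noteq> \<infinity>" by simp
qed

lemma f_pos: "AE u in lebesgue_pi. 0 < f u"
proof -
  have [measurable]: "(\<lambda>u. abs_ln (f u)) \<in> borel_measurable lebesgue_pi"
    unfolding abs_ln_def using f_meas by measurable
  have "AE u in lebesgue_pi. abs_ln (f u) \<noteq> \<infinity>"
    by (rule nn_integral_PInf_AE) (use f_log in auto)
  moreover have "AE u in lebesgue_pi. 0 \<le> f u" using f_nonneg by (auto intro!: AE_I2)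
  ultimately show ?thesis by eventually_elim (auto simp: abs_ln_def split: if_splits)
qed

text \<open>Put \<open>w = - ln (min f 1)\<close> and approximate \<open>sqrt w\<close> by trigonometric
  polynomials \<open>s\<close>. If \<open>Re P = \<bar>s\<bar>\<^sup>2\<close>, then \<open>\<integral>
  \<bar>Q\<bar>\<^sup>2 exp (- \<bar>s\<bar>\<^sup>2) du = \<integral> \<bar>Q exp (- P / 2)\<bar>\<^sup>2
  du\<close>, which Cauchy-Schwarz bounds below in terms of the mean of \<open>Q exp (- P / 2)\<close>; that
  mean is \<open>exp (- P(0) / 2)\<close>. The exponent \<open>P(0)\<close> stays bounded as \<open>s\<close>
  tends to \<open>sqrt w\<close>, because \<open>w\<close> is integrable.\<close>

lemma Szego_lower_bound:
  obtains c where "0 < c" "\<And>Q. poly Q 0 = 1 \<Longrightarrow> c \<le> (l2norm \<nu> (\<lambda>u. poly Q (cis u)))\<^sup>2"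
proof -
  note finL = finite_measure_lebesgue_pi
  note [measurable] = f_meas
  define w where "w u = - ln (min (f u) 1)" for u
  have wm [measurable]: "w \<in> borel_measurable lebesgue_pi" unfolding w_def by measurable
  have w0: "0 \<le> w u" if "u \<in> {-pi..<pi}" for u
    using f_nonneg[OF that] by (cases "f u = 0") (auto simp: w_def min_def)
  have w_int: "integrable lebesgue_pi w"
  proof (rule integrableI_bounded)
    have "ennreal (norm (w u)) \<le> abs_ln (f u)" if "u \<in> space lebesgue_pi" for u
      using f_nonneg[of u] that by (auto simp: w_def abs_ln_def min_def intro!: ennreal_leI)
    then have "(\<integral>\<^sup>+u. ennreal (norm (w u)) \<partial>lebesgue_pi) \<le> (\<integral>\<^sup>+u. abs_ln (f u) \<partial>lebesgue_pi)"
      by (intro nn_integral_mono)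
    then show "(\<integral>\<^sup>+u. ennreal (norm (w u)) \<partial>lebesgue_pi) < \<infinity>" using f_log by (rule le_less_trans)
  qed simp
  (* Truncation of f at 1 makes w nonnegative, so that its square root is available. *)
  have exp_w: "AE u in lebesgue_pi. exp (- w u) \<le> f u"
    using f_pos by eventually_elim (auto simp: w_def min_def)
  define X where "X u = complex_of_real (sqrt (w u))" for u
  have Xm [measurable]: "X \<in> borel_measurable lebesgue_pi" unfolding X_def by measurable
  have Xsq: "(cmod (X u))\<^sup>2 = w u" if "u \<in> {-pi..<pi}" for u
    using w0[OF that] by (simp add: X_def)
  have "integrable lebesgue_pi (\<lambda>u. (cmod (X u))\<^sup>2) \<longleftrightarrow> integrable lebesgue_pi w"
    by (rule Bochner_Integration.integrable_cong) (auto simp: Xsq)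
  then have X: "X \<in> L2_space lebesgue_pi" using w_int by (simp add: L2_space_def)
  have "\<exists>s\<in>trig_polys. l2norm lebesgue_pi (\<lambda>u. X u - s u) < 1 / real (Suc n)" for n
    by (rule L2_closure_D(2)[OF trig_polys_dense[OF finL refl X]]) simp
  then obtain s where s: "\<And>n. s n \<in> trig_polys" "\<And>n. l2norm lebesgue_pi (\<lambda>u. X u - s n u) < 1 / real (Suc n)"
    by metis
  have sL: "s n \<in> L2_space lebesgue_pi" for n using trig_L2[OF finL refl] s(1) by blast
  have dlim: "(\<lambda>n. l2norm lebesgue_pi (\<lambda>u. X u - s n u)) \<longlonglongrightarrow> 0"
  proof (rule tendsto_sandwich[OF _ _ tendsto_const])
    show "(\<lambda>n. 1 / real (Suc n)) \<longlonglongrightarrow> 0" using LIMSEQ_inverse_real_of_nat by (simp add: inverse_eq_divide)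
  qed (use s(2) in \<open>auto intro!: always_eventually less_imp_le\<close>)
  have slim: "(\<lambda>n. l2norm lebesgue_pi (s n)) \<longlonglongrightarrow> l2norm lebesgue_pi X"
    by (rule l2norm_tendsto[OF sL X]) (use dlim in \<open>simp add: l2norm_minus_commute[of _ X]\<close>)
  define c where "c = 2 * pi * exp (- ((l2norm lebesgue_pi X)\<^sup>2 / (2 * pi)))"
  have "c \<le> (l2norm \<nu> (\<lambda>u. poly Q (cis u)))\<^sup>2" if Q: "poly Q 0 = 1" for Q
  proof -
    obtain R where R: "0 \<le> R" "\<And>u. cmod (tpoly 0 Q u) \<le> R" using tpoly_bounded by blast
    then have R: "0 \<le> R" "\<And>u. cmod (poly Q (cis u)) \<le> R" by (auto simp: poly_cis_tpoly)
    have R2: "(cmod (poly Q (cis u)))\<^sup>2 \<le> R\<^sup>2" for u using R by (intro power_mono) auto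
    have Qm: "(\<lambda>u. poly Q (cis u)) \<in> borel_measurable lebesgue_pi"
      unfolding poly_cis_tpoly by (rule tpoly_measurable[OF refl])
    have Qnu: "(\<lambda>u. poly Q (cis u)) \<in> L2_space \<nu>"
      unfolding poly_cis_tpoly by (rule tpoly_L2[OF finite_nu sets_nu])
    have fQ: "integrable lebesgue_pi (\<lambda>u. f u * (cmod (poly Q (cis u)))\<^sup>2)"
      using L2_D(2)[OF Qnu] Qm by (subst (asm) integrable_nu) auto
    have lower: "2 * pi * exp (- ((l2norm lebesgue_pi (s n))\<^sup>2 / (2 * pi)))
        - R\<^sup>2 * (l2norm lebesgue_pi (\<lambda>u. X u - s n u) * (l2norm lebesgue_pi X + l2norm lebesgue_pi (s n)))
        \<le> (l2norm \<nu> (\<lambda>u. poly Q (cis u)))\<^sup>2" for n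
    proof -
      let ?s = "s n"
      obtain P where P: "\<And>u. Re (poly P (cis u)) = (cmod (?s u))\<^sup>2"
        "poly P 0 = of_real ((l2norm lebesgue_pi ?s)\<^sup>2 / (2 * pi))"
        using trig_norm_sq_analytic[OF s(1)[of n]] by blast
      let ?E = "\<lambda>u. poly Q (cis u) * exp (poly (smult (-1/2) P) (cis u))"
      have Em: "?E \<in> borel_measurable lebesgue_pi"
        by (intro measurable_lebesgue_pi[OF refl] borel_measurable_continuous_onI continuous_intros)
      have Eabs: "(cmod (?E u))\<^sup>2 = (cmod (poly Q (cis u)))\<^sup>2 * exp (- (cmod (?s u))\<^sup>2)" for u
        by (simp add: norm_mult power_mult_distrib P power2_eq_square[of "exp _"] flip: exp_add)
      have E: "?E \<in> L2_space lebesgue_pi"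
      proof (rule L2_bounded[OF finL Em])
        show "cmod (?E u) \<le> R" for u
        proof (rule power2_le_imp_le[OF _ R(1)])
          have "(cmod (?E u))\<^sup>2 \<le> (cmod (poly Q (cis u)))\<^sup>2 * 1"
            unfolding Eabs by (intro mult_left_mono) auto
          also have "\<dots> \<le> R\<^sup>2" using R2[of u] by simp
          finally show "(cmod (?E u))\<^sup>2 \<le> R\<^sup>2" .
        qed
      qed
      have one: "(\<lambda>u. 1) \<in> L2_space lebesgue_pi" by (rule L2_bounded[OF finL, where C=1]) auto
      have n1: "(l2norm lebesgue_pi (\<lambda>u. 1))\<^sup>2 = 2 * pi"
        using measure_lebesgue_pi by (simp add: l2norm_sq)
      let ?a = "(l2norm lebesgue_pi ?s)\<^sup>2 / (2 * pi)"
      have int_E: "(\<integral>u. ?E u \<partial>lebesgue_pi) = of_real (2 * pi) * exp (of_real (- ?a / 2))"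
        unfolding integral_poly_exp_cis by (simp add: Q P)
      have "(cmod (\<integral>u. ?E u \<partial>lebesgue_pi))\<^sup>2 \<le> (l2norm lebesgue_pi ?E * l2norm lebesgue_pi (\<lambda>u. 1))\<^sup>2"
        using L2_Cauchy_Schwarz[OF E one] by (intro power_mono) auto
      also have "\<dots> = (l2norm lebesgue_pi ?E)\<^sup>2 * (2 * pi)" by (simp add: power_mult_distrib n1)
      also have "(cmod (\<integral>u. ?E u \<partial>lebesgue_pi))\<^sup>2 = (2 * pi * exp (- ?a)) * (2 * pi)"
        unfolding int_E by (simp add: norm_mult power_mult_distrib power2_eq_square flip: exp_add)
      finally have 1: "2 * pi * exp (- ?a) \<le> (l2norm lebesgue_pi ?E)\<^sup>2" by simp
      have iprod: "integrable lebesgue_pi (\<lambda>u. cmod (X u - ?s u) * cmod (X u) + cmod (X u - ?s u) * cmod (?s u))"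
        using L2_norm_mult_integrable[OF L2_diff[OF X sL] X] L2_norm_mult_integrable[OF L2_diff[OF X sL] sL]
        by (rule Bochner_Integration.integrable_add)
      have "(l2norm lebesgue_pi ?E)\<^sup>2 \<le> (\<integral>u. f u * (cmod (poly Q (cis u)))\<^sup>2
          + R\<^sup>2 * (cmod (X u - ?s u) * cmod (X u) + cmod (X u - ?s u) * cmod (?s u)) \<partial>lebesgue_pi)"
        unfolding l2norm_sq
      proof (rule integral_mono_AE)
        show "integrable lebesgue_pi (\<lambda>u. (cmod (?E u))\<^sup>2)" by (rule L2_D(2)[OF E])
        show "integrable lebesgue_pi (\<lambda>u. f u * (cmod (poly Q (cis u)))\<^sup>2
          + R\<^sup>2 * (cmod (X u - ?s u) * cmod (X u) + cmod (X u - ?s u) * cmod (?s u)))"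
          by (intro Bochner_Integration.integrable_add fQ integrable_mult_right iprod)
        have "AE u in lebesgue_pi. u \<in> {-pi..<pi}" by (auto intro!: AE_I2)
        then show "AE u in lebesgue_pi. (cmod (?E u))\<^sup>2 \<le> f u * (cmod (poly Q (cis u)))\<^sup>2
          + R\<^sup>2 * (cmod (X u - ?s u) * cmod (X u) + cmod (X u - ?s u) * cmod (?s u))"
          using exp_w
        proof eventually_elim
          case (elim u)
          let ?v = "(cmod (?s u))\<^sup>2"
          have "exp (- ?v) - exp (- w u) \<le> \<bar>w u - ?v\<bar>"
          proof (cases "?v \<le> w u")
            case True
            have "1 - exp (- (w u - ?v)) \<le> w u - ?v"
              using exp_ge_add_one_self[of "- (w u - ?v)"] by linarith
            then have "exp (- ?v) * (1 - exp (- (w u - ?v))) \<le> 1 * (w u - ?v)"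
              using True by (intro mult_mono) auto
            then show ?thesis using True by (simp add: algebra_simps flip: exp_add)
          next
            case False
            then have "exp (- ?v) \<le> exp (- w u)" by simp
            then show ?thesis by linarith
          qed
          also have "w u - ?v = (cmod (X u) - cmod (?s u)) * (cmod (X u) + cmod (?s u))"
            using Xsq[of u] elim(1) by (simp add: power2_eq_square algebra_simps)
          also have "\<bar>\<dots>\<bar> \<le> cmod (X u - ?s u) * (cmod (X u) + cmod (?s u))"
            unfolding abs_mult using norm_triangle_ineq3[of "X u" "?s u"] by (intro mult_mono) auto
          finally have *: "exp (- ?v) \<le> exp (- w u) + cmod (X u - ?s u) * (cmod (X u) + cmod (?s u))" by simp
          have "(cmod (?E u))\<^sup>2 \<le> (cmod (poly Q (cis u)))\<^sup>2 * (f u + cmod (X u - ?s u) * (cmod (X u) + cmod (?s u)))"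
            unfolding Eabs using * elim(2) by (intro mult_left_mono) auto
          also have "\<dots> \<le> f u * (cmod (poly Q (cis u)))\<^sup>2 + R\<^sup>2 * (cmod (X u - ?s u) * (cmod (X u) + cmod (?s u)))"
            unfolding distrib_left using R2[of u] by (intro add_mono mult_right_mono) (auto simp: mult.commute)
          finally show ?case by (simp add: distrib_left)
        qed
      qed
      also have "\<dots> = (l2norm \<nu> (\<lambda>u. poly Q (cis u)))\<^sup>2
          + R\<^sup>2 * ((\<integral>u. cmod (X u - ?s u) * cmod (X u) \<partial>lebesgue_pi) + (\<integral>u. cmod (X u - ?s u) * cmod (?s u) \<partial>lebesgue_pi))"
      proof -
        have "(l2norm \<nu> (\<lambda>u. poly Q (cis u)))\<^sup>2 = (\<integral>u. f u * (cmod (poly Q (cis u)))\<^sup>2 \<partial>lebesgue_pi)"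
          unfolding l2norm_sq using Qm by (subst integral_nu) auto
        then show ?thesis
          using fQ L2_norm_mult_integrable[OF L2_diff[OF X sL] X] L2_norm_mult_integrable[OF L2_diff[OF X sL] sL]
          by simp
      qed
      also have "\<dots> \<le> (l2norm \<nu> (\<lambda>u. poly Q (cis u)))\<^sup>2
          + R\<^sup>2 * (l2norm lebesgue_pi (\<lambda>u. X u - ?s u) * l2norm lebesgue_pi X + l2norm lebesgue_pi (\<lambda>u. X u - ?s u) * l2norm lebesgue_pi ?s)"
        using L2_Cauchy_Schwarz_norm[OF L2_diff[OF X sL] X] L2_Cauchy_Schwarz_norm[OF L2_diff[OF X sL] sL]
        by (intro add_left_mono mult_left_mono add_mono) auto
      finally show ?thesis using 1 by (simp add: distrib_left)
    qed
    have "(\<lambda>n. 2 * pi * exp (- ((l2norm lebesgue_pi (s n))\<^sup>2 / (2 * pi)))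
        - R\<^sup>2 * (l2norm lebesgue_pi (\<lambda>u. X u - s n u) * (l2norm lebesgue_pi X + l2norm lebesgue_pi (s n)))) \<longlonglongrightarrow>
        c - R\<^sup>2 * (0 * (l2norm lebesgue_pi X + l2norm lebesgue_pi X))"
      unfolding c_def by (intro tendsto_intros slim dlim) auto
    then have "c - R\<^sup>2 * (0 * (l2norm lebesgue_pi X + l2norm lebesgue_pi X)) \<le> (l2norm \<nu> (\<lambda>u. poly Q (cis u)))\<^sup>2"
      by (rule LIMSEQ_le_const2) (use lower in auto)
    then show ?thesis by simp
  qed
  moreover have "0 < c" by (simp add: c_def)
  ultimately show ?thesis by (rule that[rotated])
qed


text \<open>The innovation \<open>\<psi>\<close> is the minimal element of the closure of the polynomials with
  value one at the origin. Minimality against the directions \<open>z\<^sup>m R\<close> gives the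
  orthogonality relations, and against \<open>z\<^sup>m \<psi>\<close> it shows that the nonzero Fourier
  coefficients of \<open>f \<bar>\<psi>\<bar>\<^sup>2\<close> vanish. The constant is positive by
  \<open>Szego_lower_bound\<close>.\<close>

lemma innovation:
  obtains \<psi> c where "\<psi> \<in> L2_space \<nu>" "0 < c" "AE u in lebesgue_pi. f u * (cmod (\<psi> u))\<^sup>2 = c"
    "\<And>R m. 0 < m \<Longrightarrow> (\<integral>u. \<psi> u * cnj (tpoly m R u) \<partial>\<nu>) = 0"
proof -
  define S where "S = {(\<lambda>u. poly Q (cis u)) | Q. poly Q 0 = 1}"
  have S_L2: "S \<subseteq> L2_space \<nu>"
    unfolding S_def poly_cis_tpoly using tpoly_L2[OF finite_nu sets_nu] by blast
  have S_I: "poly Q 0 = 1 \<Longrightarrow> (\<lambda>u. poly Q (cis u)) \<in> S" for Q unfolding S_def by blast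
  have S_ne: "S \<noteq> {}" using S_I[of 1] by auto
  have mid: "(\<lambda>u. (X u + Y u) / 2) \<in> S" if XY: "X \<in> S" "Y \<in> S" for X Y
  proof -
    obtain Q R where "X = (\<lambda>u. poly Q (cis u))" "Y = (\<lambda>u. poly R (cis u))" "poly Q 0 = 1" "poly R 0 = 1"
      using XY unfolding S_def by blast
    then show ?thesis using S_I[of "smult (1/2) (Q + R)"] by simp
  qed
  obtain X \<psi> where X: "\<And>n. X n \<in> S" and psi: "\<psi> \<in> L2_space \<nu>" "(\<lambda>n. l2norm \<nu> (\<lambda>u. X n u - \<psi> u)) \<longlonglongrightarrow> 0"
    and min: "\<And>Y. Y \<in> S \<Longrightarrow> l2norm \<nu> \<psi> \<le> l2norm \<nu> Y"
    using L2_minimizer[OF finite_nu S_L2 S_ne mid] by blast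
  have XL: "X n \<in> L2_space \<nu>" for n using X S_L2 by blast
  obtain Q where Q: "\<And>n. X n = (\<lambda>u. poly (Q n) (cis u))" "\<And>n. poly (Q n) 0 = 1"
    using X unfolding S_def mem_Collect_eq by metis
  have psim [measurable]: "\<psi> \<in> borel_measurable lebesgue_pi" using L2_D(1)[OF psi(1)] by (simp add: meas_nu)
  have orth1: "(\<integral>u. \<psi> u * cnj (tpoly (int (Suc m)) R u) \<partial>\<nu>) = 0" for R m
  proof (rule minimal_norm_orthogonal[OF psi(1) tpoly_L2[OF finite_nu sets_nu]])
    fix c :: complex
    let ?t = "tpoly (int (Suc m)) R"
    have tL: "?t \<in> L2_space \<nu>" by (rule tpoly_L2[OF finite_nu sets_nu])
    show "l2norm \<nu> \<psi> \<le> l2norm \<nu> (\<lambda>u. \<psi> u + c * ?t u)"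
    proof (rule LIMSEQ_le_const)
      show "(\<lambda>n. l2norm \<nu> (\<lambda>u. X n u + c * ?t u)) \<longlonglongrightarrow> l2norm \<nu> (\<lambda>u. \<psi> u + c * ?t u)"
        by (rule l2norm_tendsto) (use XL psi tL in auto)
      have "(\<lambda>u. X n u + c * ?t u) \<in> S" for n
        using S_I[of "Q n + smult c (monom 1 (Suc m) * R)"] Q(2)[of n]
        by (simp add: Q(1) tpoly_def poly_monom Complex.DeMoivre del: power_Suc)
      then show "\<exists>N. \<forall>n\<ge>N. l2norm \<nu> \<psi> \<le> l2norm \<nu> (\<lambda>u. X n u + c * ?t u)" using min by blast
    qed
  qed
  have orth2: "(\<integral>u. \<psi> u * cnj (cis (of_int (int (Suc m)) * u) * \<psi> u) \<partial>\<nu>) = 0" for m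
  proof -
    let ?e = "\<lambda>u. cis (of_int (int (Suc m)) * u)"
    have em: "?e \<in> borel_measurable \<nu>" and e1: "\<And>u. cmod (?e u) \<le> 1"
      using tpoly_measurable[OF sets_nu, of "int (Suc m)" 1] by (auto simp: tpoly_def[abs_def])
    note eL = L2_mult_bounded[OF _ em e1 zero_le_one]
    show ?thesis
    proof (rule minimal_norm_orthogonal[OF psi(1) eL(1)[OF psi(1)]])
      fix c :: complex
      have c: "0 \<le> 1 + cmod c" by (simp add: add_nonneg_nonneg)
      show "l2norm \<nu> \<psi> \<le> l2norm \<nu> (\<lambda>u. \<psi> u + c * (?e u * \<psi> u))"
      proof (rule LIMSEQ_le_const)
        show "(\<lambda>n. l2norm \<nu> (\<lambda>u. X n u + c * (?e u * X n u))) \<longlonglongrightarrow> l2norm \<nu> (\<lambda>u. \<psi> u + c * (?e u * \<psi> u))"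
        proof (rule l2norm_tendsto)
          show "(\<lambda>n. l2norm \<nu> (\<lambda>u. X n u + c * (?e u * X n u) - (\<psi> u + c * (?e u * \<psi> u)))) \<longlonglongrightarrow> 0"
          proof (rule tendsto_sandwich[OF _ _ tendsto_const])
            show "(\<lambda>n. (1 + cmod c) * l2norm \<nu> (\<lambda>u. X n u - \<psi> u)) \<longlonglongrightarrow> 0"
              using tendsto_mult_left[OF psi(2), of "1 + cmod c"] by simp
            have "l2norm \<nu> (\<lambda>u. (1 + c * ?e u) * (X n u - \<psi> u)) \<le> (1 + cmod c) * l2norm \<nu> (\<lambda>u. X n u - \<psi> u)" for n
            proof (rule L2_mult_bounded(2)[OF L2_diff[OF XL psi(1)] _ _ c])
              show "(\<lambda>u. 1 + c * ?e u) \<in> borel_measurable \<nu>"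
                using em by (intro borel_measurable_add borel_measurable_times) auto
              show "cmod (1 + c * ?e u) \<le> 1 + cmod c" for u
                using norm_triangle_ineq[of 1 "c * ?e u"] by (simp add: norm_mult)
            qed
            moreover have "(1 + c * ?e u) * (X n u - \<psi> u) = X n u + c * (?e u * X n u) - (\<psi> u + c * (?e u * \<psi> u))" for n u
              by (simp add: algebra_simps)
            ultimately show "\<forall>\<^sub>F n in sequentially. l2norm \<nu> (\<lambda>u. X n u + c * (?e u * X n u) - (\<psi> u + c * (?e u * \<psi> u)))
                \<le> (1 + cmod c) * l2norm \<nu> (\<lambda>u. X n u - \<psi> u)"
              by (intro always_eventually) simp
          qed auto
        qed (intro L2_add L2_scale eL(1) XL psi(1))+
        have "(\<lambda>u. X n u + c * (?e u * X n u)) \<in> S" for n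
          using S_I[of "Q n + smult c (monom 1 (Suc m) * Q n)"] Q(2)[of n]
          by (simp add: Q(1) poly_monom Complex.DeMoivre del: power_Suc)
        then show "\<exists>N. \<forall>n\<ge>N. l2norm \<nu> \<psi> \<le> l2norm \<nu> (\<lambda>u. X n u + c * (?e u * X n u))" using min by blast
      qed
    qed
  qed
  define c where "c = (l2norm \<nu> \<psi>)\<^sup>2 / (2 * pi)"
  have c_pos: "0 < c"
  proof -
    obtain d where d: "0 < d" "\<And>Q. poly Q 0 = 1 \<Longrightarrow> d \<le> (l2norm \<nu> (\<lambda>u. poly Q (cis u)))\<^sup>2"
      using Szego_lower_bound by blast
    have "d \<le> (l2norm \<nu> \<psi>)\<^sup>2"
    proof (rule LIMSEQ_le_const)
      show "(\<lambda>n. (l2norm \<nu> (X n))\<^sup>2) \<longlonglongrightarrow> (l2norm \<nu> \<psi>)\<^sup>2" by (intro tendsto_intros l2norm_tendsto XL psi)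
      show "\<exists>N. \<forall>n\<ge>N. d \<le> (l2norm \<nu> (X n))\<^sup>2" using d(2) Q by auto
    qed
    then have "0 < (l2norm \<nu> \<psi>)\<^sup>2" using d(1) by linarith
    then show ?thesis by (simp add: c_def)
  qed
  let ?h = "\<lambda>u. complex_of_real (f u * (cmod (\<psi> u))\<^sup>2 - c)"
  have ipsi: "integrable lebesgue_pi (\<lambda>u. f u * (cmod (\<psi> u))\<^sup>2)"
    using L2_D(2)[OF psi(1)] by (subst (asm) integrable_nu) auto
  interpret L: finite_measure lebesgue_pi by (rule finite_measure_lebesgue_pi)
  have ih: "integrable lebesgue_pi ?h" by (intro integrable_of_real Bochner_Integration.integrable_diff ipsi) auto
  have ifc: "integrable lebesgue_pi (\<lambda>u. complex_of_real (f u * (cmod (\<psi> u))\<^sup>2) * cis (of_int k * u))" for k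
    by (rule Bochner_Integration.integrable_bound[OF ipsi])
       (use f_meas borel_measurable_integrable[OF cis_integrable_lebesgue_pi[of k]] in \<open>auto simp: norm_mult norm_power abs_mult\<close>)
  have split: "(\<integral>u. ?h u * cis (of_int k * u) \<partial>lebesgue_pi)
     = (\<integral>u. complex_of_real (f u * (cmod (\<psi> u))\<^sup>2) * cis (of_int k * u) \<partial>lebesgue_pi) - of_real c * (\<integral>u. cis (of_int k * u) \<partial>lebesgue_pi)" for k
  proof -
    have eq: "?h u * cis (of_int k * u) = complex_of_real (f u * (cmod (\<psi> u))\<^sup>2) * cis (of_int k * u) - of_real c * cis (of_int k * u)" for u
      by (simp add: algebra_simps)
    show ?thesis unfolding eq using ifc[of k] cis_integrable_lebesgue_pi[of k] by simp
  qed
  have neg: "(\<integral>u. complex_of_real (f u * (cmod (\<psi> u))\<^sup>2) * cis (of_int (- int (Suc m)) * u) \<partial>lebesgue_pi) = 0" for m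
  proof -
    have em: "(\<lambda>u. cis (of_int (int (Suc m)) * u)) \<in> borel_measurable lebesgue_pi"
      by (rule borel_measurable_integrable[OF cis_integrable_lebesgue_pi])
    have "(\<integral>u. \<psi> u * cnj (cis (of_int (int (Suc m)) * u) * \<psi> u) \<partial>\<nu>)
       = (\<integral>u. f u *\<^sub>R (\<psi> u * cnj (cis (of_int (int (Suc m)) * u) * \<psi> u)) \<partial>lebesgue_pi)"
      using em by (intro integral_nu borel_measurable_times measurable_cnj) auto
    also have "\<dots> = (\<integral>u. complex_of_real (f u * (cmod (\<psi> u))\<^sup>2) * cis (of_int (- int (Suc m)) * u) \<partial>lebesgue_pi)"
    proof (rule Bochner_Integration.integral_cong[OF refl])
      fix u
      have "\<psi> u * cnj (cis (of_int (int (Suc m)) * u) * \<psi> u) = (\<psi> u * cnj (\<psi> u)) * cis (of_int (- int (Suc m)) * u)"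
        unfolding complex_cnj_mult cnj_cis_int by (simp only: mult_ac)
      then show "f u *\<^sub>R (\<psi> u * cnj (cis (of_int (int (Suc m)) * u) * \<psi> u)) = complex_of_real (f u * (cmod (\<psi> u))\<^sup>2) * cis (of_int (- int (Suc m)) * u)"
        by (simp only: complex_norm_square[symmetric] scaleR_conv_of_real of_real_mult mult.assoc)
    qed
    finally show ?thesis using orth2[of m] by simp
  qed
  have zero: "(\<integral>u. complex_of_real (f u * (cmod (\<psi> u))\<^sup>2) \<partial>lebesgue_pi) = of_real (2 * pi * c)"
  proof -
    have "(l2norm \<nu> \<psi>)\<^sup>2 = (\<integral>u. f u * (cmod (\<psi> u))\<^sup>2 \<partial>lebesgue_pi)"
      unfolding l2norm_sq by (subst integral_nu) auto
    then show ?thesis unfolding integral_complex_of_real by (simp add: c_def)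
  qed
  have "(\<integral>u. ?h u * cis (of_int k * u) \<partial>lebesgue_pi) = 0" for k
  proof (cases "k = 0")
    case True
    then show ?thesis
      unfolding split integral_cis_lebesgue_pi using zero by simp
  next
    case False
    have "(\<integral>u. complex_of_real (f u * (cmod (\<psi> u))\<^sup>2) * cis (of_int k * u) \<partial>lebesgue_pi) = 0"
    proof (cases "k < 0")
      case True
      then have "k = - int (Suc (nat (- k - 1)))" by simp
      then show ?thesis using neg[of "nat (- k - 1)"] by metis
    next
      case f: False
      with False have k: "- k = - int (Suc (nat (k - 1)))" by simp
      have "(\<integral>u. complex_of_real (f u * (cmod (\<psi> u))\<^sup>2) * cis (of_int (- k) * u) \<partial>lebesgue_pi) = 0"
        using neg[of "nat (k - 1)"] unfolding k[symmetric] .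
      then have "cnj (\<integral>u. complex_of_real (f u * (cmod (\<psi> u))\<^sup>2) * cis (of_int (- k) * u) \<partial>lebesgue_pi) = 0" by simp
      then show ?thesis unfolding Bochner_Integration.integral_cnj[symmetric] by (simp add: cis_cnj)
    qed
    then show ?thesis unfolding split integral_cis_lebesgue_pi using False by simp
  qed
  from Fourier_coefficients_unique[OF ih this]
  have "AE u in lebesgue_pi. f u * (cmod (\<psi> u))\<^sup>2 = c"
    by eventually_elim (simp only: of_real_eq_0_iff right_minus_eq)
  moreover have "(\<integral>u. \<psi> u * cnj (tpoly m R u) \<partial>\<nu>) = 0" if "0 < m" for m R
    using orth1[of "nat (m - 1)" R] that by simp
  ultimately show ?thesis using psi(1) c_pos that by blast
qed

text \<open>With \<open>D = cnj \<psi> f / sqrt c\<close> one has \<open>f = \<bar>D\<bar>\<^sup>2\<close>,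
  and by orthogonality of \<open>\<psi>\<close> the function \<open>D\<close> has no negative frequencies. If
  the frequencies of \<open>\<phi>\<close> are at least \<open>n\<close>, then so are those of \<open>\<phi>
  D\<close>. The integral \<open>\<integral> \<phi> d\<nu> = \<integral> \<phi> D cnj D du\<close> therefore
  ignores the part of \<open>D\<close> with frequencies below \<open>n\<close>, and only a small tail of
  \<open>D\<close> remains.\<close>

theorem remote_future_orthogonal:
  assumes e: "0 < e"
  obtains n0 where "\<And>n Q. n0 \<le> n \<Longrightarrow> cmod (\<integral>u. tpoly n Q u \<partial>\<nu>) \<le> e * l2norm \<nu> (tpoly n Q)"
proof -
  obtain \<psi> c where psi: "\<psi> \<in> L2_space \<nu>" and c: "0 < c" and const: "AE u in lebesgue_pi. f u * (cmod (\<psi> u))\<^sup>2 = c"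
    and orth: "\<And>R m. 0 < m \<Longrightarrow> (\<integral>u. \<psi> u * cnj (tpoly m R u) \<partial>\<nu>) = 0"
    using innovation by blast
  have psim [measurable]: "\<psi> \<in> borel_measurable lebesgue_pi" using L2_D(1)[OF psi(1)] by (simp add: meas_nu)
  note [measurable] = f_meas
  define D where "D u = cnj (\<psi> u) * of_real (f u / sqrt c)" for u
  have Dm [measurable]: "D \<in> borel_measurable lebesgue_pi" unfolding D_def by measurable
  have D_sq: "AE u in lebesgue_pi. (cmod (D u))\<^sup>2 = f u"
    using const
  proof eventually_elim
    case (elim u)
    have "(cmod (D u))\<^sup>2 = f u * (f u * (cmod (\<psi> u))\<^sup>2) / c"
      using c by (simp add: D_def norm_mult norm_divide power_mult_distrib power_divide power2_eq_square)
    then show ?case using elim c by simp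
  qed
  have "integrable lebesgue_pi (\<lambda>u. (cmod (D u))\<^sup>2)"
    by (rule integrable_cong_AE_imp[OF f_int]) (use D_sq in \<open>auto elim: eventually_mono\<close>)
  then have D: "D \<in> L2_space lebesgue_pi" by (simp add: L2_space_def)
  note finL = finite_measure_lebesgue_pi
  obtain t where t: "t \<in> trig_polys" "l2norm lebesgue_pi (\<lambda>u. D u - t u) < e"
    using L2_closure_D(2)[OF trig_polys_dense[OF finL refl D] e] by blast
  have tL: "t \<in> L2_space lebesgue_pi" using trig_L2[OF finL refl] t by blast
  obtain j T where T: "(\<lambda>u. cnj (t u)) = tpoly j T" using trig_cnj[OF t(1)] by (rule trig_polysE)
  (* The conjugate of t has frequencies at least j, so its product with phi has positive ones. *)
  show ?thesis
  proof (rule that[of "1 - j"])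
    fix n Q assume n: "1 - j \<le> n"
    let ?\<phi> = "tpoly n Q"
    have pm: "?\<phi> \<in> borel_measurable lebesgue_pi" by (rule tpoly_measurable[OF refl])
    obtain C where C: "0 \<le> C" "\<And>u. cmod (?\<phi> u) \<le> C" using tpoly_bounded by blast
    note pD = L2_mult_bounded(1)[OF D pm C(2) C(1)]
    have pD_norm: "l2norm lebesgue_pi (\<lambda>u. ?\<phi> u * D u) = l2norm \<nu> ?\<phi>"
    proof -
      have "(\<integral>u. (cmod (?\<phi> u * D u))\<^sup>2 \<partial>lebesgue_pi) = (\<integral>u. f u *\<^sub>R (cmod (?\<phi> u))\<^sup>2 \<partial>lebesgue_pi)"
        using D_sq pm by (intro integral_cong_AE) (auto elim!: eventually_mono simp: norm_mult power_mult_distrib mult.commute)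
      also have "\<dots> = (\<integral>u. (cmod (?\<phi> u))\<^sup>2 \<partial>\<nu>)"
        using pm by (subst integral_nu) auto
      finally show ?thesis by (simp add: l2norm_def)
    qed
    have "(\<integral>u. ?\<phi> u \<partial>\<nu>) = (\<integral>u. f u *\<^sub>R ?\<phi> u \<partial>lebesgue_pi)" by (rule integral_nu[OF pm])
    also have "\<dots> = (\<integral>u. (?\<phi> u * D u) * cnj (D u) \<partial>lebesgue_pi)"
    proof (rule integral_cong_AE)
      show "AE u in lebesgue_pi. f u *\<^sub>R ?\<phi> u = (?\<phi> u * D u) * cnj (D u)"
        using D_sq
      proof eventually_elim
        case (elim u)
        have D_cnj: "D u * cnj (D u) = of_real (f u)" using elim complex_norm_square[of "D u"] by simp
        show ?case unfolding mult.assoc D_cnj scaleR_conv_of_real by (rule mult.commute)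
      qed
    qed (use pm in auto)
    also have "\<dots> = (\<integral>u. (?\<phi> u * D u) * cnj (D u - t u) \<partial>lebesgue_pi)"
    proof -
      have "(\<integral>u. (?\<phi> u * D u) * cnj (t u) \<partial>lebesgue_pi) = 0"
      proof -
        have tp: "?\<phi> u * cnj (t u) = tpoly (n + j) (Q * T) u" for u
          unfolding fun_cong[OF T] tpoly_mult ..
        have tm: "tpoly (n + j) (Q * T) \<in> borel_measurable lebesgue_pi" by (rule tpoly_measurable[OF refl])
        have "(\<integral>u. \<psi> u * cnj (tpoly (n + j) (Q * T) u) \<partial>\<nu>) = 0" using n by (intro orth) simp
        moreover have "(\<integral>u. cnj (\<psi> u) * tpoly (n + j) (Q * T) u \<partial>\<nu>)
            = (\<integral>u. cnj (\<psi> u * cnj (tpoly (n + j) (Q * T) u)) \<partial>\<nu>)"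
          by (intro Bochner_Integration.integral_cong refl) simp
        ultimately have "(\<integral>u. cnj (\<psi> u) * tpoly (n + j) (Q * T) u \<partial>\<nu>) = 0"
          by (simp only: Bochner_Integration.integral_cnj complex_cnj_zero)
        then have "(\<integral>u. f u *\<^sub>R (cnj (\<psi> u) * tpoly (n + j) (Q * T) u) \<partial>lebesgue_pi) = 0"
          using tm by (subst (asm) integral_nu) auto
        moreover have "(?\<phi> u * D u) * cnj (t u) = of_real (1 / sqrt c) * (f u *\<^sub>R (cnj (\<psi> u) * tpoly (n + j) (Q * T) u))" for u
          unfolding tp[symmetric] D_def by (simp add: scaleR_conv_of_real)
        ultimately show ?thesis by (simp only: integral_mult_right_zero mult_zero_right)
      qed
      moreover have "(\<integral>u. (?\<phi> u * D u) * cnj (D u - t u) \<partial>lebesgue_pi)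
        = (\<integral>u. (?\<phi> u * D u) * cnj (D u) \<partial>lebesgue_pi) - (\<integral>u. (?\<phi> u * D u) * cnj (t u) \<partial>lebesgue_pi)"
        unfolding complex_cnj_diff right_diff_distrib
        by (rule Bochner_Integration.integral_diff[OF L2_inner_integrable[OF pD D] L2_inner_integrable[OF pD tL]])
      ultimately show ?thesis by simp
    qed
    finally have "cmod (\<integral>u. ?\<phi> u \<partial>\<nu>) \<le> l2norm \<nu> ?\<phi> * l2norm lebesgue_pi (\<lambda>u. D u - t u)"
      using L2_Cauchy_Schwarz[OF pD L2_diff[OF D tL]] unfolding pD_norm by simp
    also have "\<dots> \<le> l2norm \<nu> ?\<phi> * e" using t(2) by (intro mult_left_mono) auto
    finally show "cmod (\<integral>u. ?\<phi> u \<partial>\<nu>) \<le> e * l2norm \<nu> ?\<phi>" by (simp add: mult.commute)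
  qed
qed

text \<open>Expand the square, and use \<open>2 sqrt e x \<le> x\<^sup>2 + e\<close>.\<close>

corollary distance_from_remote_future:
  assumes e: "0 < e"
  obtains n0 where "\<And>n Q. n0 \<le> n \<Longrightarrow> (l2norm \<nu> (\<lambda>u. 1))\<^sup>2 - e \<le> (l2norm \<nu> (\<lambda>u. tpoly n Q u - 1))\<^sup>2"
proof -
  obtain n0 where n0: "\<And>n Q. n0 \<le> n \<Longrightarrow> cmod (\<integral>u. tpoly n Q u \<partial>\<nu>) \<le> sqrt e * l2norm \<nu> (tpoly n Q)"
    using remote_future_orthogonal[of "sqrt e"] e by auto
  show ?thesis
  proof (rule that)
    fix n Q assume n: "n0 \<le> n"
    let ?\<phi> = "tpoly n Q"
    have pL: "?\<phi> \<in> L2_space \<nu>" by (rule tpoly_L2[OF finite_nu sets_nu])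
    have one: "(\<lambda>u. - 1) \<in> L2_space \<nu>" by (rule L2_bounded[OF finite_nu, where C=1]) auto
    have "Re (\<integral>u. ?\<phi> u \<partial>\<nu>) \<le> sqrt e * l2norm \<nu> ?\<phi>"
      using n0[OF n, of Q] complex_Re_le_cmod[of "\<integral>u. ?\<phi> u \<partial>\<nu>"] by linarith
    moreover have "(l2norm \<nu> (\<lambda>u. ?\<phi> u + - 1))\<^sup>2 = (l2norm \<nu> ?\<phi>)\<^sup>2 - 2 * Re (\<integral>u. ?\<phi> u \<partial>\<nu>) + (l2norm \<nu> (\<lambda>u. 1))\<^sup>2"
      unfolding l2norm_sq_add[OF pL one] by (simp add: l2norm_def)
    moreover have "0 \<le> (l2norm \<nu> ?\<phi> - sqrt e)\<^sup>2" by simp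
    then have "2 * (sqrt e * l2norm \<nu> ?\<phi>) \<le> (l2norm \<nu> ?\<phi>)\<^sup>2 + e"
      using e by (simp add: power2_diff algebra_simps)
    ultimately show "(l2norm \<nu> (\<lambda>u. 1))\<^sup>2 - e \<le> (l2norm \<nu> (\<lambda>u. ?\<phi> u - 1))\<^sup>2" by simp
  qed
qed

end

section \<open>Isometries determined by Gram matrices\<close>

lemma inner_tendsto:
  assumes X: "X \<in> L2_space M" and Y: "\<And>n. Y n \<in> L2_space M" "Z \<in> L2_space M"
    and lim: "(\<lambda>n. l2norm M (\<lambda>u. Y n u - Z u)) \<longlonglongrightarrow> 0"
  shows "(\<lambda>n. \<integral>u. X u * cnj (Y n u) \<partial>M) \<longlonglongrightarrow> (\<integral>u. X u * cnj (Z u) \<partial>M)"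
proof (rule LIM_zero_cancel, rule Lim_null_comparison)
  show "(\<lambda>n. l2norm M X * l2norm M (\<lambda>u. Y n u - Z u)) \<longlonglongrightarrow> 0"
    using tendsto_mult_left[OF lim, of "l2norm M X"] by simp
  have "(\<integral>u. X u * cnj (Y n u) \<partial>M) - (\<integral>u. X u * cnj (Z u) \<partial>M) = (\<integral>u. X u * cnj (Y n u - Z u) \<partial>M)" for n
    unfolding complex_cnj_diff right_diff_distrib
    by (rule Bochner_Integration.integral_diff[symmetric]) (intro L2_inner_integrable X Y)+
  then show "\<forall>\<^sub>F n in sequentially. norm ((\<integral>u. X u * cnj (Y n u) \<partial>M) - (\<integral>u. X u * cnj (Z u) \<partial>M))
      \<le> l2norm M X * l2norm M (\<lambda>u. Y n u - Z u)"
    using L2_Cauchy_Schwarz[OF X L2_diff[OF Y]] by (intro always_eventually) simp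
qed

lemma inner_sum_right:
  assumes X: "X \<in> L2_space M" and Y: "\<And>i. i \<in> I \<Longrightarrow> Y i \<in> L2_space M"
  shows "(\<integral>u. X u * cnj (\<Sum>i\<in>I. c i * Y i u) \<partial>M) = (\<Sum>i\<in>I. cnj (c i) * (\<integral>u. X u * cnj (Y i u) \<partial>M))"
proof -
  have eq: "X u * cnj (\<Sum>i\<in>I. c i * Y i u) = (\<Sum>i\<in>I. cnj (c i) * (X u * cnj (Y i u)))" for u
    by (simp add: sum_distrib_left mult_ac)
  show ?thesis
    unfolding eq using L2_inner_integrable[OF X Y]
    by (subst Bochner_Integration.integral_sum) (auto intro!: integrable_mult_right)
qed

lemma inner_commute: "(\<integral>u. X u * cnj (Y u) \<partial>M) = cnj (\<integral>u. Y u * cnj (X u) \<partial>M)"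
  unfolding Bochner_Integration.integral_cnj[symmetric] by (simp add: mult.commute)

lemma inner_self: "(\<integral>u. X u * cnj (X u) \<partial>M) = of_real ((l2norm M X)\<^sup>2)"
  unfolding l2norm_sq complex_norm_square[symmetric] by (rule integral_complex_of_real)

lemma inner_imaginary: "(\<integral>u. X u * cnj (\<i> * Y u) \<partial>M) = - \<i> * (\<integral>u. X u * cnj (Y u) \<partial>M)"
proof -
  have "X u * cnj (\<i> * Y u) = - \<i> * (X u * cnj (Y u))" for u by simp
  then show ?thesis by (simp only: integral_mult_right_zero)
qed

definition lin_comb :: "(int \<Rightarrow> 'a \<Rightarrow> complex) \<Rightarrow> int set \<Rightarrow> (int \<Rightarrow> complex) \<Rightarrow> 'a \<Rightarrow> complex" where
  "lin_comb b F c u = (\<Sum>s\<in>F. c s * b s u)"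

lemma lin_comb_add:
  assumes "finite F" "finite G"
  shows "lin_comb b F c u + lin_comb b G d u
    = lin_comb b (F \<union> G) (\<lambda>s. (if s \<in> F then c s else 0) + (if s \<in> G then d s else 0)) u"
proof -
  have "lin_comb b F c u = (\<Sum>s\<in>F \<union> G. (if s \<in> F then c s else 0) * b s u)"
    unfolding lin_comb_def using assms by (intro sum.mono_neutral_cong_left) auto
  moreover have "lin_comb b G d u = (\<Sum>s\<in>F \<union> G. (if s \<in> G then d s else 0) * b s u)"
    unfolding lin_comb_def using assms by (intro sum.mono_neutral_cong_left) auto
  ultimately show ?thesis by (simp add: lin_comb_def distrib_right sum.distrib)
qed

lemma lin_comb_scale: "a * lin_comb b F c u = lin_comb b F (\<lambda>s. a * c s) u"
  by (simp add: lin_comb_def sum_distrib_left mult.assoc)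

lemma lin_comb_L2: "(\<And>s. b s \<in> L2_space M) \<Longrightarrow> lin_comb b F c \<in> L2_space M"
  unfolding lin_comb_def[abs_def] by (intro L2_sum L2_scale)

lemma closed_lin_span_iff:
  "Y \<in> closed_lin_span M b T \<longleftrightarrow> Y \<in> L2_space M \<and>
    (\<forall>e>0. \<exists>F c. finite F \<and> F \<subseteq> T \<and> l2norm M (\<lambda>u. Y u - lin_comb b F c u) < e)"
proof -
  have "(\<forall>e>0. \<exists>F c. finite F \<and> F \<subseteq> T \<and> sq_dist M Y (\<lambda>u. \<Sum>s\<in>F. c s * b s u) < e) \<longleftrightarrow>
    (\<forall>e>0. \<exists>F c. finite F \<and> F \<subseteq> T \<and> l2norm M (\<lambda>u. Y u - lin_comb b F c u) < e)" (is "?L \<longleftrightarrow> ?R")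
  proof
    assume L: ?L
    show ?R
    proof (intro allI impI)
      fix e :: real assume e: "0 < e"
      then obtain F c where F: "finite F" "F \<subseteq> T" "sq_dist M Y (\<lambda>u. \<Sum>s\<in>F. c s * b s u) < e\<^sup>2"
        using L by (meson zero_less_power)
      then have "l2norm M (\<lambda>u. Y u - lin_comb b F c u) < e"
        unfolding sq_dist_l2norm lin_comb_def using e by (intro power_less_imp_less_base[of _ 2 e]) auto
      with F show "\<exists>F c. finite F \<and> F \<subseteq> T \<and> l2norm M (\<lambda>u. Y u - lin_comb b F c u) < e" by blast
    qed
  next
    assume R: ?R
    show ?L
    proof (intro allI impI)
      fix e :: real assume e: "0 < e"
      then obtain F c where F: "finite F" "F \<subseteq> T" "l2norm M (\<lambda>u. Y u - lin_comb b F c u) < sqrt e"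
        using R by (meson real_sqrt_gt_zero)
      then have "(l2norm M (\<lambda>u. Y u - lin_comb b F c u))\<^sup>2 < (sqrt e)\<^sup>2"
        by (intro power_strict_mono) auto
      then have "sq_dist M Y (\<lambda>u. \<Sum>s\<in>F. c s * b s u) < e"
        unfolding sq_dist_l2norm lin_comb_def using e by simp
      with F show "\<exists>F c. finite F \<and> F \<subseteq> T \<and> sq_dist M Y (\<lambda>u. \<Sum>s\<in>F. c s * b s u) < e" by blast
    qed
  qed
  then show ?thesis by (simp add: closed_lin_span_def)
qed

lemma closed_lin_span_mono: "S \<subseteq> T \<Longrightarrow> closed_lin_span M b S \<subseteq> closed_lin_span M b T"
proof
  fix Y assume ST: "S \<subseteq> T" and Y: "Y \<in> closed_lin_span M b S"
  show "Y \<in> closed_lin_span M b T"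
    unfolding closed_lin_span_iff
  proof (intro conjI allI impI)
    show "Y \<in> L2_space M" using Y by (simp add: closed_lin_span_iff)
    fix e :: real assume "0 < e"
    then obtain F c where "finite F" "F \<subseteq> S" "l2norm M (\<lambda>u. Y u - lin_comb b F c u) < e"
      using Y unfolding closed_lin_span_iff by blast
    with ST show "\<exists>F c. finite F \<and> F \<subseteq> T \<and> l2norm M (\<lambda>u. Y u - lin_comb b F c u) < e"
      by (intro exI[of _ F] exI[of _ c]) auto
  qed
qed

text \<open>Two families with the same Gram matrix. Then \<open>b s \<mapsto> d s\<close> extends to an
  isometry of the closed spans; as no quotient by null functions is formed, the isometry is represented by a
  relation.\<close>

locale isometric_families =
  fixes M :: "'a measure" and b :: "int \<Rightarrow> 'a \<Rightarrow> complex"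
    and N :: "'b measure" and d :: "int \<Rightarrow> 'b \<Rightarrow> complex"
  assumes fin_M: "finite_measure M" and fin_N: "finite_measure N"
    and b: "\<And>s. b s \<in> L2_space M" and d: "\<And>s. d s \<in> L2_space N"
    and gram: "\<And>s t. (\<integral>u. b s u * cnj (b t u) \<partial>M) = (\<integral>u. d s u * cnj (d t u) \<partial>N)"
begin

definition corresponds :: "('a \<Rightarrow> complex) \<Rightarrow> ('b \<Rightarrow> complex) \<Rightarrow> bool" where
  "corresponds \<phi> \<xi> \<longleftrightarrow> \<phi> \<in> L2_space M \<and> \<xi> \<in> L2_space N \<and>
    (\<forall>e>0. \<exists>F c. finite F \<and> l2norm M (\<lambda>u. \<phi> u - lin_comb b F c u) < e \<and>
       l2norm N (\<lambda>u. \<xi> u - lin_comb d F c u) < e)"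

lemma corresponds_L2:
  assumes "corresponds \<phi> \<xi>" shows "\<phi> \<in> L2_space M" "\<xi> \<in> L2_space N"
  using assms by (auto simp: corresponds_def)

lemma correspondsE:
  assumes "corresponds \<phi> \<xi>" "0 < e"
  obtains F c where "finite F" "l2norm M (\<lambda>u. \<phi> u - lin_comb b F c u) < e"
    "l2norm N (\<lambda>u. \<xi> u - lin_comb d F c u) < e"
  using assms unfolding corresponds_def by blast

lemma inner_lin_comb:
  "(\<integral>u. lin_comb b F c u * cnj (lin_comb b G a u) \<partial>M) = (\<integral>u. lin_comb d F c u * cnj (lin_comb d G a u) \<partial>N)"
proof -
  have 1: "(\<integral>u. b t u * cnj (lin_comb b F c u) \<partial>M) = (\<integral>u. d t u * cnj (lin_comb d F c u) \<partial>N)" for t F c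
    unfolding lin_comb_def by (simp only: inner_sum_right[OF b b] inner_sum_right[OF d d] gram)
  have 2: "(\<integral>u. lin_comb b F c u * cnj (b t u) \<partial>M) = (\<integral>u. lin_comb d F c u * cnj (d t u) \<partial>N)" for t
    by (subst (1 2) inner_commute) (simp only: 1)
  show ?thesis
    unfolding lin_comb_def[of b G] lin_comb_def[of d G]
    by (simp only: inner_sum_right[OF lin_comb_L2[OF b] b] inner_sum_right[OF lin_comb_L2[OF d] d] 2)
qed

lemma l2norm_lin_comb: "l2norm M (lin_comb b F c) = l2norm N (lin_comb d F c)"
proof -
  have "(l2norm M (lin_comb b F c))\<^sup>2 = (l2norm N (lin_comb d F c))\<^sup>2"
    using inner_lin_comb[of F c F c] unfolding inner_self of_real_eq_iff .
  then show ?thesis by (simp add: power2_eq_iff_nonneg)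
qed

lemma corresponds_lin_comb: "finite F \<Longrightarrow> corresponds (lin_comb b F c) (lin_comb d F c)"
  unfolding corresponds_def using lin_comb_L2[of b M, OF b] lin_comb_L2[of d N, OF d]
  by (auto intro!: exI[of _ F] exI[of _ c] simp: l2norm_def)

lemma corresponds_generator: "corresponds (b t) (d t)"
proof -
  have "lin_comb b {t} (\<lambda>_. 1) = b t" "lin_comb d {t} (\<lambda>_. 1) = d t" by (auto simp: lin_comb_def)
  then show ?thesis using corresponds_lin_comb[of "{t}" "\<lambda>_. 1"] by simp
qed

lemma corresponds_add:
  assumes "corresponds \<phi> \<xi>" "corresponds \<phi>' \<xi>'"
  shows "corresponds (\<lambda>u. \<phi> u + \<phi>' u) (\<lambda>u. \<xi> u + \<xi>' u)"
  unfolding corresponds_def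
proof (intro conjI allI impI)
  note L = corresponds_L2[OF assms(1)] corresponds_L2[OF assms(2)]
  show "(\<lambda>u. \<phi> u + \<phi>' u) \<in> L2_space M" "(\<lambda>u. \<xi> u + \<xi>' u) \<in> L2_space N" using L by auto
  fix e :: real assume e: "0 < e"
  obtain F c where F: "finite F" "l2norm M (\<lambda>u. \<phi> u - lin_comb b F c u) < e/2" "l2norm N (\<lambda>u. \<xi> u - lin_comb d F c u) < e/2"
    using correspondsE[OF assms(1), of "e/2"] e by auto
  obtain G a where G: "finite G" "l2norm M (\<lambda>u. \<phi>' u - lin_comb b G a u) < e/2" "l2norm N (\<lambda>u. \<xi>' u - lin_comb d G a u) < e/2"
    using correspondsE[OF assms(2), of "e/2"] e by auto
  let ?c = "\<lambda>s. (if s \<in> F then c s else 0) + (if s \<in> G then a s else 0)"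
  have eq1: "\<phi> u + \<phi>' u - lin_comb b (F \<union> G) ?c u = (\<phi> u - lin_comb b F c u) + (\<phi>' u - lin_comb b G a u)" for u
    unfolding lin_comb_add[OF F(1) G(1), of b c u a, symmetric] by simp
  have 1: "l2norm M (\<lambda>u. \<phi> u + \<phi>' u - lin_comb b (F \<union> G) ?c u) < e"
    unfolding eq1 using l2norm_triangle[OF L2_diff[OF L(1) lin_comb_L2[of b M F c, OF b]] L2_diff[OF L(3) lin_comb_L2[of b M G a, OF b]]] F G by linarith
  have eq2: "\<xi> u + \<xi>' u - lin_comb d (F \<union> G) ?c u = (\<xi> u - lin_comb d F c u) + (\<xi>' u - lin_comb d G a u)" for u
    unfolding lin_comb_add[OF F(1) G(1), of d c u a, symmetric] by simp
  have 2: "l2norm N (\<lambda>u. \<xi> u + \<xi>' u - lin_comb d (F \<union> G) ?c u) < e"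
    unfolding eq2 using l2norm_triangle[OF L2_diff[OF L(2) lin_comb_L2[of d N F c, OF d]] L2_diff[OF L(4) lin_comb_L2[of d N G a, OF d]]] F G by linarith
  show "\<exists>F c. finite F \<and> l2norm M (\<lambda>u. \<phi> u + \<phi>' u - lin_comb b F c u) < e \<and> l2norm N (\<lambda>u. \<xi> u + \<xi>' u - lin_comb d F c u) < e"
    using 1 2 F(1) G(1) by (intro exI[of _ "F \<union> G"] exI[of _ ?c]) simp
qed

lemma corresponds_scale:
  assumes "corresponds \<phi> \<xi>" shows "corresponds (\<lambda>u. a * \<phi> u) (\<lambda>u. a * \<xi> u)"
  unfolding corresponds_def
proof (intro conjI allI impI)
  note L = corresponds_L2[OF assms(1)]
  show "(\<lambda>u. a * \<phi> u) \<in> L2_space M" "(\<lambda>u. a * \<xi> u) \<in> L2_space N" using L by auto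
  fix e :: real assume e: "0 < e"
  have p: "0 < cmod a + 1" by (simp add: add_nonneg_pos)
  obtain F c where F: "finite F" "l2norm M (\<lambda>u. \<phi> u - lin_comb b F c u) < e / (cmod a + 1)"
    "l2norm N (\<lambda>u. \<xi> u - lin_comb d F c u) < e / (cmod a + 1)"
    using correspondsE[OF assms(1), of "e / (cmod a + 1)"] e p by auto
  have le: "cmod a * x < e" if "x < e / (cmod a + 1)" "0 \<le> x" for x
  proof -
    have "cmod a * x \<le> (cmod a + 1) * x" using that by (intro mult_right_mono) auto
    also have "\<dots> < e" using that p by (simp add: field_simps)
    finally show ?thesis .
  qed
  have 1: "l2norm M (\<lambda>u. a * \<phi> u - lin_comb b F (\<lambda>s. a * c s) u) < e"
    using le[OF F(2)] unfolding lin_comb_scale[symmetric] right_diff_distrib[symmetric] l2norm_scale by simp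
  have 2: "l2norm N (\<lambda>u. a * \<xi> u - lin_comb d F (\<lambda>s. a * c s) u) < e"
    using le[OF F(3)] unfolding lin_comb_scale[symmetric] right_diff_distrib[symmetric] l2norm_scale by simp
  show "\<exists>F c. finite F \<and> l2norm M (\<lambda>u. a * \<phi> u - lin_comb b F c u) < e \<and> l2norm N (\<lambda>u. a * \<xi> u - lin_comb d F c u) < e"
    using 1 2 F(1) by blast
qed

lemma corresponds_diff:
  assumes "corresponds \<phi> \<xi>" "corresponds \<phi>' \<xi>'"
  shows "corresponds (\<lambda>u. \<phi> u - \<phi>' u) (\<lambda>u. \<xi> u - \<xi>' u)"
  using corresponds_add[OF assms(1) corresponds_scale[OF assms(2), of "-1"]] by simp

lemma corresponds_zero: "corresponds (\<lambda>u. 0) (\<lambda>u. 0)"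
  using corresponds_lin_comb[of "{}"] by (simp add: lin_comb_def[abs_def])

lemma corresponds_sum:
  assumes "finite I" "\<And>i. i \<in> I \<Longrightarrow> corresponds (\<phi> i) (\<xi> i)"
  shows "corresponds (\<lambda>u. \<Sum>i\<in>I. \<phi> i u) (\<lambda>u. \<Sum>i\<in>I. \<xi> i u)"
  using assms
proof (induction I)
  case empty
  then show ?case using corresponds_zero by simp
next
  case (insert i I)
  from corresponds_add[of "\<phi> i" "\<xi> i", OF insert.prems insert.IH]
  have "corresponds (\<lambda>u. \<phi> i u + (\<Sum>i\<in>I. \<phi> i u)) (\<lambda>u. \<xi> i u + (\<Sum>i\<in>I. \<xi> i u))"
    using insert.prems by blast
  then show ?case by (simp only: sum.insert[OF insert.hyps])
qed

lemma corresponds_norm: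
  assumes "corresponds \<phi> \<xi>" shows "l2norm M \<phi> = l2norm N \<xi>"
proof -
  note L = corresponds_L2[OF assms(1)]
  have "\<bar>l2norm M \<phi> - l2norm N \<xi>\<bar> \<le> e" if e: "0 < e" for e
  proof -
    obtain F c where F: "finite F" "l2norm M (\<lambda>u. \<phi> u - lin_comb b F c u) < e/2" "l2norm N (\<lambda>u. \<xi> u - lin_comb d F c u) < e/2"
      using correspondsE[OF assms(1), of "e/2"] e by auto
    note Lb = lin_comb_L2[of b M F c, OF b] and Ld = lin_comb_L2[of d N F c, OF d]
    show ?thesis
      using F l2norm_le_diff[OF L(1) Lb] l2norm_le_diff[OF Lb L(1)] l2norm_le_diff[OF L(2) Ld] l2norm_le_diff[OF Ld L(2)]
      unfolding l2norm_lin_comb l2norm_minus_commute[of M "lin_comb b F c" \<phi>] l2norm_minus_commute[of N "lin_comb d F c" \<xi>]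
      by linarith
  qed
  then have "\<bar>l2norm M \<phi> - l2norm N \<xi>\<bar> \<le> 0" by (rule dense_ge)
  then show ?thesis by simp
qed

lemma corresponds_inner:
  assumes "corresponds \<phi> \<xi>" "corresponds \<phi>' \<xi>'"
  shows "(\<integral>u. \<phi> u * cnj (\<phi>' u) \<partial>M) = (\<integral>u. \<xi> u * cnj (\<xi>' u) \<partial>N)"
proof -
  have re: "Re (\<integral>u. \<phi> u * cnj (\<phi>' u) \<partial>M) = Re (\<integral>u. \<xi> u * cnj (\<xi>' u) \<partial>N)"
    if "corresponds \<phi>' \<xi>'" for \<phi>' \<xi>'
    using l2norm_sq_add[OF corresponds_L2(1)[OF assms(1)] corresponds_L2(1)[OF that]]
      l2norm_sq_add[OF corresponds_L2(2)[OF assms(1)] corresponds_L2(2)[OF that]]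
      corresponds_norm[OF assms(1)] corresponds_norm[OF that] corresponds_norm[OF corresponds_add[OF assms(1) that]]
    by simp
  show ?thesis
    using re[OF assms(2)] re[OF corresponds_scale[OF assms(2), of \<i>]] unfolding inner_imaginary
    by (simp add: complex_eq_iff)
qed

lemma corresponds_approx:
  assumes L: "\<phi> \<in> L2_space M" "\<xi> \<in> L2_space N"
    and approx: "\<And>e. 0 < e \<Longrightarrow> \<exists>\<phi>' \<xi>'. corresponds \<phi>' \<xi>' \<and> l2norm M (\<lambda>u. \<phi> u - \<phi>' u) < e \<and> l2norm N (\<lambda>u. \<xi> u - \<xi>' u) < e"
  shows "corresponds \<phi> \<xi>"
  unfolding corresponds_def
proof (intro conjI allI impI L)
  fix e :: real assume e: "0 < e"
  obtain \<phi>' \<xi>' where A: "corresponds \<phi>' \<xi>'" "l2norm M (\<lambda>u. \<phi> u - \<phi>' u) < e/2" "l2norm N (\<lambda>u. \<xi> u - \<xi>' u) < e/2"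
    using approx[of "e/2"] e by auto
  obtain F c where F: "finite F" "l2norm M (\<lambda>u. \<phi>' u - lin_comb b F c u) < e/2" "l2norm N (\<lambda>u. \<xi>' u - lin_comb d F c u) < e/2"
    using correspondsE[OF A(1), of "e/2"] e by auto
  have "l2norm M (\<lambda>u. \<phi> u - lin_comb b F c u) < e"
    using l2norm_triangle_diff[OF L(1) corresponds_L2(1)[OF A(1)] lin_comb_L2[of b M F c, OF b]] A F by linarith
  moreover have "l2norm N (\<lambda>u. \<xi> u - lin_comb d F c u) < e"
    using l2norm_triangle_diff[OF L(2) corresponds_L2(2)[OF A(1)] lin_comb_L2[of d N F c, OF d]] A F by linarith
  ultimately show "\<exists>F c. finite F \<and> l2norm M (\<lambda>u. \<phi> u - lin_comb b F c u) < e \<and> l2norm N (\<lambda>u. \<xi> u - lin_comb d F c u) < e"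
    using F(1) by blast
qed

lemma corresponds_cong_AE:
  assumes c: "corresponds \<phi> \<xi>" and m: "\<phi>' \<in> borel_measurable M" "\<xi>' \<in> borel_measurable N"
    and eq: "AE u in M. \<phi>' u = \<phi> u" "AE u in N. \<xi>' u = \<xi> u"
  shows "corresponds \<phi>' \<xi>'"
proof -
  note L = corresponds_L2[OF c]
  have L': "\<phi>' \<in> L2_space M" "\<xi>' \<in> L2_space N"
    by (rule L2_dominated(1)[OF L(1) m(1)], use eq(1) in auto)
       (rule L2_dominated(1)[OF L(2) m(2)], use eq(2) in auto)
  have z: "l2norm M (\<lambda>u. \<phi>' u - \<phi> u) = 0" "l2norm N (\<lambda>u. \<xi>' u - \<xi> u) = 0"
  proof -
    have "l2norm M (\<lambda>u. \<phi>' u - \<phi> u) = l2norm M (\<lambda>u. 0)"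
      using eq by (intro l2norm_cong_AE L2_D(1) L2_diff L L' L2_zero) auto
    then show "l2norm M (\<lambda>u. \<phi>' u - \<phi> u) = 0" by (simp add: l2norm_def)
    have "l2norm N (\<lambda>u. \<xi>' u - \<xi> u) = l2norm N (\<lambda>u. 0)"
      using eq by (intro l2norm_cong_AE L2_D(1) L2_diff L L' L2_zero) auto
    then show "l2norm N (\<lambda>u. \<xi>' u - \<xi> u) = 0" by (simp add: l2norm_def)
  qed
  show ?thesis
  proof (rule corresponds_approx[OF L'])
    fix e :: real assume "0 < e"
    with c z show "\<exists>\<phi>'' \<xi>''. corresponds \<phi>'' \<xi>'' \<and> l2norm M (\<lambda>u. \<phi>' u - \<phi>'' u) < e \<and> l2norm N (\<lambda>u. \<xi>' u - \<xi>'' u) < e"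
      by (intro exI[of _ \<phi>] exI[of _ \<xi>]) simp
  qed
qed

text \<open>Images of an approximating sequence form a Cauchy sequence because the correspondence is isometric
  on linear combinations.\<close>

lemma ex_corresponds:
  assumes "\<phi> \<in> closed_lin_span M b UNIV" obtains \<xi> where "corresponds \<phi> \<xi>"
proof -
  have L: "\<phi> \<in> L2_space M" and ap: "\<And>e. 0 < e \<Longrightarrow> \<exists>F c. finite F \<and> l2norm M (\<lambda>u. \<phi> u - lin_comb b F c u) < e"
    using assms unfolding closed_lin_span_iff by auto
  have "\<exists>F c. finite F \<and> l2norm M (\<lambda>u. \<phi> u - lin_comb b F c u) < 1 / real (Suc n)" for n by (rule ap) simp
  then obtain F c where F: "\<And>n. finite (F n)" "\<And>n. l2norm M (\<lambda>u. \<phi> u - lin_comb b (F n) (c n) u) < 1 / real (Suc n)" by metis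
  define X where "X n = lin_comb b (F n) (c n)" for n
  define Z where "Z n = lin_comb d (F n) (c n)" for n
  have XL: "X n \<in> L2_space M" for n unfolding X_def by (rule lin_comb_L2[OF b])
  have ZL: "Z n \<in> L2_space N" for n unfolding Z_def by (rule lin_comb_L2[OF d])
  have XZ: "corresponds (X n) (Z n)" for n unfolding X_def Z_def by (rule corresponds_lin_comb[OF F(1)])
  have small: "\<exists>N0. \<forall>n\<ge>N0. l2norm M (\<lambda>u. \<phi> u - X n u) < e" if e: "0 < e" for e
  proof -
    obtain N0 where "1 / real (Suc N0) < e" using nat_approx_posE[OF e] by blast
    then have "l2norm M (\<lambda>u. \<phi> u - X n u) < e" if "n \<ge> N0" for n
    proof -
      have "1 / real (Suc n) \<le> 1 / real (Suc N0)" using that by (intro divide_left_mono) auto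
      then show ?thesis using F(2)[of n] \<open>1 / real (Suc N0) < e\<close> unfolding X_def by linarith
    qed
    then show ?thesis by blast
  qed
  have "\<exists>N0. \<forall>i\<ge>N0. \<forall>j\<ge>N0. l2norm N (\<lambda>u. Z i u - Z j u) < e" if e: "0 < e" for e
  proof -
    obtain N0 where N0: "\<And>n. n \<ge> N0 \<Longrightarrow> l2norm M (\<lambda>u. \<phi> u - X n u) < e/2" using small[of "e/2"] e by auto
    have "l2norm N (\<lambda>u. Z i u - Z j u) < e" if ij: "i \<ge> N0" "j \<ge> N0" for i j
      using l2norm_triangle_diff[OF XL[of i] L XL[of j]] N0[OF ij(1)] N0[OF ij(2)]
        corresponds_norm[OF corresponds_diff[OF XZ[of i] XZ[of j]]] l2norm_minus_commute[of M "X i" \<phi>] by linarith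
    then show ?thesis by blast
  qed
  from L2_complete[OF fin_N ZL this] obtain \<xi> where xi: "\<xi> \<in> L2_space N" "(\<lambda>n. l2norm N (\<lambda>u. Z n u - \<xi> u)) \<longlonglongrightarrow> 0" by blast
  have "corresponds \<phi> \<xi>"
  proof (rule corresponds_approx[OF L xi(1)])
    fix e :: real assume e: "0 < e"
    obtain N0 where N0: "\<forall>n\<ge>N0. l2norm M (\<lambda>u. \<phi> u - X n u) < e" using small[OF e] by blast
    have "\<forall>\<^sub>F n in sequentially. l2norm N (\<lambda>u. Z n u - \<xi> u) < e" by (rule order_tendstoD(2)[OF xi(2) e])
    then obtain N1 where N1: "\<forall>n\<ge>N1. l2norm N (\<lambda>u. Z n u - \<xi> u) < e" by (auto simp: eventually_sequentially)
    show "\<exists>\<phi>' \<xi>'. corresponds \<phi>' \<xi>' \<and> l2norm M (\<lambda>u. \<phi> u - \<phi>' u) < e \<and> l2norm N (\<lambda>u. \<xi> u - \<xi>' u) < e"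
      using N0 N1 XZ[of "max N0 N1"] l2norm_minus_commute[of N \<xi> "Z (max N0 N1)"]
      by (intro exI[of _ "X (max N0 N1)"] exI[of _ "Z (max N0 N1)"]) simp
  qed
  then show ?thesis by (rule that)
qed

lemma corresponds_closed_lin_span:
  assumes c: "corresponds \<phi> \<xi>" and "\<phi> \<in> closed_lin_span M b T"
  shows "\<xi> \<in> closed_lin_span N d T"
  unfolding closed_lin_span_iff
proof (intro conjI allI impI)
  show "\<xi> \<in> L2_space N" by (rule corresponds_L2(2)[OF c])
  fix e :: real assume "0 < e"
  then obtain F a where F: "finite F" "F \<subseteq> T" "l2norm M (\<lambda>u. \<phi> u - lin_comb b F a u) < e"
    using assms(2) unfolding closed_lin_span_iff by blast
  then have "l2norm N (\<lambda>u. \<xi> u - lin_comb d F a u) < e"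
    using corresponds_norm[OF corresponds_diff[OF c corresponds_lin_comb[OF F(1)]]] by simp
  with F show "\<exists>F c. finite F \<and> F \<subseteq> T \<and> l2norm N (\<lambda>u. \<xi> u - lin_comb d F c u) < e" by blast
qed

end

lemma isometric_families_sym:
  assumes "isometric_families M b N d" shows "isometric_families N d M b"
proof -
  interpret isometric_families M b N d by fact
  show ?thesis by (rule isometric_families.intro) (rule fin_N fin_M d b gram[symmetric])+
qed

lemma corresponds_sym:
  assumes if1: "isometric_families M b N d" and c: "isometric_families.corresponds M b N d \<phi> \<xi>"
  shows "isometric_families.corresponds N d M b \<xi> \<phi>"
proof -
  interpret A: isometric_families M b N d by (rule if1)
  interpret B: isometric_families N d M b by (rule isometric_families_sym[OF if1])
  show ?thesis
    unfolding B.corresponds_def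
  proof (intro conjI allI impI)
    fix e :: real assume "0 < e"
    from A.correspondsE[OF c this] show "\<exists>F c. finite F \<and> l2norm N (\<lambda>u. \<xi> u - lin_comb d F c u) < e
        \<and> l2norm M (\<lambda>u. \<phi> u - lin_comb b F c u) < e" by metis
  qed (use A.corresponds_L2[OF c] in auto)
qed

section \<open>The spectral isometry of a stationary sequence\<close>

definition character :: "int \<Rightarrow> real \<Rightarrow> complex" where
  "character s u = cis (of_int s * u)"

lemma character_fun: "character s = (\<lambda>u. cis (of_int s * u))"
  by (auto simp: character_def)

lemma tpoly_lin_comb:
  obtains F c where "finite F" "F \<subseteq> {k..}" "tpoly k P = lin_comb character F c"
proof (rule that)
  let ?F = "(\<lambda>i. k + int i) ` {..degree P}" and ?c = "\<lambda>s. coeff P (nat (s - k))"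
  show "finite ?F" "?F \<subseteq> {k..}" by auto
  have "inj_on (\<lambda>i. k + int i) {..degree P}" by (auto simp: inj_on_def)
  then show "tpoly k P = lin_comb character ?F ?c"
    by (auto simp: tpoly_sum lin_comb_def character_def sum.reindex simp del: of_int_add)
qed

lemma cnj_tpoly_lin_comb:
  obtains F c where "finite F" "F \<subseteq> {..- k}" "\<And>u. cnj (tpoly k P u) = lin_comb character F c u"
proof -
  obtain F c where F: "finite F" "F \<subseteq> {k..}" "tpoly k P = lin_comb character F c" using tpoly_lin_comb[of k P] by blast
  show ?thesis
  proof (rule that)
    show "finite (uminus ` F)" "uminus ` F \<subseteq> {..- k}" using F by auto
    have "inj_on uminus F" by (auto simp: inj_on_def)
    then show "cnj (tpoly k P u) = lin_comb character (uminus ` F) (\<lambda>s. cnj (c (- s))) u" for u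
      by (simp add: F(3) lin_comb_def character_def sum.reindex cis_cnj)
  qed
qed

lemma cnj_lin_comb_tpoly:
  assumes "finite F" "F \<subseteq> {..t}"
  obtains Q where "\<And>u. cnj (lin_comb character F c u) = tpoly (- t) Q u"
proof -
  have "\<exists>Q. \<forall>u. cnj (lin_comb character F c u) = tpoly (- t) Q u"
    using assms
  proof (induction F)
    case empty
    show ?case by (intro exI[of _ 0]) (simp add: lin_comb_def tpoly_def)
  next
    case (insert s F)
    then obtain Q where Q: "\<And>u. cnj (lin_comb character F c u) = tpoly (- t) Q u" by auto
    obtain R where R: "tpoly (- s) [:cnj (c s):] = tpoly (- t) R"
      using tpoly_lower'[of "- t" "- s"] insert.prems by auto
    have "cnj (lin_comb character (insert s F) c u) = tpoly (- t) (R + Q) u" for u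
    proof -
      have "cnj (lin_comb character (insert s F) c u) = tpoly (- s) [:cnj (c s):] u + cnj (lin_comb character F c u)"
        using insert.hyps by (simp add: lin_comb_def character_def tpoly_def cis_cnj)
      then show ?thesis unfolding R Q tpoly_add .
    qed
    then show ?case by blast
  qed
  then show ?thesis using that by blast
qed

lemma future_closure_cnj:
  assumes "\<phi> \<in> L2_closure \<mu> (range (tpoly k))"
  shows "(\<lambda>u. cnj (\<phi> u)) \<in> closed_lin_span \<mu> character {..- k}"
  unfolding closed_lin_span_iff
proof (intro conjI allI impI)
  show "(\<lambda>u. cnj (\<phi> u)) \<in> L2_space \<mu>" using L2_closure_D(1)[OF assms] by (rule L2_cnj)
  fix e :: real assume "0 < e"
  then obtain P where P: "l2norm \<mu> (\<lambda>u. \<phi> u - tpoly k P u) < e" using L2_closure_D(2)[OF assms] by blast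
  obtain F c where F: "finite F" "F \<subseteq> {..- k}" "\<And>u. cnj (tpoly k P u) = lin_comb character F c u"
    using cnj_tpoly_lin_comb[of k P] by blast
  have "cmod (cnj (\<phi> u) - lin_comb character F c u) = cmod (\<phi> u - tpoly k P u)" for u
    unfolding F(3)[symmetric] complex_cnj_diff[symmetric] complex_mod_cnj ..
  then have "l2norm \<mu> (\<lambda>u. cnj (\<phi> u) - lin_comb character F c u) < e" using P by (simp add: l2norm_def)
  with F show "\<exists>F c. finite F \<and> F \<subseteq> {..- k} \<and> l2norm \<mu> (\<lambda>u. cnj (\<phi> u) - lin_comb character F c u) < e" by blast
qed

text \<open>Split both sets along their intersection; only the common part contributes.\<close>

lemma orthogonal_random_measure_inner:
  assumes W: "orthogonal_random_measure M \<mu> W" and A: "A \<in> sets \<mu>" "A' \<in> sets \<mu>"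
  shows "(\<integral>\<omega>. W A \<omega> * cnj (W A' \<omega>) \<partial>M) = of_real (measure \<mu> (A \<inter> A'))"
proof -
  have L: "W C \<in> L2_space M" and nrm: "(\<integral>\<omega>. (cmod (W C \<omega>))\<^sup>2 \<partial>M) = measure \<mu> C" if "C \<in> sets \<mu>" for C
    using W that by (auto simp: orthogonal_random_measure_def)
  have add: "AE \<omega> in M. W (C \<union> D) \<omega> = W C \<omega> + W D \<omega>" and orth: "(\<integral>\<omega>. W C \<omega> * cnj (W D \<omega>) \<partial>M) = 0"
    if "C \<in> sets \<mu>" "D \<in> sets \<mu>" "C \<inter> D = {}" for C D
    using W that by (auto simp: orthogonal_random_measure_def)
  let ?C = "A \<inter> A'" and ?D = "A - A'" and ?D' = "A' - A"
  have s: "?C \<in> sets \<mu>" "?D \<in> sets \<mu>" "?D' \<in> sets \<mu>" using A by auto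
  have u: "?C \<union> ?D = A" "?C \<union> ?D' = A'" by auto
  have aA: "AE \<omega> in M. W A \<omega> = W ?C \<omega> + W ?D \<omega>" using add[OF s(1,2)] u(1) by auto
  have aA': "AE \<omega> in M. W A' \<omega> = W ?C \<omega> + W ?D' \<omega>" using add[OF s(1,3)] u(2) by auto
  note LL = L[OF s(1)] L[OF s(2)] L[OF s(3)]
  note I = L2_inner_integrable[OF LL(1) LL(1)] L2_inner_integrable[OF LL(1) LL(3)]
    L2_inner_integrable[OF LL(2) LL(1)] L2_inner_integrable[OF LL(2) LL(3)]
  have "(\<integral>\<omega>. W A \<omega> * cnj (W A' \<omega>) \<partial>M) = (\<integral>\<omega>. (W ?C \<omega> * cnj (W ?C \<omega>) + W ?C \<omega> * cnj (W ?D' \<omega>))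
      + (W ?D \<omega> * cnj (W ?C \<omega>) + W ?D \<omega> * cnj (W ?D' \<omega>)) \<partial>M)"
  proof (rule integral_cong_AE)
    show "(\<lambda>\<omega>. W A \<omega> * cnj (W A' \<omega>)) \<in> borel_measurable M"
      using borel_measurable_integrable[OF L2_inner_integrable[OF L[OF A(1)] L[OF A(2)]]] .
    show "(\<lambda>\<omega>. (W ?C \<omega> * cnj (W ?C \<omega>) + W ?C \<omega> * cnj (W ?D' \<omega>))
      + (W ?D \<omega> * cnj (W ?C \<omega>) + W ?D \<omega> * cnj (W ?D' \<omega>))) \<in> borel_measurable M"
      using I[THEN borel_measurable_integrable] by (intro borel_measurable_add)
    show "AE \<omega> in M. W A \<omega> * cnj (W A' \<omega>) = (W ?C \<omega> * cnj (W ?C \<omega>) + W ?C \<omega> * cnj (W ?D' \<omega>))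
      + (W ?D \<omega> * cnj (W ?C \<omega>) + W ?D \<omega> * cnj (W ?D' \<omega>))"
      using aA aA' by eventually_elim (simp add: algebra_simps)
  qed
  also have "\<dots> = (\<integral>\<omega>. W ?C \<omega> * cnj (W ?C \<omega>) \<partial>M)"
  proof -
    have z: "(\<integral>\<omega>. W ?C \<omega> * cnj (W ?D' \<omega>) \<partial>M) = 0" "(\<integral>\<omega>. W ?D \<omega> * cnj (W ?C \<omega>) \<partial>M) = 0"
      "(\<integral>\<omega>. W ?D \<omega> * cnj (W ?D' \<omega>) \<partial>M) = 0"
      by (rule orth; use A in auto)+
    show ?thesis
      by (simp only: Bochner_Integration.integral_add[OF Bochner_Integration.integrable_add[OF I(1,2)] Bochner_Integration.integrable_add[OF I(3,4)]]
          Bochner_Integration.integral_add[OF I(1,2)] Bochner_Integration.integral_add[OF I(3,4)] z add_0_right)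
  qed
  also have "\<dots> = of_real (measure \<mu> ?C)" unfolding inner_self l2norm_sq nrm[OF s(1)] ..
  finally show ?thesis .
qed

locale spectral_representation =
  fixes M :: "'a measure" and B :: "int \<Rightarrow> 'a \<Rightarrow> complex" and \<mu> :: "real measure"
  assumes prob: "prob_space M" and wss: "wide_sense_stationary M B" and spec: "spectral_measure M B \<mu>"
begin

lemma finite_mu: "finite_measure \<mu>" and sets_mu: "sets \<mu> = sets lebesgue_pi"
  using spec by (auto simp: spectral_measure_def)

lemma space_mu: "space \<mu> = {-pi..<pi}"
  using sets_eq_imp_space_eq[OF sets_mu] by simp

lemma character_L2: "character s \<in> L2_space \<mu>"
  unfolding character_fun using trig_L2[OF finite_mu sets_mu] trig_cis by blast

sublocale isometric_families \<mu> character M B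
proof (rule isometric_families.intro)
  show "finite_measure \<mu>" by (rule finite_mu)
  show "finite_measure M" using prob by (simp add: prob_space_def)
  show "character s \<in> L2_space \<mu>" for s by (rule character_L2)
  show "B s \<in> L2_space M" for s using wss by (auto simp: wide_sense_stationary_def)
  fix s t
  have "(\<integral>u. character s u * cnj (character t u) \<partial>\<mu>) = (\<integral>u. cis (of_int (s - t) * u) \<partial>\<mu>)"
    by (simp add: character_def cis_cnj cis_mult left_diff_distrib)
  also have "\<dots> = autocov M B (s - t)" using spec by (auto simp: spectral_measure_def)
  also have "\<dots> = (\<integral>\<omega>. B ((s - t) + 0) \<omega> * cnj (B 0 \<omega>) \<partial>M)" by (simp add: autocov_def)
  also have "\<dots> = (\<integral>\<omega>. B ((s - t) + t) \<omega> * cnj (B t \<omega>) \<partial>M)"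
    using wss unfolding wide_sense_stationary_def by blast
  finally show "(\<integral>u. character s u * cnj (character t u) \<partial>\<mu>) = (\<integral>\<omega>. B s \<omega> * cnj (B t \<omega>) \<partial>M)" by simp
qed

lemma L2_in_span: 
  assumes "\<phi> \<in> L2_space \<mu>" shows "\<phi> \<in> closed_lin_span \<mu> character UNIV"
  unfolding closed_lin_span_iff
proof (intro conjI allI impI assms)
  fix e :: real assume "0 < e"
  then obtain t where t: "t \<in> trig_polys" "l2norm \<mu> (\<lambda>u. \<phi> u - t u) < e"
    using L2_closure_D(2)[OF trig_polys_dense[OF finite_mu sets_mu assms]] by blast
  obtain k P where "t = tpoly k P" using t(1) by (rule trig_polysE)
  moreover obtain F c where "finite F" "F \<subseteq> {k..}" "tpoly k P = lin_comb character F c" using tpoly_lin_comb[of k P] by blast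
  ultimately show "\<exists>F c. finite F \<and> F \<subseteq> UNIV \<and> l2norm \<mu> (\<lambda>u. \<phi> u - lin_comb character F c u) < e"
    using t(2) by (intro exI[of _ F] exI[of _ c]) simp
qed

lemma ex_integral: 
  assumes "\<phi> \<in> L2_space \<mu>" obtains \<xi> where "corresponds \<phi> \<xi>"
  using L2_in_span[OF assms] by (rule ex_corresponds)

lemma indicator_L2: "A \<in> sets \<mu> \<Longrightarrow> indicator A \<in> L2_space \<mu>"
  by (rule L2_bounded[OF finite_mu, where C=1]) (auto simp: indicator_def)

lemma inner_indicator:
  assumes "A \<in> sets \<mu>" "A' \<in> sets \<mu>"
  shows "(\<integral>u. indicator A u * cnj (indicator A' u) \<partial>\<mu>) = of_real (measure \<mu> (A \<inter> A'))"
proof -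
  interpret finite_measure \<mu> by (rule finite_mu)
  have "indicator A u * cnj (indicator A' u) = complex_of_real (indicator (A \<inter> A') u)" for u
    by (simp add: indicator_def)
  moreover have "A \<inter> A' \<inter> space \<mu> = A \<inter> A'" using assms sets.sets_into_space by blast
  ultimately show ?thesis by simp
qed

lemma corresponds_simple:
  assumes W: "\<And>A. A \<in> sets \<mu> \<Longrightarrow> corresponds (indicator A) (W A)" and g: "simple_function \<mu> g"
  shows "corresponds g (simple_stoch_int \<mu> W g)"
proof -
  have "corresponds (\<lambda>u. \<Sum>y\<in>g ` space \<mu>. y * indicator (g -` {y} \<inter> space \<mu>) u)
     (\<lambda>\<omega>. \<Sum>y\<in>g ` space \<mu>. y * W (g -` {y} \<inter> space \<mu>) \<omega>)"
    using simple_functionD[OF g] by (intro corresponds_sum corresponds_scale W) auto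
  then have c: "corresponds (\<lambda>u. \<Sum>y\<in>g ` space \<mu>. y * indicator (g -` {y} \<inter> space \<mu>) u) (simple_stoch_int \<mu> W g)"
    unfolding simple_stoch_int_def[abs_def] .
  show ?thesis
    by (rule corresponds_cong_AE[OF c borel_measurable_simple_function[OF g] L2_D(1)[OF corresponds_L2(2)[OF c]]])
       (auto intro!: AE_I2 simple_function_decomp[OF g])
qed

text \<open>Once the indicator of each \<open>A\<close> corresponds to \<open>W A\<close>, the stochastic
  integral is the spectral isometry: they agree on simple functions, and these are dense.\<close>

lemma has_stoch_int_iff:
  assumes W: "\<And>A. A \<in> sets \<mu> \<Longrightarrow> corresponds (indicator A) (W A)"
  shows "has_stoch_int M \<mu> W \<phi> \<xi> \<longleftrightarrow> corresponds \<phi> \<xi>"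
proof
  assume h: "has_stoch_int M \<mu> W \<phi> \<xi>"
  then obtain g where L: "\<phi> \<in> L2_space \<mu>" "\<xi> \<in> L2_space M" and g: "\<And>n. simple_function \<mu> (g n)"
    and lim: "(\<lambda>n. (l2norm \<mu> (\<lambda>u. \<phi> u - g n u))\<^sup>2) \<longlonglongrightarrow> 0"
      "(\<lambda>n. (l2norm M (\<lambda>u. \<xi> u - simple_stoch_int \<mu> W (g n) u))\<^sup>2) \<longlonglongrightarrow> 0"
    unfolding has_stoch_int_def sq_dist_l2norm by blast
  show "corresponds \<phi> \<xi>"
  proof (rule corresponds_approx[OF L])
    fix e :: real assume e: "0 < e"
    have "\<forall>\<^sub>F n in sequentially. (l2norm \<mu> (\<lambda>u. \<phi> u - g n u))\<^sup>2 < e\<^sup>2 \<and> (l2norm M (\<lambda>u. \<xi> u - simple_stoch_int \<mu> W (g n) u))\<^sup>2 < e\<^sup>2"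
      using e by (intro eventually_conj order_tendstoD(2)[OF lim(1)] order_tendstoD(2)[OF lim(2)]) auto
    then obtain n where n: "(l2norm \<mu> (\<lambda>u. \<phi> u - g n u))\<^sup>2 < e\<^sup>2" "(l2norm M (\<lambda>u. \<xi> u - simple_stoch_int \<mu> W (g n) u))\<^sup>2 < e\<^sup>2"
      by (auto simp: eventually_sequentially)
    have "l2norm \<mu> (\<lambda>u. \<phi> u - g n u) < e" "l2norm M (\<lambda>u. \<xi> u - simple_stoch_int \<mu> W (g n) u) < e"
      using power_less_imp_less_base[OF n(1)] power_less_imp_less_base[OF n(2)] e by auto
    then show "\<exists>\<phi>' \<xi>'. corresponds \<phi>' \<xi>' \<and> l2norm \<mu> (\<lambda>u. \<phi> u - \<phi>' u) < e \<and> l2norm M (\<lambda>u. \<xi> u - \<xi>' u) < e"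
      using corresponds_simple[OF W g[of n]] by blast
  qed
next
  assume c: "corresponds \<phi> \<xi>"
  note L = corresponds_L2[OF c]
  obtain g where g: "\<And>n. simple_function \<mu> (g n)" and lim: "(\<lambda>n. l2norm \<mu> (\<lambda>u. g n u - \<phi> u)) \<longlonglongrightarrow> 0"
    using L2_simple_approx[OF L(1)] by blast
  have eq: "l2norm M (\<lambda>u. \<xi> u - simple_stoch_int \<mu> W (g n) u) = l2norm \<mu> (\<lambda>u. \<phi> u - g n u)" for n
    using corresponds_norm[OF corresponds_diff[OF c corresponds_simple[OF W g[of n]]]] by simp
  have "(\<lambda>n. (l2norm \<mu> (\<lambda>u. \<phi> u - g n u))\<^sup>2) \<longlonglongrightarrow> 0\<^sup>2"
    by (intro tendsto_power) (use lim in \<open>subst l2norm_minus_commute\<close>)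
  then show "has_stoch_int M \<mu> W \<phi> \<xi>"
    unfolding has_stoch_int_def sq_dist_l2norm using L g eq by (intro conjI exI[of _ g]) auto
qed

text \<open>A process that represents \<open>B\<close> is determined almost surely, whichever one the choice
  operator selects. Its values have the right inner products with the \<open>B t\<close>, hence with the
  element \<open>\<xi>\<close> that corresponds to the indicator of \<open>A\<close>; as \<open>W A\<close>
  and \<open>\<xi>\<close> have the same norm, they coincide.\<close>

lemma valid_process_corresponds:
  assumes W: "orthogonal_random_measure M \<mu> W"
    and rep: "\<And>t. has_stoch_int M \<mu> W (\<lambda>u. cis (of_int t * u)) (B t)"
    and A: "A \<in> sets \<mu>"
  shows "corresponds (indicator A) (W A)"
proof -
  have WL: "W C \<in> L2_space M" if "C \<in> sets \<mu>" for C
    using W that by (auto simp: orthogonal_random_measure_def)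
  note AL = indicator_L2[OF A]
  have simple: "(\<integral>\<omega>. W A \<omega> * cnj (simple_stoch_int \<mu> W g \<omega>) \<partial>M) = (\<integral>u. indicator A u * cnj (g u) \<partial>\<mu>)"
    if g: "simple_function \<mu> g" for g
  proof -
    let ?C = "\<lambda>y. g -` {y} \<inter> space \<mu>"
    have s: "?C y \<in> sets \<mu>" for y using simple_functionD(2)[OF g] by blast
    have "(\<integral>\<omega>. W A \<omega> * cnj (simple_stoch_int \<mu> W g \<omega>) \<partial>M) = (\<Sum>y\<in>g ` space \<mu>. cnj y * of_real (measure \<mu> (A \<inter> ?C y)))"
      unfolding simple_stoch_int_def
      by (simp only: inner_sum_right[OF WL[OF A] WL[OF s]] orthogonal_random_measure_inner[OF W A s])
    also have "\<dots> = (\<integral>u. indicator A u * cnj (\<Sum>y\<in>g ` space \<mu>. y * indicator (?C y) u) \<partial>\<mu>)"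
      by (simp only: inner_sum_right[OF AL indicator_L2[OF s]] inner_indicator[OF A s])
    also have "\<dots> = (\<integral>u. indicator A u * cnj (g u) \<partial>\<mu>)"
    proof (rule Bochner_Integration.integral_cong[OF refl])
      fix u assume u: "u \<in> space \<mu>"
      show "indicator A u * cnj (\<Sum>y\<in>g ` space \<mu>. y * indicator (?C y) u) = indicator A u * cnj (g u)"
        unfolding simple_function_decomp[OF g u, symmetric] ..
    qed
    finally show ?thesis .
  qed
  have gen: "(\<integral>\<omega>. W A \<omega> * cnj (B t \<omega>) \<partial>M) = (\<integral>u. indicator A u * cnj (character t u) \<partial>\<mu>)" for t
  proof -
    obtain g where g: "\<And>n. simple_function \<mu> (g n)"
      and lim: "(\<lambda>n. (l2norm \<mu> (\<lambda>u. character t u - g n u))\<^sup>2) \<longlonglongrightarrow> 0"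
        "(\<lambda>n. (l2norm M (\<lambda>u. B t u - simple_stoch_int \<mu> W (g n) u))\<^sup>2) \<longlonglongrightarrow> 0"
      using rep[of t] unfolding has_stoch_int_def sq_dist_l2norm character_fun by blast
    have sL: "simple_stoch_int \<mu> W (g n) \<in> L2_space M" for n
      unfolding simple_stoch_int_def[abs_def]
      by (intro L2_sum L2_scale WL simple_functionD(2)[OF g])
    have gL: "g n \<in> L2_space \<mu>" for n
    proof -
      have "bounded (g n ` space \<mu>)" by (intro finite_imp_bounded simple_functionD(1) g)
      then obtain C where "\<And>u. u \<in> space \<mu> \<Longrightarrow> cmod (g n u) \<le> C" unfolding bounded_iff by auto
      then show ?thesis by (rule L2_bounded[OF finite_mu borel_measurable_simple_function[OF g]])
    qed
    have l1: "(\<lambda>n. l2norm \<mu> (\<lambda>u. g n u - character t u)) \<longlonglongrightarrow> 0"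
      using tendsto_real_sqrt[OF lim(1)] by (subst l2norm_minus_commute) simp
    have l2: "(\<lambda>n. l2norm M (\<lambda>u. simple_stoch_int \<mu> W (g n) u - B t u)) \<longlonglongrightarrow> 0"
      using tendsto_real_sqrt[OF lim(2)] by (subst l2norm_minus_commute) simp
    have "(\<lambda>n. \<integral>u. indicator A u * cnj (g n u) \<partial>\<mu>) \<longlonglongrightarrow> (\<integral>\<omega>. W A \<omega> * cnj (B t \<omega>) \<partial>M)"
      using inner_tendsto[OF WL[OF A] sL d l2] unfolding simple[OF g] .
    then show ?thesis
      using inner_tendsto[OF AL gL b l1] LIMSEQ_unique by blast
  qed
  obtain \<xi> where xi: "corresponds (indicator A) \<xi>" using ex_integral[OF AL] by blast
  have "(\<integral>\<omega>. W A \<omega> * cnj (\<xi> \<omega>) \<partial>M) = of_real (measure \<mu> A)"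
  proof -
    have "\<exists>F c. finite F \<and> l2norm \<mu> (\<lambda>u. indicator A u - lin_comb character F c u) < 1 / real (Suc n)
        \<and> l2norm M (\<lambda>u. \<xi> u - lin_comb B F c u) < 1 / real (Suc n)" for n
      using correspondsE[OF xi, of "1 / real (Suc n)"] by (metis of_nat_0_less_iff zero_less_Suc zero_less_divide_1_iff)
    then obtain F c where F: "\<And>n. l2norm \<mu> (\<lambda>u. indicator A u - lin_comb character (F n) (c n) u) < 1 / real (Suc n)"
      "\<And>n. l2norm M (\<lambda>u. \<xi> u - lin_comb B (F n) (c n) u) < 1 / real (Suc n)" by metis
    have inv: "(\<lambda>n. 1 / real (Suc n)) \<longlonglongrightarrow> 0" using LIMSEQ_inverse_real_of_nat by (simp add: inverse_eq_divide)
    have l1: "(\<lambda>n. l2norm \<mu> (\<lambda>u. lin_comb character (F n) (c n) u - indicator A u)) \<longlonglongrightarrow> 0"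
      by (rule tendsto_sandwich[OF _ _ tendsto_const inv], simp, subst l2norm_minus_commute)
         (intro always_eventually allI less_imp_le F(1))
    have l2: "(\<lambda>n. l2norm M (\<lambda>u. lin_comb B (F n) (c n) u - \<xi> u)) \<longlonglongrightarrow> 0"
      by (rule tendsto_sandwich[OF _ _ tendsto_const inv], simp, subst l2norm_minus_commute)
         (intro always_eventually allI less_imp_le F(2))
    have "(\<integral>\<omega>. W A \<omega> * cnj (lin_comb B (F n) (c n) \<omega>) \<partial>M) = (\<integral>u. indicator A u * cnj (lin_comb character (F n) (c n) u) \<partial>\<mu>)" for n
      unfolding lin_comb_def by (simp only: inner_sum_right[OF WL[OF A] d] inner_sum_right[OF AL b] gen)
    then have "(\<lambda>n. \<integral>u. indicator A u * cnj (lin_comb character (F n) (c n) u) \<partial>\<mu>) \<longlonglongrightarrow> (\<integral>\<omega>. W A \<omega> * cnj (\<xi> \<omega>) \<partial>M)"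
      using inner_tendsto[OF WL[OF A] lin_comb_L2[OF d] corresponds_L2(2)[OF xi] l2] by simp
    moreover have "(\<lambda>n. \<integral>u. indicator A u * cnj (lin_comb character (F n) (c n) u) \<partial>\<mu>) \<longlonglongrightarrow> (\<integral>u. indicator A u * cnj (indicator A u) \<partial>\<mu>)"
      by (rule inner_tendsto[OF AL lin_comb_L2[OF b] AL l1])
    ultimately have "(\<integral>\<omega>. W A \<omega> * cnj (\<xi> \<omega>) \<partial>M) = (\<integral>u. indicator A u * cnj (indicator A u) \<partial>\<mu>)"
      using LIMSEQ_unique by blast
    then show ?thesis unfolding inner_indicator[OF A A] by simp
  qed
  note inner = this
  have n1: "(l2norm M (W A))\<^sup>2 = measure \<mu> A"
    using W A by (auto simp: orthogonal_random_measure_def l2norm_sq)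
  have n2: "(l2norm M \<xi>)\<^sup>2 = measure \<mu> A"
  proof -
    have "of_real ((l2norm M \<xi>)\<^sup>2) = (of_real (measure \<mu> (A \<inter> A)) :: complex)"
      using inner_indicator[OF A A] corresponds_norm[OF xi] unfolding inner_self[of \<mu> "indicator A"] by simp
    then show ?thesis unfolding of_real_eq_iff by simp
  qed
  have neg: "(\<integral>\<omega>. W A \<omega> * cnj (- \<xi> \<omega>) \<partial>M) = - of_real (measure \<mu> A)" using inner by simp
  have "(l2norm M (\<lambda>\<omega>. W A \<omega> + - \<xi> \<omega>))\<^sup>2 = 0"
    unfolding l2norm_sq_add[OF WL[OF A] L2_uminus[OF corresponds_L2(2)[OF xi]]] neg n1
    using n2 by (simp add: l2norm_def)
  then have "l2norm M (\<lambda>\<omega>. W A \<omega> - \<xi> \<omega>) = 0" by simp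
  from l2norm_eq_0_AE[OF L2_diff[OF WL[OF A] corresponds_L2(2)[OF xi]] this]
  have "AE \<omega> in M. W A \<omega> = \<xi> \<omega>" by eventually_elim simp
  then show ?thesis
    by (intro corresponds_cong_AE[OF xi L2_D(1)[OF AL] L2_D(1)[OF WL[OF A]]]) auto
qed

text \<open>Take for \<open>W A\<close> the image of the indicator of \<open>A\<close> under the spectral
  isometry.\<close>

lemma ex_spectral_process:
  "\<exists>W. orthogonal_random_measure M \<mu> W \<and> (\<forall>t. has_stoch_int M \<mu> W (\<lambda>u. cis (of_int t * u)) (B t))"
proof -
  define W where "W A = (SOME \<xi>. corresponds (indicator A) \<xi>)" for A
  have W: "corresponds (indicator A) (W A)" if "A \<in> sets \<mu>" for A
    using ex_integral[OF indicator_L2[OF that]] unfolding W_def by (metis someI)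
  have WL: "W A \<in> L2_space M" if "A \<in> sets \<mu>" for A by (rule corresponds_L2(2)[OF W[OF that]])
  have inner: "(\<integral>\<omega>. W A \<omega> * cnj (W A' \<omega>) \<partial>M) = of_real (measure \<mu> (A \<inter> A'))"
    if "A \<in> sets \<mu>" "A' \<in> sets \<mu>" for A A'
    using corresponds_inner[OF W W] inner_indicator that by metis
  have nrm: "(\<integral>\<omega>. (cmod (W A \<omega>))\<^sup>2 \<partial>M) = measure \<mu> A" if A: "A \<in> sets \<mu>" for A
    using inner[OF A A] unfolding inner_self l2norm_sq of_real_eq_iff by simp
  have add: "AE \<omega> in M. W (A \<union> A') \<omega> = W A \<omega> + W A' \<omega>"
    if A: "A \<in> sets \<mu>" "A' \<in> sets \<mu>" "A \<inter> A' = {}" for A A'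
  proof -
    have Un: "A \<union> A' \<in> sets \<mu>" using A by auto
    note c = corresponds_diff[OF W[OF Un] corresponds_add[OF W[OF A(1)] W[OF A(2)]]]
    have "indicator (A \<union> A') u - (indicator A u + indicator A' u) = (0 :: complex)" for u
      using A(3) by (auto simp: indicator_def)
    then have "l2norm M (\<lambda>\<omega>. W (A \<union> A') \<omega> - (W A \<omega> + W A' \<omega>)) = 0"
      using corresponds_norm[OF c] by (simp add: l2norm_def)
    from l2norm_eq_0_AE[OF corresponds_L2(2)[OF c] this] show ?thesis by eventually_elim simp
  qed
  have "orthogonal_random_measure M \<mu> W"
    unfolding orthogonal_random_measure_def using WL nrm add inner by simp
  moreover have "has_stoch_int M \<mu> W (\<lambda>u. cis (of_int t * u)) (B t)" for t
    unfolding character_fun[symmetric]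
    by (subst has_stoch_int_iff, erule W, rule corresponds_generator)
  ultimately show ?thesis by blast
qed

theorem has_stoch_int_spectral_process:
  "has_stoch_int M \<mu> (spectral_process M B \<mu>) \<phi> \<xi> \<longleftrightarrow> corresponds \<phi> \<xi>"
proof (rule has_stoch_int_iff)
  have "orthogonal_random_measure M \<mu> (spectral_process M B \<mu>) \<and>
    (\<forall>t. has_stoch_int M \<mu> (spectral_process M B \<mu>) (\<lambda>u. cis (of_int t * u)) (B t))"
    unfolding spectral_process_def by (rule someI_ex[OF ex_spectral_process])
  then show "A \<in> sets \<mu> \<Longrightarrow> corresponds (indicator A) (spectral_process M B \<mu> A)" for A
    using valid_process_corresponds by blast
qed

lemma stoch_int_corresponds:
  assumes "\<phi> \<in> L2_space \<mu>"
  shows "corresponds \<phi> (stoch_int M \<mu> (spectral_process M B \<mu>) \<phi>)"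
  using ex_integral[OF assms] unfolding stoch_int_def has_stoch_int_spectral_process by (metis someI)

lemma spectral_rep_corresponds:
  assumes "\<xi> \<in> closed_lin_span M B UNIV"
  shows "corresponds (spectral_rep M B \<mu> \<xi>) \<xi>"
proof -
  have iso: "isometric_families \<mu> character M B" ..
  obtain \<phi> where "isometric_families.corresponds M B \<mu> character \<xi> \<phi>"
    using isometric_families.ex_corresponds[OF isometric_families_sym[OF iso] assms] .
  from corresponds_sym[OF isometric_families_sym[OF iso] this] have "corresponds \<phi> \<xi>" .
  then show ?thesis unfolding spectral_rep_def has_stoch_int_spectral_process
    by (rule someI[where P="\<lambda>\<phi>. corresponds \<phi> \<xi>"])
qed

lemma closed_lin_span_corresponds_iff:
  assumes "corresponds \<phi> \<xi>"
  shows "\<xi> \<in> closed_lin_span M B T \<longleftrightarrow> \<phi> \<in> closed_lin_span \<mu> character T"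
proof
  have iso: "isometric_families \<mu> character M B" ..
  assume "\<xi> \<in> closed_lin_span M B T"
  then show "\<phi> \<in> closed_lin_span \<mu> character T"
    by (rule isometric_families.corresponds_closed_lin_span[OF isometric_families_sym[OF iso] corresponds_sym[OF iso assms]])
qed (rule corresponds_closed_lin_span[OF assms])

end

section \<open>The limit of the prediction errors\<close>

text \<open>Completing the square: the cost is \<open>(1 + \<bar>w\<bar>\<^sup>2) \<bar>z - h\<bar>\<^sup>2 +
  (1 - h)\<close>.\<close>

lemma filter_cost_pointwise:
  fixes w z :: complex
  defines "h \<equiv> 1 / (1 + (cmod w)\<^sup>2)"
  shows "1 - h \<le> (cmod (z - 1))\<^sup>2 + (cmod (w * z))\<^sup>2"
    "(cmod (of_real h - 1))\<^sup>2 + (cmod (w * of_real h))\<^sup>2 = 1 - h" "0 < h" "h \<le> 1"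
proof -
  let ?a = "(cmod w)\<^sup>2"
  have p: "0 < 1 + ?a" by (simp add: add_pos_nonneg)
  then show h: "0 < h" "h \<le> 1" by (simp_all add: h_def)
  have ha: "h * (1 + ?a) = 1" using p by (simp add: h_def)
  have z: "(cmod (z - 1))\<^sup>2 + (cmod (w * z))\<^sup>2 = (1 + ?a) * (cmod (z - of_real h))\<^sup>2 + (1 - h)" for z
  proof -
    have "(cmod (z - 1))\<^sup>2 + (cmod (w * z))\<^sup>2 = (1 + ?a) * (cmod z)\<^sup>2 - 2 * Re z + 1"
      unfolding norm_mult power_mult_distrib cmod_power2[of z] cmod_power2[of "z - 1"]
      by (simp add: power2_eq_square algebra_simps)
    moreover have "(1 + ?a) * (cmod (z - of_real h))\<^sup>2 = (1 + ?a) * (cmod z)\<^sup>2 - 2 * (h * (1 + ?a)) * Re z + h * (h * (1 + ?a))"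
      unfolding cmod_power2[of z] cmod_power2[of "z - of_real h"]
      by (simp add: power2_eq_square algebra_simps)
    ultimately show ?thesis unfolding ha by simp
  qed
  have "0 \<le> (1 + ?a) * (cmod (z - of_real h))\<^sup>2" using p by simp
  then show "1 - h \<le> (cmod (z - 1))\<^sup>2 + (cmod (w * z))\<^sup>2" unfolding z by simp
  show "(cmod (of_real h - 1))\<^sup>2 + (cmod (w * of_real h))\<^sup>2 = 1 - h" unfolding z[of "of_real h"] by simp
qed

lemma lebesgue_decomposition_carrier:
  assumes "lebesgue_decomposition \<mu> \<mu>\<^sub>a \<mu>\<^sub>s"
  obtains N where "N \<in> null_sets lebesgue_pi" "N \<in> sets \<mu>" "emeasure \<mu>\<^sub>a N = 0"
    "density \<mu> (indicator (- N)) = \<mu>\<^sub>a" "density \<mu> (indicator N) = \<mu>\<^sub>s"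
proof -
  note dec = assms[unfolded lebesgue_decomposition_def]
  have sets_a: "sets \<mu>\<^sub>a = sets \<mu>" and sets_s: "sets \<mu>\<^sub>s = sets \<mu>"
    and sum: "\<And>A. A \<in> sets \<mu> \<Longrightarrow> emeasure \<mu> A = emeasure \<mu>\<^sub>a A + emeasure \<mu>\<^sub>s A"
    using dec by auto
  obtain N where N: "N \<in> null_sets lebesgue_pi" and Ns: "emeasure \<mu>\<^sub>s (space \<mu> - N) = 0"
    using dec by blast
  have N_a: "emeasure \<mu>\<^sub>a N = 0"
    and N_sets: "N \<in> sets \<mu>"
    using dec N unfolding absolutely_continuous_def by (auto dest!: subsetD)
  have sub: "A \<subseteq> space \<mu>" if "A \<in> sets \<mu>" for A using sets.sets_into_space[OF that] .
  have s_off: "emeasure \<mu>\<^sub>s (A - N) = 0" if "A \<in> sets \<mu>" for A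
  proof -
    have "emeasure \<mu>\<^sub>s (A - N) \<le> emeasure \<mu>\<^sub>s (space \<mu> - N)"
      using sub[OF that] N_sets sets_s by (intro emeasure_mono) auto
    then show ?thesis using Ns by simp
  qed
  (* Absolute continuity makes the carrier N negligible for the absolutely continuous part. *)
  have a_on: "emeasure \<mu>\<^sub>a (A \<inter> N) = 0" if "A \<in> sets \<mu>" for A
  proof -
    have "emeasure \<mu>\<^sub>a (A \<inter> N) \<le> emeasure \<mu>\<^sub>a N"
      using N_sets sets_a by (intro emeasure_mono) auto
    then show ?thesis using N_a by simp
  qed
  have split: "emeasure K A = emeasure K (A \<inter> N) + emeasure K (A - N)" if "A \<in> sets K" "sets K = sets \<mu>" for K A
    using that N_sets plus_emeasure[of "A \<inter> N" K "A - N"] by (simp add: Int_Diff_Un Int_Diff_disjoint)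
  have off_N: "density \<mu> (indicator (- N)) = \<mu>\<^sub>a"
  proof (rule measure_eqI)
    fix A assume "A \<in> sets (density \<mu> (indicator (- N)))"
    then have A: "A \<in> sets \<mu>" by simp
    have ind: "(indicator (- N) :: real \<Rightarrow> ennreal) \<in> borel_measurable \<mu>"
      using borel_measurable_indicator[OF sets.compl_sets[OF N_sets], where 'b=ennreal]
      by (rule measurable_cong[THEN iffD1, rotated]) (auto simp: indicator_def)
    have "emeasure (density \<mu> (indicator (- N))) A = (\<integral>\<^sup>+u. indicator (A - N) u \<partial>\<mu>)"
      unfolding emeasure_density[OF ind A] by (intro nn_integral_cong) (auto simp: indicator_def)
    also have "\<dots> = emeasure \<mu> (A - N)" using A N_sets by simp
    also have "\<dots> = emeasure \<mu>\<^sub>a (A - N)" using sum[of "A - N"] s_off[OF A] A N_sets by simp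
    also have "\<dots> = emeasure \<mu>\<^sub>a A" using split[of A \<mu>\<^sub>a] a_on[OF A] A sets_a by simp
    finally show "emeasure (density \<mu> (indicator (- N))) A = emeasure \<mu>\<^sub>a A" .
  qed (simp add: sets_a)
  have on_N: "density \<mu> (indicator N) = \<mu>\<^sub>s"
  proof (rule measure_eqI)
    fix A assume "A \<in> sets (density \<mu> (indicator N))"
    then have A: "A \<in> sets \<mu>" by simp
    have "emeasure (density \<mu> (indicator N)) A = (\<integral>\<^sup>+u. indicator (A \<inter> N) u \<partial>\<mu>)"
      unfolding emeasure_density[OF borel_measurable_indicator[OF N_sets] A]
      by (intro nn_integral_cong) (auto simp: indicator_def)
    also have "\<dots> = emeasure \<mu> (A \<inter> N)" using A N_sets by simp
    also have "\<dots> = emeasure \<mu>\<^sub>s (A \<inter> N)" using sum[of "A \<inter> N"] a_on[OF A] A N_sets by simp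
    also have "\<dots> = emeasure \<mu>\<^sub>s A" using split[of A \<mu>\<^sub>s] s_off[OF A] A sets_s by simp
    finally show "emeasure (density \<mu> (indicator N)) A = emeasure \<mu>\<^sub>s A" .
  qed (simp add: sets_s)
  show ?thesis using N N_sets N_a off_N on_N by (rule that)
qed

theorem theorem5p6:
  fixes M :: "'a measure" and B :: "int \<Rightarrow> 'a \<Rightarrow> complex"
    and \<mu> \<mu>\<^sub>a \<mu>\<^sub>s :: "real measure" and f\<^sub>a :: "real \<Rightarrow> real" and l :: "real \<Rightarrow> complex"
  assumes "prob_space M"
    and "wide_sense_stationary M B"
    and "spectral_measure M B \<mu>"
    and "lebesgue_decomposition \<mu> \<mu>\<^sub>a \<mu>\<^sub>s"
    and "f\<^sub>a \<in> borel_measurable lebesgue_pi"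
    and "\<And>u. u \<in> {-pi..<pi} \<Longrightarrow> 0 \<le> f\<^sub>a u"
    and "\<mu>\<^sub>a = density lebesgue_pi (\<lambda>u. ennreal (f\<^sub>a u))"
    and "l \<in> borel_measurable lebesgue_pi"
    and "(\<integral>\<^sup>+u. abs_ln (f\<^sub>a u) \<partial>lebesgue_pi) < \<infinity>"
  shows "((\<lambda>t. prediction_error M B \<mu> l t) \<longlongrightarrow>
           (\<integral>\<omega>. (cmod (B 0 \<omega>))\<^sup>2 \<partial>M) - (\<integral>u. 1 / (1 + (cmod (l u))\<^sup>2) \<partial>\<mu>\<^sub>s)) at_bot"
proof -
  interpret spectral_representation M B \<mu> by (rule spectral_representation.intro[OF assms(1-3)])
  interpret mu: finite_measure \<mu> by (rule finite_mu)
  note dec = assms(4)[unfolded lebesgue_decomposition_def]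
  have sets_a: "sets \<mu>\<^sub>a = sets \<mu>"
    and sum: "\<And>A. A \<in> sets \<mu> \<Longrightarrow> emeasure \<mu> A = emeasure \<mu>\<^sub>a A + emeasure \<mu>\<^sub>s A"
    using dec by auto
  obtain N where N: "N \<in> null_sets lebesgue_pi" and N_sets: "N \<in> sets \<mu>"
    and N_a: "emeasure \<mu>\<^sub>a N = 0"
    and off_N: "density \<mu> (indicator (- N)) = density lebesgue_pi (\<lambda>u. ennreal (f\<^sub>a u))"
    and on_N: "density \<mu> (indicator N) = \<mu>\<^sub>s"
    using lebesgue_decomposition_carrier[OF assms(4)] unfolding assms(7)[symmetric] by blast
  have f_int: "integrable lebesgue_pi f\<^sub>a"
  proof (rule integrableI_bounded[OF assms(5)])
    have "(\<integral>\<^sup>+u. ennreal (norm (f\<^sub>a u)) \<partial>lebesgue_pi) = (\<integral>\<^sup>+u. ennreal (f\<^sub>a u) * indicator (space lebesgue_pi) u \<partial>lebesgue_pi)"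
      by (intro nn_integral_cong) (simp add: assms(6))
    also have "\<dots> = emeasure \<mu>\<^sub>a (space lebesgue_pi)"
      unfolding assms(7) by (rule emeasure_density[symmetric]) (use assms(5) in auto)
    also have "\<dots> \<le> emeasure \<mu> (space lebesgue_pi)"
      using sum[of "space lebesgue_pi"] sets_mu by simp
    also have "\<dots> < \<infinity>" by (simp add: mu.emeasure_finite less_top[symmetric])
    finally show "(\<integral>\<^sup>+u. ennreal (norm (f\<^sub>a u)) \<partial>lebesgue_pi) < \<infinity>" .
  qed
  interpret S: singular_set \<mu> f\<^sub>a N
    by (rule singular_set.intro[OF finite_mu sets_mu N assms(5) assms(6) f_int off_N])
  interpret R: log_integrable_density f\<^sub>a
    by (rule log_integrable_density.intro[OF assms(5) assms(6) f_int assms(9)])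
  have nu: "R.\<nu> = \<mu>\<^sub>a" by (simp add: R.\<nu>_def assms(7))
  have nu_le: "R.\<nu> \<le> \<mu>"
    using sum by (subst le_measure) (auto simp: nu sets_a le_fun_def)
  have nu_sets: "sets R.\<nu> = sets \<mu>" by (simp add: nu sets_a)
  have lm: "l \<in> borel_measurable \<mu>" using assms(8) measurable_cong_sets[OF sets_mu refl] by blast
  define h where "h u = 1 / (1 + (cmod (l u))\<^sup>2)" for u
  have hm [measurable]: "h \<in> borel_measurable \<mu>" unfolding h_def using lm by measurable
  have h01: "0 < h u" "h u \<le> 1" for u unfolding h_def by (rule filter_cost_pointwise)+
  have h_abs: "\<bar>h u\<bar> \<le> 1" "\<bar>1 - h u\<bar> \<le> 1" for u using h01[of u] by auto
  define L where "L = (\<integral>\<omega>. (cmod (B 0 \<omega>))\<^sup>2 \<partial>M) - (\<integral>u. 1 / (1 + (cmod (l u))\<^sup>2) \<partial>\<mu>\<^sub>s)"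
  have i_h: "integrable \<mu> (\<lambda>u. indicator N u * h u)"
    by (rule mu.integrable_const_bound[where B=1]) (use h_abs N_sets in \<open>auto simp: indicator_def\<close>)
  have i_1h: "integrable \<mu> (\<lambda>u. indicator N u * (1 - h u))"
    by (rule mu.integrable_const_bound[where B=1])
       (use h_abs N_sets in \<open>auto simp: indicator_def\<close>)
  have L2_one: "(\<lambda>u. 1) \<in> L2_space \<mu>" by (rule L2_bounded[OF finite_mu]) auto
  have f_norm: "(\<integral>u. f\<^sub>a u * (cmod (X u))\<^sup>2 \<partial>lebesgue_pi) = (l2norm R.\<nu> X)\<^sup>2" if "X \<in> borel_measurable \<mu>" for X
  proof -
    have "X \<in> borel_measurable lebesgue_pi" using that measurable_cong_sets[OF sets_mu refl] by blast
    then show ?thesis unfolding l2norm_sq by (subst R.integral_nu) auto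
  qed
  have L_eq: "L = (\<integral>u. indicator N u * (1 - h u) \<partial>\<mu>) + (l2norm R.\<nu> (\<lambda>u. 1))\<^sup>2"
  proof -
    have "(\<integral>\<omega>. (cmod (B 0 \<omega>))\<^sup>2 \<partial>M) = (l2norm \<mu> (\<lambda>u. 1))\<^sup>2"
      using corresponds_norm[OF corresponds_generator[of 0]] by (simp add: l2norm_sq[symmetric] character_fun)
    also have "\<dots> = (\<integral>u. indicator N u \<partial>\<mu>) + (l2norm R.\<nu> (\<lambda>u. 1))\<^sup>2"
      using S.l2norm_split[OF L2_one] f_norm[of "\<lambda>u. 1"] by simp
    finally have 1: "(\<integral>\<omega>. (cmod (B 0 \<omega>))\<^sup>2 \<partial>M) = (\<integral>u. indicator N u \<partial>\<mu>) + (l2norm R.\<nu> (\<lambda>u. 1))\<^sup>2" .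
    have "(\<integral>u. h u \<partial>\<mu>\<^sub>s) = integral\<^sup>L (density \<mu> (\<lambda>u. ennreal (indicator N u))) h"
      by (simp add: on_N[symmetric] ennreal_indicator)
    also have "\<dots> = (\<integral>u. indicator N u * h u \<partial>\<mu>)"
      using N_sets by (subst integral_density) auto
    finally have 2: "(\<integral>u. 1 / (1 + (cmod (l u))\<^sup>2) \<partial>\<mu>\<^sub>s) = (\<integral>u. indicator N u * h u \<partial>\<mu>)"
      by (simp add: h_def)
    have "integrable \<mu> (indicator N :: real \<Rightarrow> real)" using N_sets by (simp add: mu.emeasure_finite less_top[symmetric])
    then have "(\<integral>u. indicator N u - indicator N u * h u \<partial>\<mu>) = (\<integral>u. indicator N u \<partial>\<mu>) - (\<integral>u. indicator N u * h u \<partial>\<mu>)"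
      using i_h by (rule Bochner_Integration.integral_diff)
    then show ?thesis unfolding L_def 1 2 by (simp add: right_diff_distrib)
  qed
  define cost where "cost Y = (\<integral>\<omega>. (cmod (Y \<omega> - B 0 \<omega>))\<^sup>2 \<partial>M) + (\<integral>\<omega>. (cmod (linear_filter M B \<mu> l Y \<omega>))\<^sup>2 \<partial>M)" for Y
  define D where "D t = closed_lin_span M B {..t} \<inter> filter_domain M B \<mu> l" for t
  have cost_eq: "cost Y = (l2norm \<mu> (\<lambda>u. spectral_rep M B \<mu> Y u - 1))\<^sup>2 + (l2norm \<mu> (\<lambda>u. l u * spectral_rep M B \<mu> Y u))\<^sup>2"
    and l_L2: "(\<lambda>u. l u * spectral_rep M B \<mu> Y u) \<in> L2_space \<mu>"
    and rep: "corresponds (spectral_rep M B \<mu> Y) Y" if Y: "Y \<in> filter_domain M B \<mu> l" for Y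
  proof -
    let ?\<phi> = "spectral_rep M B \<mu> Y"
    show c: "corresponds ?\<phi> Y"
      using Y unfolding filter_domain_def by (intro spectral_rep_corresponds) simp
    have m: "(\<lambda>u. l u * ?\<phi> u) \<in> borel_measurable \<mu>"
      using lm L2_D(1)[OF corresponds_L2(1)[OF c]] by measurable
    show lL: "(\<lambda>u. l u * ?\<phi> u) \<in> L2_space \<mu>"
      unfolding L2_space_def using Y m
      by (auto simp: filter_domain_def intro!: integrableI_bounded)
    have 1: "(\<integral>\<omega>. (cmod (Y \<omega> - B 0 \<omega>))\<^sup>2 \<partial>M) = (l2norm \<mu> (\<lambda>u. ?\<phi> u - 1))\<^sup>2"
      using corresponds_norm[OF corresponds_diff[OF c corresponds_generator[of 0]]]
      by (simp add: l2norm_sq[symmetric] character_fun)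
    have 2: "(\<integral>\<omega>. (cmod (linear_filter M B \<mu> l Y \<omega>))\<^sup>2 \<partial>M) = (l2norm \<mu> (\<lambda>u. l u * ?\<phi> u))\<^sup>2"
      using corresponds_norm[OF stoch_int_corresponds[OF lL]] by (simp add: l2norm_sq[symmetric] linear_filter_def)
    show "cost Y = (l2norm \<mu> (\<lambda>u. ?\<phi> u - 1))\<^sup>2 + (l2norm \<mu> (\<lambda>u. l u * ?\<phi> u))\<^sup>2"
      unfolding cost_def 1 2 ..
  qed
  (* The competitor 1_N h belongs to every past and attains the limit value. *)
  have ex_opt: "\<exists>Y\<in>D t. cost Y = L" for t
  proof -
    define \<phi> where "\<phi> u = indicator N u * complex_of_real (h u)" for u
    have "(\<lambda>u. complex_of_real (h u)) \<in> L2_space \<mu>"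
      by (rule L2_bounded[OF finite_mu, where C=1]) (use h01 hm in \<open>auto simp: abs_of_pos\<close>)
    from future_closure_cnj[OF S.singular_part_in_future[OF this, of "- t"]]
    have "(\<lambda>u. cnj (indicator N u * complex_of_real (h u))) \<in> closed_lin_span \<mu> character {..t}"
      by (simp only: minus_minus)
    moreover have "cnj (indicator N u * complex_of_real (h u)) = \<phi> u" for u
      by (simp add: \<phi>_def indicator_def)
    ultimately have span: "\<phi> \<in> closed_lin_span \<mu> character {..t}" by (simp only:)
    have phiL: "\<phi> \<in> L2_space \<mu>" using span by (simp add: closed_lin_span_iff)
    obtain Y where Y: "corresponds \<phi> Y" using ex_integral[OF phiL] by blast
    have Yt: "Y \<in> closed_lin_span M B {..t}" by (rule corresponds_closed_lin_span[OF Y span])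
    then have YU: "Y \<in> closed_lin_span M B UNIV" using closed_lin_span_mono[of "{..t}" UNIV] by blast
    let ?\<psi> = "spectral_rep M B \<mu> Y"
    note c = spectral_rep_corresponds[OF YU]
    have "l2norm \<mu> (\<lambda>u. ?\<psi> u - \<phi> u) = 0"
      using corresponds_norm[OF corresponds_diff[OF c Y]] by (simp add: l2norm_def)
    from l2norm_eq_0_AE[OF L2_diff[OF corresponds_L2(1)[OF c] phiL] this]
    have eq: "AE u in \<mu>. ?\<psi> u = \<phi> u" by eventually_elim simp
    have lphi: "(cmod (l u * \<phi> u))\<^sup>2 \<le> 1" for u
    proof -
      have "(cmod (l u * of_real (h u)))\<^sup>2 \<le> 1"
        using filter_cost_pointwise(2)[of "l u"] h01[of u] zero_le_power2[of "cmod (of_real (h u) - 1)"]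
        unfolding h_def[symmetric] by linarith
      then show ?thesis by (simp add: \<phi>_def indicator_def)
    qed
    have phim [measurable]: "\<phi> \<in> borel_measurable \<mu>" by (rule L2_D(1)[OF phiL])
    have lphim: "(\<lambda>u. l u * \<phi> u) \<in> borel_measurable \<mu>" using lm by measurable
    have lphiL: "(\<lambda>u. l u * \<phi> u) \<in> L2_space \<mu>"
    proof (rule L2_bounded[OF finite_mu lphim])
      show "cmod (l u * \<phi> u) \<le> 1" for u by (rule power2_le_imp_le) (simp_all only: lphi power_one zero_le_one)
    qed
    have "(\<integral>\<^sup>+u. ennreal ((cmod (l u * ?\<psi> u))\<^sup>2) \<partial>\<mu>) = (\<integral>\<^sup>+u. ennreal ((cmod (l u * \<phi> u))\<^sup>2) \<partial>\<mu>)"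
      by (rule nn_integral_cong_AE) (use eq in eventually_elim, simp)
    also have "\<dots> = ennreal ((l2norm \<mu> (\<lambda>u. l u * \<phi> u))\<^sup>2)"
      unfolding l2norm_sq by (rule nn_integral_eq_integral[OF L2_D(2)[OF lphiL]]) simp
    also have "\<dots> < \<infinity>" by simp
    finally have dom: "Y \<in> filter_domain M B \<mu> l" using YU by (simp add: filter_domain_def)
    have n1: "l2norm \<mu> (\<lambda>u. ?\<psi> u - 1) = l2norm \<mu> (\<lambda>u. \<phi> u - 1)"
      using eq by (intro l2norm_cong_AE L2_D(1) L2_diff corresponds_L2(1)[OF c] phiL L2_one) (auto elim: eventually_mono)
    have n2: "l2norm \<mu> (\<lambda>u. l u * ?\<psi> u) = l2norm \<mu> (\<lambda>u. l u * \<phi> u)"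
      using eq by (intro l2norm_cong_AE L2_D(1)[OF l_L2[OF dom]] lphim) (auto elim: eventually_mono)
    have p1L: "(\<lambda>u. \<phi> u - 1) \<in> L2_space \<mu>" by (intro L2_diff phiL L2_one)
    have int1: "integrable \<mu> (\<lambda>u. indicator N u * (cmod (X u))\<^sup>2)" if "X \<in> L2_space \<mu>" for X
      using integrable_mult_indicator[OF N_sets L2_D(2)[OF that]] by simp
    have off: "(\<integral>u. f\<^sub>a u * (cmod (\<phi> u - 1))\<^sup>2 \<partial>lebesgue_pi) = (l2norm R.\<nu> (\<lambda>u. 1))\<^sup>2"
      "(\<integral>u. f\<^sub>a u * (cmod (l u * \<phi> u))\<^sup>2 \<partial>lebesgue_pi) = 0"
    proof -
      have ae: "AE u in R.\<nu>. u \<notin> N"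
        using N_a N_sets by (intro AE_not_in null_setsI) (auto simp: nu sets_a)
      have mn: "X \<in> borel_measurable \<mu> \<Longrightarrow> X \<in> borel_measurable R.\<nu>" for X :: "real \<Rightarrow> complex"
        using measurable_cong_sets[OF nu_sets refl] by blast
      have "l2norm R.\<nu> (\<lambda>u. \<phi> u - 1) = l2norm R.\<nu> (\<lambda>u. - 1)"
        using ae by (intro l2norm_cong_AE mn L2_D(1)[OF p1L]) (auto simp: \<phi>_def elim: eventually_mono)
      then show "(\<integral>u. f\<^sub>a u * (cmod (\<phi> u - 1))\<^sup>2 \<partial>lebesgue_pi) = (l2norm R.\<nu> (\<lambda>u. 1))\<^sup>2"
        using f_norm[OF L2_D(1)[OF p1L]] by (simp add: l2norm_def)
      have "l2norm R.\<nu> (\<lambda>u. l u * \<phi> u) = l2norm R.\<nu> (\<lambda>u. 0)"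
        using ae by (intro l2norm_cong_AE mn lphim) (auto simp: \<phi>_def elim: eventually_mono)
      then show "(\<integral>u. f\<^sub>a u * (cmod (l u * \<phi> u))\<^sup>2 \<partial>lebesgue_pi) = 0"
        using f_norm[OF lphim] by (simp add: l2norm_def)
    qed
    have "cost Y = (\<integral>u. indicator N u * (cmod (\<phi> u - 1))\<^sup>2 \<partial>\<mu>) + (\<integral>u. indicator N u * (cmod (l u * \<phi> u))\<^sup>2 \<partial>\<mu>) + (l2norm R.\<nu> (\<lambda>u. 1))\<^sup>2"
      unfolding cost_eq[OF dom] n1 n2 S.l2norm_split[OF p1L] S.l2norm_split[OF lphiL] off by simp
    also have "(\<integral>u. indicator N u * (cmod (\<phi> u - 1))\<^sup>2 \<partial>\<mu>) + (\<integral>u. indicator N u * (cmod (l u * \<phi> u))\<^sup>2 \<partial>\<mu>)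
       = (\<integral>u. indicator N u * (cmod (\<phi> u - 1))\<^sup>2 + indicator N u * (cmod (l u * \<phi> u))\<^sup>2 \<partial>\<mu>)"
      by (rule Bochner_Integration.integral_add[symmetric, OF int1[OF p1L] int1[OF lphiL]])
    also have "\<dots> = (\<integral>u. indicator N u * (1 - h u) \<partial>\<mu>)"
    proof (rule Bochner_Integration.integral_cong[OF refl])
      fix u
      show "indicator N u * (cmod (\<phi> u - 1))\<^sup>2 + indicator N u * (cmod (l u * \<phi> u))\<^sup>2 = indicator N u * (1 - h u)"
        using filter_cost_pointwise(2)[of "l u"] unfolding h_def[symmetric]
        by (cases "u \<in> N") (auto simp: \<phi>_def)
    qed
    finally have "cost Y = L" using L_eq by simp
    then show ?thesis using Yt dom by (auto simp: D_def)
  qed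
  (* On N the pointwise bound applies; off N only the term |phi - 1|^2 is kept. *)
  have lower: "(\<integral>u. indicator N u * (1 - h u) \<partial>\<mu>) + (l2norm R.\<nu> (\<lambda>u. spectral_rep M B \<mu> Y u - 1))\<^sup>2 \<le> cost Y"
    if Y: "Y \<in> filter_domain M B \<mu> l" for Y
  proof -
    let ?\<phi> = "spectral_rep M B \<mu> Y"
    have p1L: "(\<lambda>u. ?\<phi> u - 1) \<in> L2_space \<mu>" by (intro L2_diff corresponds_L2(1)[OF rep[OF Y]] L2_one)
    note lphiL = l_L2[OF Y]
    have int1: "integrable \<mu> (\<lambda>u. indicator N u * (cmod (X u))\<^sup>2)" if "X \<in> L2_space \<mu>" for X
      using integrable_mult_indicator[OF N_sets L2_D(2)[OF that]] by simp
    have "(\<integral>u. indicator N u * (1 - h u) \<partial>\<mu>)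
       \<le> (\<integral>u. indicator N u * (cmod (?\<phi> u - 1))\<^sup>2 + indicator N u * (cmod (l u * ?\<phi> u))\<^sup>2 \<partial>\<mu>)"
    proof (rule integral_mono[OF i_1h Bochner_Integration.integrable_add[OF int1[OF p1L] int1[OF lphiL]]])
      fix u
      show "indicator N u * (1 - h u) \<le> indicator N u * (cmod (?\<phi> u - 1))\<^sup>2 + indicator N u * (cmod (l u * ?\<phi> u))\<^sup>2"
        using filter_cost_pointwise(1)[of "l u" "?\<phi> u"] unfolding h_def[symmetric]
        by (cases "u \<in> N") auto
    qed
    also have "\<dots> = (\<integral>u. indicator N u * (cmod (?\<phi> u - 1))\<^sup>2 \<partial>\<mu>) + (\<integral>u. indicator N u * (cmod (l u * ?\<phi> u))\<^sup>2 \<partial>\<mu>)"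
      by (rule Bochner_Integration.integral_add[OF int1[OF p1L] int1[OF lphiL]])
    finally have "(\<integral>u. indicator N u * (1 - h u) \<partial>\<mu>) + (l2norm R.\<nu> (\<lambda>u. ?\<phi> u - 1))\<^sup>2
      \<le> (l2norm \<mu> (\<lambda>u. ?\<phi> u - 1))\<^sup>2 + (l2norm \<mu> (\<lambda>u. l u * ?\<phi> u))\<^sup>2"
      unfolding S.l2norm_split[OF p1L] S.l2norm_split[OF lphiL] f_norm[OF L2_D(1)[OF p1L]] f_norm[OF L2_D(1)[OF lphiL]]
      using zero_le_power2[of "l2norm R.\<nu> (\<lambda>u. l u * ?\<phi> u)"] by linarith
    then show ?thesis unfolding cost_eq[OF Y] .
  qed
  have pe: "prediction_error M B \<mu> l t = (INF Y\<in>D t. cost Y)" for t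
    unfolding prediction_error_def cost_def D_def ..
  have bdd: "bdd_below (cost ` D t)" for t
    by (rule bdd_belowI2[of _ 0]) (simp add: cost_def)
  have upper: "prediction_error M B \<mu> l t \<le> L" for t
  proof -
    obtain Y where "Y \<in> D t" "cost Y = L" using ex_opt by blast
    then show ?thesis unfolding pe using cINF_lower[OF bdd[of t]] by metis
  qed
  have far: "\<exists>t0. \<forall>t\<le>t0. L - e \<le> prediction_error M B \<mu> l t" if e: "0 < e" for e
  proof -
    obtain n0 where n0: "\<And>n Q. n0 \<le> n \<Longrightarrow> (l2norm R.\<nu> (\<lambda>u. 1))\<^sup>2 - e \<le> (l2norm R.\<nu> (\<lambda>u. tpoly n Q u - 1))\<^sup>2"
      using R.distance_from_remote_future[OF e] by blast
    have "L - e \<le> prediction_error M B \<mu> l t" if t: "t \<le> - n0" for t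
      unfolding pe
    proof (rule cINF_greatest)
      show "D t \<noteq> {}" using ex_opt[of t] by blast
      fix Y assume Y: "Y \<in> D t"
      then have dom: "Y \<in> filter_domain M B \<mu> l" and Yt: "Y \<in> closed_lin_span M B {..t}" by (auto simp: D_def)
      let ?\<phi> = "spectral_rep M B \<mu> Y"
      have phi_t: "?\<phi> \<in> closed_lin_span \<mu> character {..t}"
        using closed_lin_span_corresponds_iff[OF rep[OF dom]] Yt by blast
      have phiL: "?\<phi> \<in> L2_space \<mu>" by (rule corresponds_L2(1)[OF rep[OF dom]])
      have "(l2norm R.\<nu> (\<lambda>u. 1))\<^sup>2 - e \<le> (l2norm R.\<nu> (\<lambda>u. ?\<phi> u - 1))\<^sup>2"
      proof (rule ccontr)
        assume "\<not> ?thesis"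
        then have lt: "(l2norm R.\<nu> (\<lambda>u. ?\<phi> u - 1))\<^sup>2 < (l2norm R.\<nu> (\<lambda>u. 1))\<^sup>2 - e" by simp
        let ?K = "(l2norm R.\<nu> (\<lambda>u. 1))\<^sup>2 - e"
        (* A violation would persist for a trigonometric polynomial close to phi, whose conjugate has frequencies at least - t. *)
        have lt': "l2norm R.\<nu> (\<lambda>u. ?\<phi> u - 1) < sqrt ?K" using lt by (rule real_less_rsqrt)
        then have "0 < sqrt ?K - l2norm R.\<nu> (\<lambda>u. ?\<phi> u - 1)" by simp
        then obtain F c where F: "finite F" "F \<subseteq> {..t}"
          "l2norm \<mu> (\<lambda>u. ?\<phi> u - lin_comb character F c u) < sqrt ?K - l2norm R.\<nu> (\<lambda>u. ?\<phi> u - 1)"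
          using phi_t unfolding closed_lin_span_iff by blast
        let ?p = "lin_comb character F c"
        have pL: "?p \<in> L2_space \<mu>" by (rule lin_comb_L2[OF b])
        obtain Q where Q: "\<And>u. cnj (?p u) = tpoly (- t) Q u" using cnj_lin_comb_tpoly[OF F(1,2)] by blast
        have "cmod (tpoly (- t) Q u - 1) = cmod (?p u - 1)" for u
          unfolding Q[symmetric] by (metis complex_cnj_diff complex_cnj_one complex_mod_cnj)
        then have "?K \<le> (l2norm R.\<nu> (\<lambda>u. ?p u - 1))\<^sup>2"
          using n0[of "- t" Q] t by (simp add: l2norm_def)
        then have "sqrt ?K \<le> l2norm R.\<nu> (\<lambda>u. ?p u - 1)" by (rule real_le_lsqrt[OF l2norm_nonneg])
        also have "\<dots> \<le> l2norm R.\<nu> (\<lambda>u. ?p u - ?\<phi> u) + l2norm R.\<nu> (\<lambda>u. ?\<phi> u - 1)"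
          by (intro l2norm_triangle_diff L2_mono_measure(1)[OF nu_sets nu_le] pL phiL L2_one)
        also have "l2norm R.\<nu> (\<lambda>u. ?p u - ?\<phi> u) \<le> l2norm \<mu> (\<lambda>u. ?p u - ?\<phi> u)"
          by (intro L2_mono_measure(2)[OF nu_sets nu_le] L2_diff pL phiL)
        finally show False using F(3) l2norm_minus_commute[of \<mu> ?p ?\<phi>] by simp
      qed
      then show "L - e \<le> cost Y" using lower[OF dom] L_eq by linarith
    qed
    then show ?thesis by blast
  qed
  have "((\<lambda>t. prediction_error M B \<mu> l t) \<longlongrightarrow> L) at_bot"
  proof (rule tendstoI)
    fix e :: real assume "0 < e"
    then obtain t0 where t0: "\<And>t. t \<le> t0 \<Longrightarrow> L - e / 2 \<le> prediction_error M B \<mu> l t"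
      using far[of "e / 2"] by auto
    have "dist (prediction_error M B \<mu> l t) L < e" if "t \<le> t0" for t
      using t0[OF that] upper[of t] \<open>0 < e\<close> by (simp add: dist_real_def)
    then show "\<forall>\<^sub>F t in at_bot. dist (prediction_error M B \<mu> l t) L < e"
      by (auto simp: eventually_at_bot_linorder)
  qed
  then show ?thesis unfolding L_def .
qed

end
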